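(* Let $\mathbb{K}$ be a field, let $\mathcal{H}$ be a (simple) hypergraph on vertex set $\{x_1,\ldots,x_n\}$, and let $I=I(\mathcal{H})$ be the corresponding square-free monomial ideal in $R=\mathbb{K}[x_1,\ldots,x_n]$, assumed nonzero and proper. Let $E_1,\ldots,E_s$ be an induced matching of $\mathcal{H}$ with $|E_1|=d(I)$. If $\mathrm{v}(I)\le\sum_{i=1}^s(|E_i|-1)$, then $\mathrm{v}(I^{(k)})\le\mathrm{reg}(R/I^{(k)})$ for all $k\ge 1$. Moreover, if $I$ has the strong persistence property and $\mathrm{v}(I)\le\sum_{i=1}^s(|E_i|-1)$, then $\mathrm{v}(I^k)\le\mathrm{reg}(R/I^k)$ for all $k\ge 1$.
   Context: $R$ has its standard grading. A simple hypergraph $\mathcal{H}$ is a pair $(V(\mathcal{H}),E(\mathcal{H}))$ with $V(\mathcal{H})$ a finite vertex set and $E(\mathcal{H})$ a collection of subsets of $V(\mathcal{H})$ (edges), no edge containing another. Its edge ideal is $I(\mathcal{H})=(\prod_{x_i\in e}x_i\mid e\in E(\mathcal{H}))\subseteq R$. The induced subhypergraph on $W\subseteq V(\mathcal{H})$ has vertex set $W$ and edges all edges of $\mathcal{H}$ contained in $W$. A collection $\{E_1,\ldots,E_s\}$ of edges is an induced matching if the $E_i$ are pairwise disjoint and are exactly the edges of the induced subhypergraph on $\bigcup_{i=1}^sE_i$. $d(I)$ denotes the maximum degree of a minimal generator of $I$. $I$ has the strong persistence property if $(I^{k+1}:I)=I^k$ for all $k\ge 1$. The $k$-th symbolic power is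 $I^{(k)}=\bigcap_{P\in\mathrm{Min}(I)}(I^kR_P\cap R)$, where $\mathrm{Min}(I)=\mathrm{Ass}(R/I)$ is the set of minimal primes of $I$. For a proper graded ideal $J\subset R$, the v-number is $\mathrm{v}(J)=\min\{e\ge 0\mid \exists f\in R_e,\ \mathfrak{p}\in\mathrm{Ass}(J)\text{ with }(J:f)=\mathfrak{p}\}$, where $\mathrm{Ass}(J)$ is the set of associated primes of $R/J$, and $\mathrm{reg}(R/J)=\max\{j-i\mid\beta_{i,j}(R/J)\ne 0\}$ is the Castelnuovo-Mumford regularity ($\beta_{i,j}$ the graded Betti numbers). *)

theory Defs
  imports
    "HOL-Library.Poly_Mapping"
    "HOL-Library.Disjoint_Sets"
    "HOL-Computational_Algebra.Polynomial_Factorial"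
    "Jordan_Normal_Form.Matrix"
begin

section \<open>Ideals in a commutative ring\<close>

abbreviation ideal_gen :: "'a::comm_ring_1 set \<Rightarrow> 'a set" where
  "ideal_gen \<equiv> module.span (*)"

abbreviation is_ideal :: "'a::comm_ring_1 set \<Rightarrow> bool" where
  "is_ideal \<equiv> module.subspace (*)"

primrec ideal_power :: "'a::comm_ring_1 set \<Rightarrow> nat \<Rightarrow> 'a set" where
  "ideal_power I 0 = UNIV"
| "ideal_power I (Suc k) = ideal_gen {a * b | a b. a \<in> I \<and> b \<in> ideal_power I k}"

definition colon :: "'a::comm_ring_1 set \<Rightarrow> 'a set \<Rightarrow> 'a set" where
  "colon J S = {g. \<forall>f\<in>S. g * f \<in> J}"

definition is_prime_ideal :: "'a::comm_ring_1 set \<Rightarrow> bool" where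
  "is_prime_ideal P \<longleftrightarrow>
     is_ideal P \<and> P \<noteq> UNIV \<and> (\<forall>a b. a * b \<in> P \<longrightarrow> a \<in> P \<or> b \<in> P)"

text \<open>The associated primes of the module \<open>R/J\<close>: the annihilator of the class of \<open>f\<close> is \<open>(J : f)\<close>.\<close>

definition Ass :: "'a::comm_ring_1 set \<Rightarrow> 'a set set" where
  "Ass J = {P. is_prime_ideal P \<and> (\<exists>f. P = colon J {f})}"

definition minimal_primes :: "'a::comm_ring_1 set \<Rightarrow> 'a set set" where
  "minimal_primes I = {P. is_prime_ideal P \<and> I \<subseteq> P \<and>
     (\<forall>Q. is_prime_ideal Q \<and> I \<subseteq> Q \<and> Q \<subseteq> P \<longrightarrow> Q = P)}"

text \<open>For a domain \<open>R\<close>, the localization \<open>R\<^sub>P\<close> is regarded as a subring of the field of fractions;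
  the extension \<open>J R\<^sub>P\<close> is then the set of all fractions with numerator in \<open>J\<close> and denominator
  outside \<open>P\<close>.\<close>

definition localized_ideal :: "'a::idom set \<Rightarrow> 'a set \<Rightarrow> 'a fract set" where
  "localized_ideal P J = {Fract a s | a s. a \<in> J \<and> s \<notin> P}"

definition symbolic_power :: "'a::idom set \<Rightarrow> nat \<Rightarrow> 'a set" where
  "symbolic_power I k =
     (\<Inter>P\<in>minimal_primes I. {f. to_fract f \<in> localized_ideal P (ideal_power I k)})"

definition strong_persistence :: "'a::comm_ring_1 set \<Rightarrow> bool" where
  "strong_persistence I \<longleftrightarrow> (\<forall>k\<ge>1. colon (ideal_power I (k + 1)) I = ideal_power I k)"


section \<open>The standard graded polynomial ring\<close>

text \<open>The variables are indexed by \<open>'x\<close>, instantiated below by finite linearly ordered types.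
  The order on \<open>'x\<close> only serves to make the polynomial ring an instance of \<^class>\<open>idom\<close>.\<close>

type_synonym ('x, 'k) mpoly = "('x \<Rightarrow>\<^sub>0 nat) \<Rightarrow>\<^sub>0 'k"

definition Var :: "'x \<Rightarrow> ('x, 'k::comm_ring_1) mpoly" where
  "Var x = Poly_Mapping.single (Poly_Mapping.single x 1) 1"

definition mon_deg :: "('x \<Rightarrow>\<^sub>0 nat) \<Rightarrow> nat" where
  "mon_deg m = (\<Sum>x\<in>Poly_Mapping.keys m. Poly_Mapping.lookup m x)"

text \<open>The graded component \<open>R\<^sub>e\<close>; it contains \<open>0\<close>.\<close>

definition graded_part :: "nat \<Rightarrow> ('x, 'k::comm_ring_1) mpoly set" where
  "graded_part e = {f. \<forall>m\<in>Poly_Mapping.keys f. mon_deg m = e}"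

definition min_generating_set ::
    "('x, 'k::comm_ring_1) mpoly set \<Rightarrow> ('x, 'k) mpoly set \<Rightarrow> bool" where
  "min_generating_set J G \<longleftrightarrow>
     (\<forall>g\<in>G. \<exists>e. g \<in> graded_part e) \<and> ideal_gen G = J \<and> (\<forall>G'. G' \<subset> G \<longrightarrow> ideal_gen G' \<noteq> J)"

definition max_gen_degree :: "('x, 'k::comm_ring_1) mpoly set \<Rightarrow> nat" where
  "max_gen_degree J = Max {e. \<exists>G g. min_generating_set J G \<and> g \<in> G \<and> g \<in> graded_part e}"

definition v_number :: "('x, 'k::comm_ring_1) mpoly set \<Rightarrow> nat" where
  "v_number J = (LEAST e. \<exists>f P. f \<in> graded_part e \<and> P \<in> Ass J \<and> colon J {f} = P)"


section \<open>Graded Betti numbers and regularity\<close>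

text \<open>A minimal graded free resolution
  \<open>\<dots> \<rightarrow> F\<^sub>2 \<rightarrow> F\<^sub>1 \<rightarrow> F\<^sub>0 \<rightarrow> R/J \<rightarrow> 0\<close> with \<open>F\<^sub>i = \<Oplus>\<^sub>r R(-(D i ! r))\<close>, where \<open>A i\<close> is the matrix of
  \<open>F\<^sub>i\<^sub>+\<^sub>1 \<rightarrow> F\<^sub>i\<close> and the augmentation \<open>F\<^sub>0 \<rightarrow> R/J\<close> sends the \<open>r\<close>-th basis element to the class
  of \<open>g $ r\<close>. Free modules of rank 0 are allowed, so finite resolutions are included.
  The shifts can be taken in \<^typ>\<open>nat\<close> since \<open>R/J\<close> lives in nonnegative degrees.\<close>

definition minimal_graded_free_resolution ::
    "('x, 'k::comm_ring_1) mpoly set \<Rightarrow> (nat \<Rightarrow> nat list) \<Rightarrow>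
     ('x, 'k) mpoly vec \<Rightarrow> (nat \<Rightarrow> ('x, 'k) mpoly mat) \<Rightarrow> bool" where
  "minimal_graded_free_resolution J D g A \<longleftrightarrow>
     \<comment> \<open>graded maps of degree 0\<close>
     g \<in> carrier_vec (length (D 0)) \<and>
     (\<forall>r<length (D 0). g $ r \<in> graded_part (D 0 ! r)) \<and>
     (\<forall>i. A i \<in> carrier_mat (length (D i)) (length (D (Suc i)))) \<and>
     (\<forall>i. \<forall>r<length (D i). \<forall>c<length (D (Suc i)).
        \<forall>m\<in>Poly_Mapping.keys (A i $$ (r, c)). D i ! r + mon_deg m = D (Suc i) ! c) \<and>
     \<comment> \<open>exactness at \<open>R/J\<close>, at \<open>F\<^sub>0\<close>, and at \<open>F\<^sub>i\<close> for positive \<open>i\<close>\<close>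
     (\<forall>f. \<exists>v\<in>carrier_vec (length (D 0)). f - g \<bullet> v \<in> J) \<and>
     {v \<in> carrier_vec (length (D 0)). g \<bullet> v \<in> J} =
       (\<lambda>w. A 0 *\<^sub>v w) ` carrier_vec (length (D 1)) \<and>
     (\<forall>i. {v \<in> carrier_vec (length (D (Suc i))). A i *\<^sub>v v = 0\<^sub>v (length (D i))} =
       (\<lambda>w. A (Suc i) *\<^sub>v w) ` carrier_vec (length (D (Suc (Suc i))))) \<and>
     \<comment> \<open>minimality: the image of \<open>F\<^sub>i\<^sub>+\<^sub>1\<close> lies in \<open>(x\<^sub>1, \<dots>, x\<^sub>n) F\<^sub>i\<close>\<close>
     (\<forall>i. \<forall>r<length (D i). \<forall>c<length (D (Suc i)).
        A i $$ (r, c) \<in> ideal_gen (range Var))"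

text \<open>The Betti number \<open>\<beta>\<^sub>i\<^sub>,\<^sub>j(R/J)\<close> of a graded ideal \<open>J\<close> is the number of summands \<open>R(-j)\<close> of
  \<open>F\<^sub>i\<close>; as a minimal graded free resolution is unique up to isomorphism, the choice is immaterial.\<close>

definition betti :: "('x, 'k::comm_ring_1) mpoly set \<Rightarrow> nat \<Rightarrow> nat \<Rightarrow> nat" where
  "betti J i j = count_list ((SOME D. \<exists>g A. minimal_graded_free_resolution J D g A) i) j"

text \<open>The regularity of \<open>R/J\<close> (not of \<open>J\<close>).\<close>

definition reg_quotient :: "('x, 'k::comm_ring_1) mpoly set \<Rightarrow> int" where
  "reg_quotient J = Max {int j - int i | i j. betti J i j \<noteq> 0}"


section \<open>Hypergraphs\<close>

type_synonym 'x hypergraph = "'x set \<times> 'x set set"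

abbreviation vertices :: "'x hypergraph \<Rightarrow> 'x set" where
  "vertices \<equiv> fst"

abbreviation edges :: "'x hypergraph \<Rightarrow> 'x set set" where
  "edges \<equiv> snd"

definition simple_hypergraph :: "'x hypergraph \<Rightarrow> bool" where
  "simple_hypergraph H \<longleftrightarrow> finite (vertices H) \<and> (\<forall>e\<in>edges H. e \<subseteq> vertices H) \<and>
     (\<forall>e\<in>edges H. \<forall>e'\<in>edges H. e \<subseteq> e' \<longrightarrow> e = e')"

definition edge_ideal :: "'x hypergraph \<Rightarrow> ('x, 'k::comm_ring_1) mpoly set" where
  "edge_ideal H = ideal_gen ((\<lambda>e. \<Prod>x\<in>e. Var x) ` edges H)"

definition induced_subhypergraph :: "'x hypergraph \<Rightarrow> 'x set \<Rightarrow> 'x hypergraph" where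
  "induced_subhypergraph H W = (W, {e \<in> edges H. e \<subseteq> W})"

definition induced_matching :: "'x hypergraph \<Rightarrow> 'x set set \<Rightarrow> bool" where
  "induced_matching H M \<longleftrightarrow>
     M \<subseteq> edges H \<and> disjoint M \<and> edges (induced_subhypergraph H (\<Union>M)) = M"

end

theory Submission
  imports Defs "HOL-Library.Function_Algebras"
begin

text \<open>Put \<open>d = |E\<^sub>1|\<close> and let \<open>J\<close> be \<open>I\<^sup>k\<close> or \<open>I\<^sup>(\<^sup>k\<^sup>)\<close>. In both cases \<open>(J : I\<^sup>k\<^sup>-\<^sup>1) = I\<close>, so if \<open>(I : f)\<close> is an
  associated prime, it is the finite intersection of the ideals \<open>(J : f u)\<close>, where \<open>u\<close> runs over the
  products of \<open>k - 1\<close> edge monomials. A prime equals one of the ideals in a finite intersection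
  representing it, whence \<open>v(J) \<le> v(I) + (k - 1) d\<close>.

  For the regularity, the chain complex of a minimal resolution and the Koszul complex of the
  variables are compared one syzygy module at a time: \<open>\<beta>\<^sub>i\<^sub>,\<^sub>j(R/J) \<noteq> 0\<close> iff the \<open>i\<close>-th Koszul homology of
  \<open>R/J\<close> is nonzero in degree \<open>j\<close>. Koszul homology vanishes in multidegrees with an exponent exceeding
  \<open>k\<close>; this gives finite generation of all syzygies, hence the existence of the resolution. Finally,
  choose a vertex \<open>v\<^sub>i\<close> in each \<open>E\<^sub>i\<close> and let \<open>m\<close> be the product of all variables in the matching, divided
  by \<open>v\<^sub>1 \<cdots> v\<^sub>s\<close> and multiplied by the \<open>(k-1)\<close>-st power of the edge monomial of \<open>E\<^sub>1\<close>. Then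
  \<open>m e(v\<^sub>1) \<and> \<dots> \<and> e(v\<^sub>s)\<close> is a Koszul cycle modulo \<open>J\<close>. It is not a boundary, as the sum of coefficients
  over all transversals of the matching vanishes on boundaries. So
  \<open>reg(R/J) \<ge> (k - 1) d + \<Sum> (|E\<^sub>i| - 1)\<close>.\<close>

text \<open>\<open>betti\<close> picks a resolution by \<open>SOME\<close> and
  \<open>reg_quotient\<close> is a \<open>Max\<close>, so a lower bound for the regularity can be
  read off only after a minimal resolution is known to exist and the Betti table is known to be
  finite. Koszul homology yields both: its degree bound for R/J passes to every syzygy module, which
  replaces the Hilbert basis theorem, and there are no sets of more than n variables.

  The colon equality comes from iterating strong persistence for ordinary powers. For symbolic
  powers it comes from the fact that every minimal vertex cover has an edge meeting it in exactly
  one vertex.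

  A boundary coefficient sits at a set T with two vertices u, w in one matching edge and one vertex
  in each other edge. It contributes to exactly the two transversals T - {u} and T - {w}. Its two
  signs are opposite if no vertex of T lies between u and w, which is why the variables are ordered
  with each matching edge forming a block.

  The hypothesis |E_1| = d(I) balances the estimates: each additional factor of I costs at most d(I)
  in the v-number, and raises the degree of the homology class by |E_1|.\<close>

abbreviation lookup where "lookup \<equiv> Poly_Mapping.lookup"
abbreviation keys where "keys \<equiv> Poly_Mapping.keys"
abbreviation single where "single \<equiv> Poly_Mapping.single"

type_synonym 'x expo = "'x \<Rightarrow>\<^sub>0 nat"

lemma ring_is_module: "Modules.module ((*) :: 'a::comm_ring_1 \<Rightarrow> 'a \<Rightarrow> 'a)"
  by unfold_locales (auto simp: algebra_simps)

interpretation rmod: Modules.module "(*) :: 'a::comm_ring_1 \<Rightarrow> 'a \<Rightarrow> 'a"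
  by (rule ring_is_module)

declare rmod.scale_scale [simp del]

section \<open>Monomials\<close>

text \<open>Total degree for \<open>C = UNIV\<close>; for a vertex cover \<open>C\<close>, the order
  of the monomial along the prime generated by the variables in \<open>C\<close>.\<close>

definition wt :: "'x set \<Rightarrow> ('x::finite) expo \<Rightarrow> nat" where
  "wt C m = (\<Sum>x\<in>C. lookup m x)"

definition ind :: "'x set \<Rightarrow> ('x::finite) expo" where
  "ind S = (\<Sum>x\<in>S. single x 1)"

lemma lookup_ind: "lookup (ind S) x = (if x \<in> S then 1 else 0)"
proof -
  have "lookup (ind S) x = (\<Sum>y\<in>S. if y = x then 1 else 0)"
    unfolding ind_def lookup_sum by (intro sum.cong) (auto simp: lookup_single)
  then show ?thesis by simp
qed

lemma ind_empty [simp]: "ind {} = 0"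
  by (simp add: ind_def)

lemma ind_insert: "v \<notin> S \<Longrightarrow> ind (insert v S) = single v 1 + ind S"
  by (simp add: ind_def)

lemma wt_add: "wt C (m + n) = wt C m + wt C n"
  by (simp add: wt_def lookup_add sum.distrib)

lemma wt_0 [simp]: "wt C 0 = 0"
  by (simp add: wt_def)

lemma wt_ind: "wt C (ind S) = card (S \<inter> C)"
proof -
  have "wt C (ind S) = (\<Sum>x\<in>C. if x \<in> S then 1 else 0)"
    by (simp add: wt_def lookup_ind)
  also have "\<dots> = card (S \<inter> C)"
    by (simp add: sum.If_cases Int_commute)
  finally show ?thesis .
qed

lemma wt_single: "wt C (single v a) = (if v \<in> C then a else 0)"
proof -
  have "wt C (single v a) = (\<Sum>x\<in>C. if x = v then a else 0)"
    unfolding wt_def by (intro sum.cong) (auto simp: lookup_single)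
  then show ?thesis by simp
qed

lemma mon_deg_eq_wt: "mon_deg m = wt UNIV m"
  unfolding mon_deg_def wt_def
  by (rule sum.mono_neutral_left) (auto simp: in_keys_iff)

lemma wt_mono: "C \<subseteq> D \<Longrightarrow> wt C m \<le> wt D m"
  unfolding wt_def by (rule sum_mono2) auto

lemma lookup_le_wt: "v \<in> C \<Longrightarrow> lookup m v \<le> wt C m"
  unfolding wt_def by (rule member_le_sum) auto

lemma wt_UNIV_eq_0_iff: "wt UNIV m = 0 \<longleftrightarrow> m = 0"
proof
  assume "wt UNIV m = 0"
  then have "lookup m v = 0" for v using lookup_le_wt[of v UNIV m] by simp
  then show "m = 0" by (intro poly_mapping_eqI) simp
qed simp

lemma expo_diff_add:
  assumes "\<And>v. lookup n v \<le> lookup (m::'x expo) v"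
  shows "n + (m - n) = m"
  using assms by (intro poly_mapping_eqI) (simp add: lookup_add lookup_minus)

lemma single_diff_add: "0 < lookup m v \<Longrightarrow> single v 1 + (m - single v 1) = (m :: 'x expo)"
  by (rule expo_diff_add) (auto simp: lookup_single when_def)

section \<open>Coefficients of polynomials\<close>

lemma lookup_single_mult_add:
  fixes f :: "('x, 'k::comm_ring_1) mpoly"
  shows "lookup (single n c * f) (n + m) = c * lookup f m"
  by (simp add: lookup_mult prod_fun_def lookup_single when_mult)

lemma lookup_single_mult_0:
  fixes f :: "('x, 'k::comm_ring_1) mpoly"
  assumes "\<nexists>q. m = n + q"
  shows "lookup (single n c * f) m = 0"
  using assms keys_mult[of "single n c" f] by (auto simp: not_in_keys_iff_lookup_eq_zero[symmetric] split: if_splits)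

lemma lookup_Var_mult:
  fixes f :: "('x, 'k::comm_ring_1) mpoly"
  shows "lookup (Var v * f) m = (if lookup m v = 0 then 0 else lookup f (m - single v 1))"
proof (cases "lookup m v = 0")
  case True
  then have "\<nexists>q. m = single v 1 + q" by (auto simp: lookup_add)
  then show ?thesis using True by (simp add: Var_def lookup_single_mult_0)
next
  case False
  then have "m = single v 1 + (m - single v 1)" using single_diff_add[of m v] by simp
  then have "lookup (Var v * f) m = lookup f (m - single v 1)"
    unfolding Var_def using lookup_single_mult_add[of "single v 1" 1 f "m - single v 1"] by simp
  then show ?thesis using False by simp
qed

lemma keys_multE:
  fixes f g :: "('x, 'k::comm_ring_1) mpoly"
  assumes "m \<in> keys (f * g)"
  obtains a b where "m = a + b" "a \<in> keys f" "b \<in> keys g"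
  using keys_mult assms by blast

lemma sum_monomials: "(\<Sum>m\<in>keys f. single m (lookup f m)) = (f :: ('x, 'k::comm_ring_1) mpoly)"
proof (rule poly_mapping_eqI)
  fix n
  have "lookup (\<Sum>m\<in>keys f. single m (lookup f m)) n = (\<Sum>m\<in>keys f. if m = n then lookup f m else 0)"
    unfolding lookup_sum by (intro sum.cong) (auto simp: lookup_single)
  also have "\<dots> = lookup f n" by (simp add: in_keys_iff)
  finally show "lookup (\<Sum>m\<in>keys f. single m (lookup f m)) n = lookup f n" .
qed

lemma keys_minus_subset: "keys (f - g) \<subseteq> keys f \<union> keys (g :: 'a \<Rightarrow>\<^sub>0 'b::ab_group_add)"
  by (auto simp: in_keys_iff lookup_minus)

section \<open>Homogeneous components\<close>

definition part :: "('a \<Rightarrow> bool) \<Rightarrow> ('a \<Rightarrow>\<^sub>0 'b::zero) \<Rightarrow> 'a \<Rightarrow>\<^sub>0 'b" where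
  "part P f = Poly_Mapping.mapp (\<lambda>m c. if P m then c else 0) f"

lemma lookup_part: "lookup (part P f) m = (if P m then lookup f m else 0)"
  by (auto simp: part_def lookup_mapp in_keys_iff when_def)

lemma keys_part: "keys (part P f) = {m \<in> keys f. P m}"
  by (auto simp: in_keys_iff lookup_part split: if_splits)

lemma part_add: "part P (f + g) = part P f + part P (g :: 'a \<Rightarrow>\<^sub>0 'b::monoid_add)"
  by (rule poly_mapping_eqI) (simp add: lookup_part lookup_add)

lemma part_diff: "part P (f - g) = part P f - part P (g :: 'a \<Rightarrow>\<^sub>0 'b::ab_group_add)"
  by (rule poly_mapping_eqI) (simp add: lookup_part lookup_minus)

lemma part_zero [simp]: "part P 0 = 0"
  by (rule poly_mapping_eqI) (simp add: lookup_part)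

lemma part_sum: "part P (\<Sum>i\<in>A. f i) = (\<Sum>i\<in>A. part P (f i :: 'a \<Rightarrow>\<^sub>0 'b::comm_monoid_add))"
  by (rule poly_mapping_eqI) (simp add: lookup_part lookup_sum)

lemma part_split: "part P f + part (\<lambda>m. \<not> P m) f = (f :: 'a \<Rightarrow>\<^sub>0 'b::monoid_add)"
  by (rule poly_mapping_eqI) (simp add: lookup_part lookup_add)

lemma part_id: "(\<And>m. m \<in> keys f \<Longrightarrow> P m) \<Longrightarrow> part P f = f"
  by (rule poly_mapping_eqI) (auto simp: lookup_part in_keys_iff)

lemma part_none: "(\<And>m. m \<in> keys f \<Longrightarrow> \<not> P m) \<Longrightarrow> part P f = 0"
  by (rule poly_mapping_eqI) (auto simp: lookup_part in_keys_iff)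

text \<open>Weights are integers, so that shifted degrees may be negative.\<close>

definition wpart :: "'x set \<Rightarrow> int \<Rightarrow> ('x::finite, 'k::comm_ring_1) mpoly \<Rightarrow> ('x, 'k) mpoly" where
  "wpart C t f = part (\<lambda>m. int (wt C m) = t) f"

lemma keys_wpart: "keys (wpart C t f) = {m \<in> keys f. int (wt C m) = t}"
  by (simp add: wpart_def keys_part)

lemma lookup_wpart: "lookup (wpart C t f) m = (if int (wt C m) = t then lookup f m else 0)"
  by (simp add: wpart_def lookup_part)

lemma wpart_diff: "wpart C t (f - g) = wpart C t f - wpart C t g"
  by (simp add: wpart_def part_diff)

lemma wpart_zero [simp]: "wpart C t 0 = 0"
  by (simp add: wpart_def)

lemma wpart_sum: "wpart C t (\<Sum>i\<in>A. f i) = (\<Sum>i\<in>A. wpart C t (f i))"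
  by (simp add: wpart_def part_sum)

lemma wpart_mult_homogeneous:
  assumes "\<And>m. m \<in> keys f \<Longrightarrow> int (wt C m) = d"
  shows "wpart C t (f * g) = f * wpart C (t - d) g"
proof -
  let ?P = "\<lambda>m. int (wt C m) = t - d" and ?Q = "\<lambda>m. int (wt C m) = t"
  have "f * g = f * (part ?P g + part (\<lambda>m. \<not> ?P m) g)" by (simp only: part_split)
  also have "\<dots> = f * part ?P g + f * part (\<lambda>m. \<not> ?P m) g" by (simp add: algebra_simps)
  finally have "part ?Q (f * g) = part ?Q (f * part ?P g) + part ?Q (f * part (\<lambda>m. \<not> ?P m) g)"
    by (simp add: part_add)
  also have "part ?Q (f * part ?P g) = f * part ?P g"
    by (intro part_id) (auto elim!: keys_multE simp: keys_part wt_add assms)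
  also have "part ?Q (f * part (\<lambda>m. \<not> ?P m) g) = 0"
    by (intro part_none) (auto elim!: keys_multE simp: keys_part wt_add assms)
  finally show ?thesis by (simp add: wpart_def)
qed

lemma sum_wparts:
  assumes "finite T" "\<And>m. m \<in> keys f \<Longrightarrow> int (wt C m) \<in> T"
  shows "(\<Sum>t\<in>T. wpart C t f) = f"
proof (rule poly_mapping_eqI)
  fix m
  have "lookup (\<Sum>t\<in>T. wpart C t f) m = (\<Sum>t\<in>T. if int (wt C m) = t then lookup f m else 0)"
    by (simp add: lookup_sum lookup_wpart)
  also have "\<dots> = lookup f m" using assms by (auto simp: in_keys_iff)
  finally show "lookup (\<Sum>t\<in>T. wpart C t f) m = lookup f m" .
qed

definition hom_part :: "int \<Rightarrow> ('x::finite, 'k::comm_ring_1) mpoly set" where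
  "hom_part t = {f. \<forall>m\<in>keys f. int (wt UNIV m) = t}"

lemma graded_part_eq: "graded_part e = hom_part (int e)"
  by (simp add: graded_part_def hom_part_def mon_deg_eq_wt)

lemma hom_part_0 [simp]: "0 \<in> hom_part t"
  by (simp add: hom_part_def)

lemma hom_part_add: "f \<in> hom_part t \<Longrightarrow> g \<in> hom_part t \<Longrightarrow> f + g \<in> hom_part t"
  using keys_add[of f g] by (auto simp: hom_part_def)

lemma hom_part_diff: "f \<in> hom_part t \<Longrightarrow> g \<in> hom_part t \<Longrightarrow> f - g \<in> hom_part t"
  using keys_minus_subset[of f g] by (auto simp: hom_part_def)

lemma hom_part_mult: "f \<in> hom_part t \<Longrightarrow> g \<in> hom_part u \<Longrightarrow> f * g \<in> hom_part (t + u)"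
  by (auto simp: hom_part_def wt_add elim!: keys_multE)

lemma hom_part_single: "single m c \<in> hom_part (int (wt UNIV m))"
  by (simp add: hom_part_def)

lemma wpart_hom: "wpart UNIV t f \<in> hom_part t"
  by (simp add: hom_part_def keys_wpart)

lemma wpart_of_hom: "f \<in> hom_part t \<Longrightarrow> wpart UNIV t f = f"
  unfolding wpart_def by (rule part_id) (simp add: hom_part_def)

lemma wpart_of_hom_other: "f \<in> hom_part t \<Longrightarrow> u \<noteq> t \<Longrightarrow> wpart UNIV u f = 0"
  unfolding wpart_def by (rule part_none) (simp add: hom_part_def)

lemma wpart_mult_hom: "f \<in> hom_part d \<Longrightarrow> wpart UNIV t (f * g) = f * wpart UNIV (t - d) g"
  by (rule wpart_mult_homogeneous) (simp add: hom_part_def)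

lemma hom_part_const: "f \<in> hom_part 0 \<Longrightarrow> f = single 0 (lookup f 0)"
  by (rule poly_mapping_eqI)
     (auto simp: hom_part_def lookup_single when_def wt_UNIV_eq_0_iff in_keys_iff)

lemma hom_part_no_const: "f \<in> hom_part t \<Longrightarrow> t \<noteq> 0 \<Longrightarrow> lookup f 0 = 0"
  by (cases "0 \<in> keys f") (auto simp: hom_part_def not_in_keys_iff_lookup_eq_zero[symmetric])

lemma lookup_mult_zero_right:
  fixes f g :: "('x::finite, 'k::comm_ring_1) mpoly"
  assumes "lookup g 0 = 0"
  shows "lookup (f * g) 0 = 0"
proof (rule ccontr)
  assume "lookup (f * g) 0 \<noteq> 0"
  then have "0 \<in> keys (f * g)" by (simp add: in_keys_iff)
  then obtain a b where ab: "0 = a + b" "b \<in> keys g" by (auto elim: keys_multE)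
  then have "wt UNIV b = 0" by (metis add_is_0 wt_0 wt_add)
  then show False using ab assms by (simp add: wt_UNIV_eq_0_iff in_keys_iff)
qed

section \<open>Monomial ideals\<close>

text \<open>Encoding by supports turns every ideal computation into one about sets of exponents.
  \<open>M\<close> is arbitrary here and is required to be \<open>upclosed\<close> only where ideal
  properties matter; \<open>M = {}\<close> gives the zero ideal.\<close>

definition monomial_ideal :: "'x expo set \<Rightarrow> ('x, 'k::comm_ring_1) mpoly set" where
  "monomial_ideal M = {f. keys f \<subseteq> M}"

definition upclosed :: "'x expo set \<Rightarrow> bool" where
  "upclosed M \<longleftrightarrow> (\<forall>m\<in>M. \<forall>n. m + n \<in> M)"

lemma single_in_monomial_ideal: "single m 1 \<in> (monomial_ideal M :: ('x, 'k::comm_ring_1) mpoly set) \<longleftrightarrow> m \<in> M"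
  by (simp add: monomial_ideal_def)

lemma monomial_ideal_ideal:
  assumes "upclosed M"
  shows "is_ideal (monomial_ideal M :: ('x, 'k::comm_ring_1) mpoly set)"
proof (rule rmod.subspaceI)
  fix f g :: "('x, 'k) mpoly"
  assume "f \<in> monomial_ideal M" "g \<in> monomial_ideal M"
  then show "f + g \<in> monomial_ideal M" using keys_add[of f g] by (auto simp: monomial_ideal_def)
next
  fix f g :: "('x, 'k) mpoly"
  assume "g \<in> monomial_ideal M"
  then show "f * g \<in> monomial_ideal M" using assms
    by (auto simp: monomial_ideal_def upclosed_def elim!: keys_multE) (metis add.commute subsetD)
qed (simp add: monomial_ideal_def)

lemma ideal_gen_monomials:
  "ideal_gen ((\<lambda>u. single u 1) ` U) = (monomial_ideal {u + n | u n. u \<in> U} :: ('x, 'k::comm_ring_1) mpoly set)"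
  (is "?L = monomial_ideal ?M")
proof
  have up: "upclosed ?M"
    unfolding upclosed_def by (smt (verit) add.assoc mem_Collect_eq)
  have "(\<lambda>u. single u 1) ` U \<subseteq> (monomial_ideal ?M :: ('x, 'k) mpoly set)"
    by (auto simp: monomial_ideal_def) (metis add.right_neutral)
  then show "?L \<subseteq> (monomial_ideal ?M :: ('x, 'k) mpoly set)"
    by (rule rmod.span_minimal) (rule monomial_ideal_ideal[OF up])
  show "(monomial_ideal ?M :: ('x, 'k) mpoly set) \<subseteq> ?L"
  proof
    fix f :: "('x, 'k) mpoly" assume f: "f \<in> monomial_ideal ?M"
    have "single m (lookup f m) \<in> ?L" if m: "m \<in> keys f" for m
    proof -
      obtain u n where u: "m = u + n" "u \<in> U" using f m by (auto simp: monomial_ideal_def)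
      have "single m (lookup f m) = single n (lookup f m) * single u 1"
        by (simp add: mult_single u add.commute)
      then show ?thesis using u by (simp add: rmod.span_base rmod.span_scale)
    qed
    then have "(\<Sum>m\<in>keys f. single m (lookup f m)) \<in> ?L" by (rule rmod.span_sum)
    then show "f \<in> ?L" by (simp add: sum_monomials)
  qed
qed

lemma ideal_gen_product:
  assumes "upclosed M" "upclosed N"
  shows "ideal_gen {a * b | a b. a \<in> (monomial_ideal M :: ('x, 'k::comm_ring_1) mpoly set) \<and> b \<in> monomial_ideal N}
    = monomial_ideal {m + n | m n. m \<in> M \<and> n \<in> N}" (is "?L = monomial_ideal ?M")
proof
  have up: "upclosed ?M" using assms
    unfolding upclosed_def by (smt (verit) add.assoc mem_Collect_eq)
  show "?L \<subseteq> (monomial_ideal ?M :: ('x, 'k) mpoly set)"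
    by (rule rmod.span_minimal[OF _ monomial_ideal_ideal[OF up]]) (auto simp: monomial_ideal_def elim!: keys_multE)
  show "(monomial_ideal ?M :: ('x, 'k) mpoly set) \<subseteq> ?L"
  proof
    fix f :: "('x, 'k) mpoly" assume f: "f \<in> monomial_ideal ?M"
    have "single p (lookup f p) \<in> ?L" if p: "p \<in> keys f" for p
    proof -
      obtain m n where u: "p = m + n" "m \<in> M" "n \<in> N" using f p by (auto simp: monomial_ideal_def)
      have "single p (lookup f p) = single m (lookup f p) * single n 1"
        by (simp add: mult_single u)
      moreover have "single m (lookup f p) \<in> monomial_ideal M" "single n 1 \<in> (monomial_ideal N :: ('x, 'k) mpoly set)"
        using u by (auto simp: monomial_ideal_def)
      ultimately show ?thesis by (intro rmod.span_base) auto
    qed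
    then have "(\<Sum>m\<in>keys f. single m (lookup f m)) \<in> ?L" by (rule rmod.span_sum)
    then show "f \<in> ?L" by (simp add: sum_monomials)
  qed
qed

text \<open>Turns the minimality clause of a resolution into the vanishing of constant
  terms.\<close>

lemma ideal_gen_Var:
  "ideal_gen (range Var) = {f :: ('x::finite, 'k::comm_ring_1) mpoly. lookup f 0 = 0}"
proof -
  have "range Var = (\<lambda>u. single u 1 :: ('x, 'k) mpoly) ` range (\<lambda>v. single v 1)"
    by (auto simp: Var_def image_def)
  then have "ideal_gen (range Var :: ('x, 'k) mpoly set) = monomial_ideal {u + n | u n. u \<in> range (\<lambda>v. single v 1)}"
    by (simp only: ideal_gen_monomials)
  also have "{u + n | u n. u \<in> range (\<lambda>v::'x. single v (1::nat))} = - {0}"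
  proof -
    have "\<exists>v n. m = single v 1 + n" if "m \<noteq> 0" for m :: "'x expo"
    proof -
      from that obtain v where "lookup m v \<noteq> 0" by (metis lookup_zero poly_mapping_eqI)
      then show ?thesis using single_diff_add[of m v] by (metis gr0I)
    qed
    moreover have "single v 1 + n \<noteq> 0" for v and n :: "'x expo"
    proof
      assume "single v 1 + n = 0"
      then have "lookup (single v 1 + n) v = 0" by simp
      then show False by (simp add: lookup_add)
    qed
    ultimately have *: "m \<in> {u + n | u n. u \<in> range (\<lambda>v::'x. single v (1::nat))} \<longleftrightarrow> m \<noteq> 0" for m
      unfolding mem_Collect_eq image_iff by (metis UNIV_I)
    show ?thesis by (rule Set.set_eqI) (simp only: * Compl_iff singleton_iff not_False_eq_True)
  qed
  finally show ?thesis by (auto simp: monomial_ideal_def in_keys_iff)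
qed

section \<open>The Koszul complex\<close>

declare One_nat_def [simp del]

lemma lookup_const_mult [simp]:
  fixes f :: "('x, 'k::comm_ring_1) mpoly"
  shows "lookup (single 0 c * f) m = c * lookup f m"
  using lookup_single_mult_add[of 0 c f m] by simp

text \<open>\<open>f (\<phi> x) = - f x\<close> alone would not do in characteristic 2, where fixed
  points of \<open>\<phi>\<close> could contribute. The predicate \<open>P\<close> excludes them by
  marking one element of each pair.\<close>

lemma sum_pairing_zero:
  fixes f :: "'a \<Rightarrow> 'b::ab_group_add"
  assumes "finite A" and "\<And>x. x \<in> A \<Longrightarrow> \<phi> x \<in> A" "\<And>x. x \<in> A \<Longrightarrow> \<phi> (\<phi> x) = x"
    "\<And>x. x \<in> A \<Longrightarrow> P (\<phi> x) \<longleftrightarrow> \<not> P x" "\<And>x. x \<in> A \<Longrightarrow> f (\<phi> x) = - f x"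
  shows "sum f A = 0"
proof -
  let ?B = "{x \<in> A. P x}" and ?C = "{x \<in> A. \<not> P x}"
  have "sum f A = sum f (?B \<union> ?C)" by (rule arg_cong[where f = "sum f"]) auto
  also have "\<dots> = sum f ?B + sum f ?C" using assms(1) by (intro sum.union_disjoint) auto
  also have "sum f ?C = (\<Sum>x\<in>?B. f (\<phi> x))"
    by (rule sum.reindex_bij_betw[symmetric], rule bij_betw_byWitness[where f' = \<phi>])
       (use assms in auto)
  also have "\<dots> = (\<Sum>x\<in>?B. - f x)" using assms(5) by (intro sum.cong) auto
  also have "\<dots> = - sum f ?B" by (simp add: sum_negf)
  finally show ?thesis by simp
qed

definition vscale :: "'a::comm_ring_1 \<Rightarrow> (nat \<Rightarrow> 'a) \<Rightarrow> nat \<Rightarrow> 'a" where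
  "vscale f v = (\<lambda>i. f * v i)"

interpretation vmod: Modules.module "vscale :: 'a::comm_ring_1 \<Rightarrow> (nat \<Rightarrow> 'a) \<Rightarrow> nat \<Rightarrow> 'a"
  by unfold_locales (auto simp: vscale_def plus_fun_def algebra_simps)

lemma sum_fun_apply: "(\<Sum>x\<in>A. g x) i = (\<Sum>x\<in>A. g x i :: 'b::comm_monoid_add)"
  by (induction A rule: infinite_finite_induct) (auto simp: plus_fun_def zero_fun_def)

lemma lookup_single_var_mult:
  fixes f :: "('x, 'k::comm_ring_1) mpoly"
  shows "lookup (single (single v 1) a * f) m = (if lookup m v = 0 then 0 else a * lookup f (m - single v 1))"
proof -
  have "single (single v 1) a = single 0 a * Var v" by (simp add: Var_def mult_single)
  then have "single (single v 1) a * f = single 0 a * (Var v * f)" by (simp add: mult.assoc)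
  moreover have "lookup (single 0 a * (Var v * f)) m = a * lookup (Var v * f) m"
    using lookup_single_mult_add[of 0 a "Var v * f" m] by simp
  ultimately show ?thesis by (simp only: lookup_Var_mult) simp
qed

text \<open>Monomials not divisible by the variable are dropped, so this is only a left inverse of
  multiplication by it.\<close>

definition divx :: "'a \<Rightarrow> ('a, 'k::comm_ring_1) mpoly \<Rightarrow> ('a, 'k) mpoly" where
  "divx v f = Poly_Mapping.map_key (\<lambda>m. m + single v 1) f"

lemma lookup_divx:
  fixes f :: "('a, 'k::comm_ring_1) mpoly"
  shows "lookup (divx v f) m = lookup f (m + single v 1)"
proof -
  have "inj (\<lambda>m :: 'a expo. m + single v 1)" by (simp add: inj_on_def)
  then show ?thesis by (simp add: divx_def map_key.rep_eq)
qed

text \<open>Only the size of a free module and the degrees of its basis elements matter, so all free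
  modules live inside one type of infinite vectors.\<close>

definition free_mod :: "nat list \<Rightarrow> int \<Rightarrow> (nat \<Rightarrow> ('x::finite, 'k::comm_ring_1) mpoly) set" where
  "free_mod D t = {v. (\<forall>i<length D. v i \<in> hom_part (t - int (D ! i))) \<and> (\<forall>i\<ge>length D. v i = 0)}"

text \<open>A graded module given by its homogeneous pieces. Scalar multiples of the variables are
  the only multipliers in a Koszul differential, so closure is asked for these alone.\<close>

definition graded_mod :: "(int \<Rightarrow> (nat \<Rightarrow> ('x::finite, 'k::comm_ring_1) mpoly) set) \<Rightarrow> bool" where
  "graded_mod Z \<longleftrightarrow> (\<forall>t. 0 \<in> Z t \<and> (\<forall>v\<in>Z t. \<forall>w\<in>Z t. v + w \<in> Z t \<and> v - w \<in> Z t) \<and>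
     (\<forall>v\<in>Z t. \<forall>u a. vscale (single (single u 1) a) v \<in> Z (t + 1)))"

lemma graded_modD:
  assumes "graded_mod Z"
  shows "0 \<in> Z t" "v \<in> Z t \<Longrightarrow> w \<in> Z t \<Longrightarrow> v + w \<in> Z t" "v \<in> Z t \<Longrightarrow> w \<in> Z t \<Longrightarrow> v - w \<in> Z t"
    "v \<in> Z t \<Longrightarrow> vscale (single (single u 1) a) v \<in> Z (t + 1)"
  using assms by (auto simp: graded_mod_def)

lemma graded_mod_sum: "graded_mod Z \<Longrightarrow> (\<And>i. i \<in> A \<Longrightarrow> f i \<in> Z t) \<Longrightarrow> (\<Sum>i\<in>A. f i) \<in> Z t"
  by (induction A rule: infinite_finite_induct) (auto dest: graded_modD)

lemma graded_mod_free: "graded_mod (free_mod D :: int \<Rightarrow> (nat \<Rightarrow> ('a::finite, 'b::comm_ring_1) mpoly) set)"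
  unfolding graded_mod_def
proof (intro allI conjI ballI)
  fix t and u :: 'a and a :: 'b and v :: "nat \<Rightarrow> ('a::finite, 'b::comm_ring_1) mpoly" assume v: "v \<in> free_mod D t"
  have s: "single (single u 1) a \<in> hom_part 1"
    using hom_part_single[of "single u 1" a] by (simp add: wt_single)
  show "vscale (single (single u 1) a) v \<in> free_mod D (t + 1)"
    unfolding free_mod_def vscale_def
  proof (intro CollectI conjI allI impI)
    fix i assume "i < length D"
    then have "v i \<in> hom_part (t - int (D ! i))" using v by (simp add: free_mod_def)
    from hom_part_mult[OF s this]
    show "single (single u 1) a * v i \<in> hom_part (t + 1 - int (D ! i))" by (simp add: algebra_simps)
  qed (use v in \<open>simp add: free_mod_def\<close>)
qed (auto simp: free_mod_def zero_fun_def plus_fun_def fun_diff_def hom_part_add hom_part_diff)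

lemma graded_mod_Int: "vmod.subspace N \<Longrightarrow> graded_mod (\<lambda>t. N \<inter> free_mod D t)"
  using graded_mod_free[of D]
  by (auto simp: graded_mod_def vmod.subspace_0 vmod.subspace_add vmod.subspace_diff vmod.subspace_scale)

text \<open>Changing the injection \<^term>\<open>r\<close> permutes the variables, which only affects signs.
  This freedom is used when a nontrivial homology class is exhibited.\<close>

locale koszul =
  fixes r :: "'x::finite \<Rightarrow> nat"
  assumes inj_r: "inj r"
begin

text \<open>The sign of moving \<open>e(v)\<close> from the front into its \<open>r\<close>-sorted
  position among the factors of \<open>e(S)\<close>.\<close>

definition ksign :: "'x set \<Rightarrow> 'x \<Rightarrow> 'k::comm_ring_1" where
  "ksign S v = (-1) ^ card {u \<in> S. r u < r v}"

lemma ksign_square [simp]: "ksign S v * ksign S v = 1"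
  unfolding ksign_def power_add[symmetric] by simp

lemma ksign_insert: "v \<notin> S \<Longrightarrow> ksign (insert v S) u = (if r v < r u then - ksign S u else ksign S u)"
proof -
  assume v: "v \<notin> S"
  show ?thesis
  proof (cases "r v < r u")
    case True
    then have "{z \<in> insert v S. r z < r u} = insert v {z \<in> S. r z < r u}" by auto
    then show ?thesis using True v by (simp add: ksign_def)
  next
    case False
    then have "{z \<in> insert v S. r z < r u} = {z \<in> S. r z < r u}" by auto
    then show ?thesis using False by (simp add: ksign_def)
  qed
qed

lemma ksign_swap:
  assumes "u \<notin> S" "v \<notin> S" "u \<noteq> v"
  shows "ksign S u * ksign (insert u S) v = - (ksign S v * ksign (insert v S) u :: 'k::comm_ring_1)"
proof -
  have "r u \<noteq> r v" using inj_r assms(3) by (auto dest: injD)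
  then have "r u < r v \<and> \<not> r v < r u \<or> r v < r u \<and> \<not> r u < r v" by auto
  then show ?thesis using assms by (auto simp: ksign_insert)
qed

text \<open>An element of the Koszul complex is stored as its coefficient function,
  \<open>c S\<close> being the coefficient of the wedge of \<open>S\<close>. Reading the usual
  differential coefficientwise turns the removal of a factor into a sum over the vertices missing
  from \<open>S\<close>.\<close>

definition kdiff :: "('x set \<Rightarrow> ('x, 'k::comm_ring_1) mpoly) \<Rightarrow> 'x set \<Rightarrow> ('x, 'k) mpoly" where
  "kdiff c S = (\<Sum>v\<in>-S. single (single v 1) (ksign S v) * c (insert v S))"

definition kdiff_vec :: "('x set \<Rightarrow> nat \<Rightarrow> ('x, 'k::comm_ring_1) mpoly) \<Rightarrow> 'x set \<Rightarrow> nat \<Rightarrow> ('x, 'k) mpoly" where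
  "kdiff_vec c S = (\<Sum>v\<in>-S. vscale (single (single v 1) (ksign S v)) (c (insert v S)))"

lemma kdiff_vec_apply: "kdiff_vec c S i = kdiff (\<lambda>S. c S i) S"
  by (simp add: kdiff_vec_def kdiff_def sum_fun_apply vscale_def)

text \<open>The two orders of passing through \<open>v\<close> and \<open>w\<close> give the same
  monomial factor with opposite signs, by \<open>ksign_swap\<close>.\<close>

lemma kdiff_kdiff:
  fixes c :: "'x set \<Rightarrow> ('x, 'k::comm_ring_1) mpoly"
  shows "kdiff (kdiff c) S = 0"
proof -
  define t where "t = (\<lambda>(v, w). single (single v 1 + single w 1) (ksign S v * ksign (insert v S) w) * c (insert w (insert v S)))"
  define A where "A = Sigma (-S) (\<lambda>v. - insert v S)"
  have "kdiff (kdiff c) S = (\<Sum>v\<in>-S. \<Sum>w\<in>- insert v S. t (v, w))"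
    by (simp add: kdiff_def t_def sum_distrib_left mult.assoc[symmetric] mult_single)
  also have "\<dots> = sum t A" unfolding A_def by (subst sum.Sigma) auto
  also have "sum t A = 0"
  proof (rule sum_pairing_zero[where \<phi> = prod.swap and P = "\<lambda>(v, w). r v < r w"])
    fix x assume x: "x \<in> A"
    obtain v w where vw: "x = (v, w)" by (cases x)
    have *: "v \<notin> S" "w \<notin> S" "v \<noteq> w" using x vw by (auto simp: A_def)
    then show "prod.swap x \<in> A" using vw by (auto simp: A_def)
    show "prod.swap (prod.swap x) = x" by simp
    have "r v \<noteq> r w" using inj_r *(3) by (auto dest: injD)
    then show "(case prod.swap x of (v, w) \<Rightarrow> r v < r w) \<longleftrightarrow> \<not> (case x of (v, w) \<Rightarrow> r v < r w)"
      using vw by auto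
    show "t (prod.swap x) = - t x"
      using ksign_swap[where 'k='k, OF *(2,1) *(3)[symmetric]] vw
      by (simp add: t_def insert_commute add.commute single_uminus)
  qed simp
  finally show ?thesis .
qed

lemma kdiff_vec_kdiff_vec: "kdiff_vec (kdiff_vec c) S = 0"
proof
  fix i
  have "kdiff_vec (kdiff_vec c) S i = kdiff (kdiff (\<lambda>S. c S i)) S" by (simp add: kdiff_vec_apply[abs_def])
  then show "kdiff_vec (kdiff_vec c) S i = 0 i" by (simp add: kdiff_kdiff zero_fun_def)
qed

lemma kdiff_vec_diff: "kdiff_vec (\<lambda>S. c S - e S) S = kdiff_vec c S - kdiff_vec e S"
  by (simp add: kdiff_vec_def vmod.scale_right_diff_distrib sum_subtractf)

lemma kdiff_vec_hom:
  assumes "module_hom vscale vscale \<pi>"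
  shows "\<pi> (kdiff_vec c S) = kdiff_vec (\<lambda>S. \<pi> (c S)) S"
proof -
  interpret module_hom vscale vscale \<pi> by (rule assms)
  show ?thesis by (simp add: kdiff_vec_def sum scale)
qed

lemma kdiff_vec_subspace: "vmod.subspace N \<Longrightarrow> (\<And>S. c S \<in> N) \<Longrightarrow> kdiff_vec c S \<in> N"
  unfolding kdiff_vec_def by (intro vmod.subspace_sum vmod.subspace_scale)

lemma lookup_kdiff:
  "lookup (kdiff c S) m = (\<Sum>u\<in>-S. if lookup m u = 0 then 0 else ksign S u * lookup (c (insert u S)) (m - single u 1))"
  unfolding kdiff_def lookup_sum lookup_single_var_mult ..

text \<open>The choice depends on the multidegree only. All terms of the homotopy identity share one
  multidegree and hence use the same variable.\<close>

definition sel :: "nat \<Rightarrow> 'x expo \<Rightarrow> 'x" where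
  "sel k a = (SOME v. k < lookup a v)"

lemma sel: "k < lookup a v \<Longrightarrow> k < lookup a (sel k a)"
  unfolding sel_def by (rule someI)

text \<open>A contracting homotopy in those multidegrees that have some exponent larger than \<^term>\<open>k\<close>:
  divide by a variable with such an exponent.\<close>

definition khomotopy :: "nat \<Rightarrow> ('x set \<Rightarrow> ('x, 'k::comm_ring_1) mpoly) \<Rightarrow> 'x set \<Rightarrow> ('x, 'k) mpoly" where
  "khomotopy k c S = (\<Sum>v\<in>S. single 0 (ksign (S - {v}) v) *
     part (\<lambda>m. (\<exists>u. k < lookup (m + ind S) u) \<and> sel k (m + ind S) = v) (divx v (c (S - {v}))))"

lemma lookup_khomotopy:
  "lookup (khomotopy k c S) m = (if (\<exists>u. k < lookup (m + ind S) u) \<and> sel k (m + ind S) \<in> S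
     then ksign (S - {sel k (m + ind S)}) (sel k (m + ind S)) *
       lookup (c (S - {sel k (m + ind S)})) (m + single (sel k (m + ind S)) 1) else 0)"
proof -
  have "lookup (khomotopy k c S) m = (\<Sum>v\<in>S. if sel k (m + ind S) = v then
     (if (\<exists>u. k < lookup (m + ind S) u) then ksign (S - {v}) v * lookup (c (S - {v})) (m + single v 1) else 0) else 0)"
    unfolding khomotopy_def lookup_sum
    by (intro sum.cong refl)
      (auto simp: lookup_part lookup_divx)
  also have "\<dots> = (if sel k (m + ind S) \<in> S then
     (if (\<exists>u. k < lookup (m + ind S) u) then ksign (S - {sel k (m + ind S)}) (sel k (m + ind S)) *
       lookup (c (S - {sel k (m + ind S)})) (m + single (sel k (m + ind S)) 1) else 0) else 0)"
    by (simp add: eq_commute[of "sel k (m + ind S)"])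
  finally show ?thesis by simp
qed

text \<open>The term \<open>m\<close> times the wedge of \<open>S\<close> has multidegree
  \<open>m + ind S\<close>, and the differential preserves it.\<close>

lemma multideg_insert:
  assumes "u \<notin> S" "lookup m u \<noteq> 0"
  shows "m - single u 1 + ind (insert u S) = m + ind S"
proof -
  have "m - single u 1 + ind (insert u S) = (single u 1 + (m - single u 1)) + ind S"
    using assms(1) by (simp only: ind_insert ac_simps not_False_eq_True)
  then show ?thesis using assms(2) by (simp only: single_diff_add gr0I)
qed

text \<open>The homotopy is cut off to zero in these multidegrees, and the differential brings
  nothing in from other ones.\<close>

lemma homotopy_off:
  assumes "\<nexists>v. k < lookup (m + ind S) v"
  shows "lookup (kdiff (khomotopy k c) S) m = 0"
proof -
  have "lookup (khomotopy k c (insert u S)) (m - single u 1) = 0" if "u \<in> - S" "lookup m u \<noteq> 0" for u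
    using that assms multideg_insert[of u S m] by (simp only: lookup_khomotopy Compl_iff simp_thms if_False)
  then show ?thesis unfolding lookup_kdiff by (intro sum.neutral) auto
qed

lemma homotopy_on:
  fixes c :: "'x set \<Rightarrow> ('x, 'k::comm_ring_1) mpoly"
  assumes "\<exists>v. k < lookup (m + ind S) v"
  shows "lookup (kdiff (khomotopy k c) S) m + lookup (khomotopy k (kdiff c) S) m = lookup (c S) m"
proof -
  define v where "v = sel k (m + ind S)"
  have kv: "k < lookup (m + ind S) v" unfolding v_def using assms sel by blast
  have 1: "lookup (kdiff (khomotopy k c) S) m = (\<Sum>u\<in>-S. if lookup m u = 0 then 0 else
      (if v \<in> insert u S then ksign S u * (ksign (insert u S - {v}) v *
        lookup (c (insert u S - {v})) (m - single u 1 + single v 1)) else 0))"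
    unfolding lookup_kdiff
  proof (intro sum.cong refl)
    fix u assume "u \<in> - S"
    then have "lookup (khomotopy k c (insert u S)) (m - single u 1) = (if v \<in> insert u S then ksign (insert u S - {v}) v *
        lookup (c (insert u S - {v})) (m - single u 1 + single v 1) else 0)" if "lookup m u \<noteq> 0"
      unfolding lookup_khomotopy using multideg_insert[of u S m] that assms by (simp only: v_def Compl_iff simp_thms if_True)
    then show "(if lookup m u = 0 then 0 else ksign S u * lookup (khomotopy k c (insert u S)) (m - single u 1)) =
      (if lookup m u = 0 then 0 else (if v \<in> insert u S then ksign S u * (ksign (insert u S - {v}) v *
        lookup (c (insert u S - {v})) (m - single u 1 + single v 1)) else 0))"
      by (cases "lookup m u = 0"; cases "v \<in> insert u S") (simp_all only: if_True if_False mult_zero_right refl simp_thms)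
  qed
  show ?thesis
  proof (cases "v \<in> S")
    \<comment> \<open>With \<open>v\<close> outside \<open>S\<close> the second summand vanishes,
      and in the first only \<open>u = v\<close> survives: it divides by the variable
      \<open>v\<close> and multiplies back.\<close>
    case False
    then have mv: "lookup m v \<noteq> 0" using kv by (simp add: lookup_add lookup_ind)
    have "lookup (khomotopy k (kdiff c) S) m = 0" using False by (simp add: lookup_khomotopy v_def[symmetric])
    moreover have "lookup (kdiff (khomotopy k c) S) m = (\<Sum>u\<in>-S. if u = v then lookup (c S) m else 0)"
      unfolding 1
    proof (intro sum.cong refl)
      fix u assume "u \<in> - S"
      then show "(if lookup m u = 0 then 0 else
      (if v \<in> insert u S then ksign S u * (ksign (insert u S - {v}) v *
        lookup (c (insert u S - {v})) (m - single u 1 + single v 1)) else 0)) = (if u = v then lookup (c S) m else 0)"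
        using False mv single_diff_add[of m v]
        by (auto simp: mult.assoc[symmetric] add.commute)
    qed
    ultimately show ?thesis using False by simp
  next
    \<comment> \<open>With \<open>v\<close> in \<open>S\<close>, the index \<open>u = v\<close> of
      the second summand returns \<open>c S\<close>; every other index occurs in both summands with
      opposite signs.\<close>
    case True
    define T where "T = S - {v}"
    have S: "S = insert v T" "v \<notin> T" using True by (auto simp: T_def)
    have compl: "- T = insert v (- S)" "v \<notin> - S" using True by (auto simp: T_def)
    have "lookup (khomotopy k (kdiff c) S) m = ksign T v * lookup (kdiff c T) (m + single v 1)"
      using True assms by (simp add: lookup_khomotopy v_def[symmetric] T_def)
    also have "\<dots> = lookup (c S) m + (\<Sum>u\<in>-S. if lookup m u = 0 then 0 else
       ksign T v * (ksign T u * lookup (c (insert u T)) (m + single v 1 - single u 1)))"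
    proof -
      have "lookup (kdiff c T) (m + single v 1) = (\<Sum>u\<in>-T. if lookup (m + single v 1) u = 0 then 0 else
         ksign T u * lookup (c (insert u T)) (m + single v 1 - single u 1))"
        by (rule lookup_kdiff)
      also have "\<dots> = ksign T v * lookup (c S) m + (\<Sum>u\<in>-S. if lookup (m + single v 1) u = 0 then 0 else
         ksign T u * lookup (c (insert u T)) (m + single v 1 - single u 1))"
        unfolding compl(1) using compl(2) S by (subst sum.insert) (auto simp: lookup_add)
      also have "(\<Sum>u\<in>-S. if lookup (m + single v 1) u = 0 then 0 else
         ksign T u * lookup (c (insert u T)) (m + single v 1 - single u 1)) =
        (\<Sum>u\<in>-S. if lookup m u = 0 then 0 else
         ksign T u * lookup (c (insert u T)) (m + single v 1 - single u 1))"
      proof (intro sum.cong refl)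
        fix u assume "u \<in> - S"
        then have "u \<noteq> v" using True by auto
        then show "(if lookup (m + single v 1) u = 0 then 0 else
         ksign T u * lookup (c (insert u T)) (m + single v 1 - single u 1)) = (if lookup m u = 0 then 0 else
         ksign T u * lookup (c (insert u T)) (m + single v 1 - single u 1))"
          by (simp add: lookup_add lookup_single)
      qed
      finally have "ksign T v * lookup (kdiff c T) (m + single v 1) = ksign T v * (ksign T v * lookup (c S) m) +
        ksign T v * (\<Sum>u\<in>-S. if lookup m u = 0 then 0 else
         ksign T u * lookup (c (insert u T)) (m + single v 1 - single u 1))"
        by (simp add: distrib_left)
      then show ?thesis by (simp add: mult.assoc[symmetric] sum_distrib_left if_distrib[of "(*) _"] cong: if_cong)
    qed
    finally have 2: "lookup (khomotopy k (kdiff c) S) m = lookup (c S) m + (\<Sum>u\<in>-S. if lookup m u = 0 then 0 else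
       ksign T v * (ksign T u * lookup (c (insert u T)) (m + single v 1 - single u 1)))" .
    have "lookup (kdiff (khomotopy k c) S) m = (\<Sum>u\<in>-S. - (if lookup m u = 0 then 0 else
       ksign T v * (ksign T u * lookup (c (insert u T)) (m + single v 1 - single u 1))))"
      unfolding 1
    proof (intro sum.cong refl)
      fix u assume "u \<in> - S"
      then have u: "u \<notin> T" "u \<noteq> v" "insert u S - {v} = insert u T" using S by auto
      have sw: "ksign S u * ksign (insert u T) v = - (ksign T v * ksign T u :: 'k)"
      proof -
        have "r u \<noteq> r v" using inj_r u(2) by (auto dest: injD)
        then show ?thesis using u S(2) unfolding S(1) by (auto simp: ksign_insert)
      qed
      have "m - single u 1 + single v 1 = m + single v 1 - single u 1" if "lookup m u \<noteq> 0"
        using that by (intro poly_mapping_eqI) (auto simp: lookup_add lookup_minus lookup_single when_def)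
      then show "(if lookup m u = 0 then 0 else
      (if v \<in> insert u S then ksign S u * (ksign (insert u S - {v}) v *
        lookup (c (insert u S - {v})) (m - single u 1 + single v 1)) else 0)) = - (if lookup m u = 0 then 0 else
       ksign T v * (ksign T u * lookup (c (insert u T)) (m + single v 1 - single u 1)))"
        unfolding u(3) using True sw by (simp add: mult.assoc[symmetric])
    qed
    then show ?thesis unfolding 2 by (simp add: sum_negf)
  qed
qed

lemma keys_khomotopy:
  assumes "m \<in> keys (khomotopy k c S)"
  obtains v where "v \<in> S" "m + single v 1 \<in> keys (c (S - {v}))"
proof -
  define v where "v = sel k (m + ind S)"
  have "lookup (khomotopy k c S) m \<noteq> 0" using assms by (simp only: in_keys_iff not_False_eq_True)
  then have "v \<in> S" "lookup (c (S - {v})) (m + single v 1) \<noteq> 0"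
    unfolding lookup_khomotopy v_def[symmetric] by (simp_all only: split: if_splits) auto
  then show thesis using that by (simp only: in_keys_iff not_False_eq_True)
qed

text \<open>Each basis element \<open>e(v)\<close> has degree 1, so a chain of total degree
  \<open>j\<close> on \<open>p\<close>-sets has coefficients in degree \<open>j - p\<close>.\<close>

definition chain :: "(int \<Rightarrow> 'm::zero set) \<Rightarrow> nat \<Rightarrow> int \<Rightarrow> ('x set \<Rightarrow> 'm) \<Rightarrow> bool" where
  "chain Z p j c \<longleftrightarrow> (\<forall>S. c S \<in> (if card S = p then Z (j - int p) else {0}))"

text \<open>\<open>koszul_vanish Z B p j\<close> says that the \<open>p\<close>-th Koszul homology of \<open>Z/B\<close> vanishes in degree \<open>j\<close>.\<close>

definition koszul_vanish :: "(int \<Rightarrow> (nat \<Rightarrow> ('x, 'k::comm_ring_1) mpoly) set) \<Rightarrow> (nat \<Rightarrow> ('x, 'k) mpoly) set \<Rightarrow> nat \<Rightarrow> int \<Rightarrow> bool" where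
  "koszul_vanish Z B p j \<longleftrightarrow> (\<forall>c. chain Z p j c \<longrightarrow> (\<forall>S. kdiff_vec c S \<in> B) \<longrightarrow>
     (\<exists>e. chain Z (Suc p) j e \<and> (\<forall>S. c S - kdiff_vec e S \<in> B)))"

lemma chain_card: "chain Z p j c \<Longrightarrow> card S \<noteq> p \<Longrightarrow> c S = 0"
  by (auto simp: chain_def split: if_splits)

lemma chain_mem: "chain Z p j c \<Longrightarrow> card S = p \<Longrightarrow> c S \<in> Z (j - int p)"
  by (auto simp: chain_def split: if_splits)

lemma chainI: "(\<And>S. card S = p \<Longrightarrow> c S \<in> Z (j - int p)) \<Longrightarrow> (\<And>S. card S \<noteq> p \<Longrightarrow> c S = 0) \<Longrightarrow> chain Z p j c"
  by (simp add: chain_def)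

lemma chain_Int: "chain Z p j c \<Longrightarrow> (\<And>S. c S \<in> N) \<Longrightarrow> chain (\<lambda>t. N \<inter> Z t) p j c"
  unfolding chain_def by (metis IntI)

lemma chain_diff:
  assumes "graded_mod Z" "chain Z p j c" "chain Z p j e"
  shows "chain Z p j (\<lambda>S. c S - e S)"
  by (rule chainI)
    (simp_all add: graded_modD(3)[OF assms(1)] chain_mem[OF assms(2)] chain_mem[OF assms(3)]
       chain_card[OF assms(2)] chain_card[OF assms(3)])

lemma chain_kdiff_vec:
  assumes "graded_mod Z" "chain Z (Suc p) j c"
  shows "chain Z p j (kdiff_vec c)"
  unfolding chain_def
proof
  fix S
  show "kdiff_vec c S \<in> (if card S = p then Z (j - int p) else {0})"
  proof (cases "card S = p")
    case True
    have "vscale (single (single v 1) (ksign S v)) (c (insert v S)) \<in> Z (j - int p)" if "v \<in> - S" for v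
    proof -
      have "c (insert v S) \<in> Z (j - int (Suc p))" using that True by (intro chain_mem[OF assms(2)]) simp
      from graded_modD(4)[OF assms(1) this] show ?thesis by simp
    qed
    then have "kdiff_vec c S \<in> Z (j - int p)" unfolding kdiff_vec_def by (rule graded_mod_sum[OF assms(1)])
    then show ?thesis using True by simp
  next
    case False
    have "c (insert v S) = 0" if "v \<in> - S" for v
      using that False by (intro chain_card[OF assms(2)]) simp
    then show ?thesis using False by (simp add: kdiff_vec_def)
  qed
qed

lemma chain_mono: "(\<And>t. Z t \<subseteq> Z' t) \<Longrightarrow> chain Z p j c \<Longrightarrow> chain Z' p j c"
  unfolding chain_def by (metis subsetD)

text \<open>The homotopy divides only by a variable whose exponent exceeds \<open>k\<close>. By the
  hypothesis on \<open>M\<close> such a division does not leave \<open>monomial_ideal M\<close>, so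
  the homotopy still contracts modulo it. The case \<open>M = {}\<close>, \<open>k = 0\<close> is
  the exactness of the Koszul complex of a free module.\<close>

lemma homology_vanishes:
  fixes c :: "'x set \<Rightarrow> nat \<Rightarrow> ('x, 'k::comm_ring_1) mpoly"
  assumes c: "chain (free_mod D) p j c"
    and M: "\<And>m v. m \<in> M \<Longrightarrow> k < lookup m v \<Longrightarrow> m - single v 1 \<in> M"
    and cyc: "\<And>S i. kdiff_vec c S i \<in> monomial_ideal M"
    and big: "\<And>S i m. m \<in> keys (c S i) \<Longrightarrow> \<exists>v. k < lookup (m + ind S) v"
  shows "\<exists>e. chain (free_mod D) (Suc p) j e \<and> (\<forall>S i. (c S - kdiff_vec e S) i \<in> monomial_ideal M)"
proof (intro exI conjI allI)
  define e where "e = (\<lambda>S i. khomotopy k (\<lambda>S. c S i) S)"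
  show "chain (free_mod D) (Suc p) j e"
    unfolding chain_def
  proof
    fix S
    have key: "\<exists>v\<in>S. m + single v 1 \<in> keys (c (S - {v}) i)" if "m \<in> keys (e S i)" for m i
      using that unfolding e_def by (blast elim: keys_khomotopy)
    show "e S \<in> (if card S = Suc p then free_mod D (j - int (Suc p)) else {0})"
    proof (cases "card S = Suc p")
      case True
      have "int (wt UNIV m) = j - int (Suc p) - int (D ! i)" if "i < length D" "m \<in> keys (e S i)" for i m
      proof -
        obtain v where v: "v \<in> S" "m + single v 1 \<in> keys (c (S - {v}) i)" using key \<open>m \<in> keys (e S i)\<close> by blast
        have "c (S - {v}) \<in> free_mod D (j - int p)" using v(1) True by (intro chain_mem[OF c]) simp
        then have "int (wt UNIV (m + single v 1)) = j - int p - int (D ! i)"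
          using v(2) \<open>i < length D\<close> by (auto simp: free_mod_def hom_part_def)
        then show ?thesis by (simp add: wt_add wt_single)
      qed
      moreover have "e S i = 0" if "i \<ge> length D" for i
      proof -
        have "keys (e S i) = {}"
        proof (rule ccontr)
          assume "keys (e S i) \<noteq> {}"
          then obtain m v where v: "v \<in> S" "m + single v 1 \<in> keys (c (S - {v}) i)" using key by blast
          have "c (S - {v}) \<in> free_mod D (j - int p)" using v(1) True by (intro chain_mem[OF c]) simp
          then show False using v(2) that by (auto simp: free_mod_def)
        qed
        then show ?thesis by simp
      qed
      ultimately show ?thesis using True by (simp add: free_mod_def hom_part_def)
    next
      case False
      have "e S i = 0" for i
      proof -
        have "keys (e S i) = {}"
        proof (rule ccontr)
          assume "keys (e S i) \<noteq> {}"
          then obtain m v where v: "v \<in> S" "m + single v 1 \<in> keys (c (S - {v}) i)" using key by blast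
          have "c (S - {v}) = 0"
          proof (rule chain_card[OF c])
            have "card S > 0" using v(1) by (simp add: card_gt_0_iff) blast
            then show "card (S - {v}) \<noteq> p" using v(1) False by (simp add: card_Diff_singleton)
          qed
          then show False using v(2) by (simp add: zero_fun_def)
        qed
        then show ?thesis by simp
      qed
      then show ?thesis using False by (simp add: fun_eq_iff zero_fun_def)
    qed
  qed
  fix S i
  let ?c = "\<lambda>S. c S i"
  have "m \<in> M" if m: "m \<in> keys (?c S - kdiff (khomotopy k ?c) S)" for m
  \<comment> \<open>By the homotopy identity, a monomial of the error term in a contracted
    multidegree comes from the homotopy applied to the differential of \<open>c\<close>, which lies
    in \<open>M\<close>. In the other multidegrees \<open>c\<close> has no terms, by
    \<open>big\<close>.\<close>
  proof (cases "\<exists>v. k < lookup (m + ind S) v")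
    case True
    define v where "v = sel k (m + ind S)"
    have kv: "k < lookup (m + ind S) v" unfolding v_def using True sel by blast
    have "lookup (khomotopy k (kdiff ?c) S) m \<noteq> 0"
      using homotopy_on[OF True, of ?c] m by (auto simp: in_keys_iff lookup_minus)
    then have v: "v \<in> S" and "m + single v 1 \<in> keys (kdiff ?c (S - {v}))"
      unfolding lookup_khomotopy v_def[symmetric] in_keys_iff by (simp_all only: split: if_splits) auto
    then have "m + single v 1 \<in> M" using cyc[of "S - {v}" i] by (auto simp: kdiff_vec_apply monomial_ideal_def)
    moreover have "k < lookup (m + single v 1) v" using kv v by (simp add: lookup_add lookup_ind)
    ultimately show ?thesis using M by force
  next
    case False
    then have "lookup (c S i) m = 0" using big[of m S i] by (simp add: in_keys_iff) blast
    then show ?thesis using homotopy_off[OF False, of ?c] m by (simp add: in_keys_iff lookup_minus)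
  qed
  then show "(c S - kdiff_vec e S) i \<in> monomial_ideal M"
    by (auto simp: monomial_ideal_def kdiff_vec_apply e_def fun_diff_def)
qed

lemma monomial_ideal_empty: "monomial_ideal {} = {0}"
  by (auto simp: monomial_ideal_def)

text \<open>Every multidegree occurring on a nonempty \<open>S\<close> has a positive exponent, so
  the homotopy with \<open>k = 0\<close> applies.\<close>

lemma free_exact:
  assumes "p \<ge> 1"
  shows "koszul_vanish (free_mod D) {0} p j"
  unfolding koszul_vanish_def
proof (intro allI impI)
  fix c :: "'x set \<Rightarrow> nat \<Rightarrow> ('x, 'k::comm_ring_1) mpoly"
  assume c: "chain (free_mod D) p j c" and cyc: "\<forall>S. kdiff_vec c S \<in> {0}"
  have "\<exists>v. 0 < lookup (m + ind S) v" if "m \<in> keys (c S i)" for m S i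
  proof -
    have "card S = p" using chain_card[OF c, of S] that by (cases "card S = p") (simp_all add: zero_fun_def)
    then have "S \<noteq> {}" using assms by auto
    then show ?thesis by (auto simp: lookup_add lookup_ind)
  qed
  from homology_vanishes[OF c _ _ this, of "{}"] cyc
  show "\<exists>e. chain (free_mod D) (Suc p) j e \<and> (\<forall>S. c S - kdiff_vec e S \<in> {0})"
    by (auto simp: monomial_ideal_empty zero_fun_def fun_eq_iff)
qed

text \<open>In homological degree 0 the free module does have homology, namely its constant vectors.
  Without constant terms every multidegree again has a positive exponent.\<close>

lemma free_exact_0:
  fixes w :: "nat \<Rightarrow> ('x, 'k::comm_ring_1) mpoly"
  assumes w: "w \<in> free_mod D j" and w0: "\<And>i. lookup (w i) 0 = 0"
  shows "\<exists>e. chain (free_mod D) 1 j e \<and> kdiff_vec e {} = w"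
proof -
  define c where "c = (\<lambda>S::'x set. if S = {} then w else 0)"
  have c: "chain (free_mod D) 0 j c" using w by (auto simp: chain_def c_def)
  have cyc: "kdiff_vec c S i \<in> monomial_ideal {}" for S i
    by (simp add: kdiff_vec_apply kdiff_def c_def monomial_ideal_empty zero_fun_def)
  have big: "\<exists>v. 0 < lookup (m + ind S) v" if "m \<in> keys (c S i)" for m S i
  proof -
    have "m \<noteq> 0" using that w0[of i] by (auto simp: c_def zero_fun_def in_keys_iff split: if_splits)
    then obtain v where "lookup m v \<noteq> 0" by (metis lookup_zero poly_mapping_eqI)
    then show ?thesis by (auto simp: lookup_add intro!: exI[of _ v])
  qed
  have "\<exists>e. chain (free_mod D) (Suc 0) j e \<and> (\<forall>S i. (c S - kdiff_vec e S) i \<in> monomial_ideal {})"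
    by (rule homology_vanishes[OF c _ cyc big]) auto
  then obtain e where e: "chain (free_mod D) 1 j e" "\<forall>S i. (c S - kdiff_vec e S) i = 0"
    by (auto simp: monomial_ideal_empty One_nat_def)
  then have "c {} - kdiff_vec e {} = 0" by (simp add: fun_eq_iff)
  then show ?thesis using e(1) by (auto simp: c_def)
qed

lemma kdiff_vec_degree_1:
  assumes "chain Z 1 j e" "S \<noteq> {}"
  shows "kdiff_vec e S = 0"
proof -
  have "e (insert v S) = 0" if "v \<in> - S" for v
    using that assms(2) by (intro chain_card[OF assms(1)]) (simp add: card_eq_0_iff)
  then show ?thesis by (simp add: kdiff_vec_def)
qed

section \<open>Syzygies shift Koszul homology\<close>

text \<open>Half of the connecting map in the long exact sequence of 0 -> N -> F -> F/N -> 0: the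
  homology of F vanishes in degree \<open>Suc p\<close>, so a cycle of F/N is determined up to
  boundaries by its differential in N.\<close>

lemma syzygy_vanish_imp:
  assumes N: "vmod.subspace N" and koszul_vanish: "koszul_vanish (\<lambda>t. N \<inter> free_mod D t) {0} p j"
  shows "koszul_vanish (free_mod D) N (Suc p) j"
  unfolding koszul_vanish_def
proof (intro allI impI)
  fix c assume c: "chain (free_mod D) (Suc p) j c" and cyc: "\<forall>S. kdiff_vec c S \<in> N"
  have "chain (\<lambda>t. N \<inter> free_mod D t) p j (kdiff_vec c)"
    by (rule chain_Int[OF chain_kdiff_vec[OF graded_mod_free c]]) (use cyc in auto)
  then obtain b where b: "chain (\<lambda>t. N \<inter> free_mod D t) (Suc p) j b" "\<And>S. kdiff_vec c S - kdiff_vec b S = 0"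
    using koszul_vanish by (auto simp: koszul_vanish_def kdiff_vec_kdiff_vec)
  have bf: "chain (free_mod D) (Suc p) j b" by (rule chain_mono[OF _ b(1)]) auto
  have "chain (free_mod D) (Suc p) j (\<lambda>S. c S - b S)"
    by (rule chain_diff[OF graded_mod_free c bf])
  then obtain e where e: "chain (free_mod D) (Suc (Suc p)) j e" "\<And>S. c S - b S - kdiff_vec e S = 0"
    using free_exact[of "Suc p" D j] b(2) by (auto simp: koszul_vanish_def kdiff_vec_diff)
  have "c S - kdiff_vec e S \<in> N" for S
  proof -
    have "c S - kdiff_vec e S = b S" using e(2)[of S] by (simp add: algebra_simps)
    moreover have "b S \<in> N" using b(1) vmod.subspace_0[OF N] by (cases "card S = Suc p") (auto simp: chain_def split: if_splits)
    ultimately show ?thesis by simp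
  qed
  then show "\<exists>e. chain (free_mod D) (Suc (Suc p)) j e \<and> (\<forall>S. c S - kdiff_vec e S \<in> N)" using e(1) by blast
qed

text \<open>The converse half needs the map from the homology of N to that of F to be zero. For
  \<open>p > 0\<close> this is exactness of F; for \<open>p = 0\<close> it is the condition that N
  has no constant terms.\<close>

lemma vanish_imp_syzygy:
  assumes N: "vmod.subspace N" and koszul_vanish: "koszul_vanish (free_mod D) N (Suc p) j"
    and min: "p = 0 \<Longrightarrow> \<forall>v\<in>N \<inter> free_mod D j. \<forall>i. lookup (v i) 0 = 0"
  shows "koszul_vanish (\<lambda>t. N \<inter> free_mod D t) {0} p j"
  unfolding koszul_vanish_def
proof (intro allI impI)
  fix c assume c: "chain (\<lambda>t. N \<inter> free_mod D t) p j c" and cyc: "\<forall>S. kdiff_vec c S \<in> {0}"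
  have cN: "c S \<in> N" for S using c vmod.subspace_0[OF N] by (cases "card S = p") (auto simp: chain_def split: if_splits)
  have cf: "chain (free_mod D) p j c" by (rule chain_mono[OF _ c]) auto
  \<comment> \<open>\<open>C\<close> bounds \<open>c\<close> in the free module. It is a cycle
    modulo N, and correcting it by a boundary moves it into N itself.\<close>
  obtain C where C: "chain (free_mod D) (Suc p) j C" "\<And>S. c S = kdiff_vec C S"
  proof (cases "p = 0")
    case True
    have "c {} \<in> N \<inter> free_mod D j" using chain_mem[OF c, of "{}"] True by simp
    then have "\<And>i. lookup (c {} i) 0 = 0" "c {} \<in> free_mod D j" using min True by auto
    from free_exact_0[OF this(2,1)] obtain e where e: "chain (free_mod D) 1 j e" "kdiff_vec e {} = c {}" by blast
    have "c S = kdiff_vec e S" for S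
      using e(2) kdiff_vec_degree_1[OF e(1)] chain_card[OF c, of S] True by (cases "S = {}") auto
    then show thesis using that[of e] e(1) True by (simp add: One_nat_def)
  next
    case False
    then show thesis using that free_exact[of p D j] cf cyc by (auto simp: koszul_vanish_def)
  qed
  have "\<forall>S. kdiff_vec C S \<in> N" using cN C(2) by metis
  then obtain e where e: "chain (free_mod D) (Suc (Suc p)) j e" "\<And>S. C S - kdiff_vec e S \<in> N"
    using koszul_vanish C(1) by (auto simp: koszul_vanish_def)
  define b where "b = (\<lambda>S. C S - kdiff_vec e S)"
  have "chain (free_mod D) (Suc p) j b" unfolding b_def
    by (rule chain_diff[OF graded_mod_free C(1) chain_kdiff_vec[OF graded_mod_free e(1)]])
  then have "chain (\<lambda>t. N \<inter> free_mod D t) (Suc p) j b"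
    by (rule chain_Int) (use e(2) in \<open>simp add: b_def\<close>)
  moreover have "c S - kdiff_vec b S = 0" for S using C(2) unfolding b_def by (simp add: kdiff_vec_diff kdiff_vec_kdiff_vec)
  ultimately show "\<exists>e. chain (\<lambda>t. N \<inter> free_mod D t) (Suc p) j e \<and> (\<forall>S. c S - kdiff_vec e S \<in> {0})" by auto
qed

text \<open>In every degree \<open>\<pi>\<close> induces an isomorphism from F modulo the preimage
  of \<open>B\<close> onto \<open>Z\<close> modulo \<open>B\<close>. Chains are lifted and pushed
  coefficient by coefficient, with errors in \<open>B\<close>, which is stable under the
  differential.\<close>

lemma koszul_vanish_presentation:
  assumes hom: "module_hom vscale vscale \<pi>" and B: "vmod.subspace B" and Z: "graded_mod Z"
    and img: "\<And>t v. v \<in> free_mod D t \<Longrightarrow> \<pi> v \<in> Z t"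
    and surj: "\<And>t z. z \<in> Z t \<Longrightarrow> \<exists>v\<in>free_mod D t. z - \<pi> v \<in> B"
  shows "koszul_vanish (free_mod D) {v. \<pi> v \<in> B} p j \<longleftrightarrow> koszul_vanish Z B p j"
proof -
  interpret module_hom vscale vscale \<pi> by (rule hom)
  have lift: "\<exists>C. chain (free_mod D) p j C \<and> (\<forall>S. c S - \<pi> (C S) \<in> B)" if c: "chain Z p j c" for p c
  proof -
    have "\<exists>v. v \<in> (if card S = p then free_mod D (j - int p) else {0}) \<and> c S - \<pi> v \<in> B" for S
      using surj[of "c S" "j - int p"] chain_mem[OF c, of S] chain_card[OF c, of S] vmod.subspace_0[OF B]
      by (cases "card S = p") (auto simp: zero)
    then show ?thesis unfolding chain_def by metis
  qed
  have push: "chain Z p j (\<lambda>S. \<pi> (c S))" if "chain (free_mod D) p j c" for p c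
    using that img by (auto simp: chain_def zero split: if_splits)
  show ?thesis
  proof
    assume h: "koszul_vanish (free_mod D) {v. \<pi> v \<in> B} p j"
    show "koszul_vanish Z B p j"
      unfolding koszul_vanish_def
    proof (intro allI impI)
      fix c assume c: "chain Z p j c" and cyc: "\<forall>S. kdiff_vec c S \<in> B"
      obtain C where C: "chain (free_mod D) p j C" "\<And>S. c S - \<pi> (C S) \<in> B" using lift[OF c] by blast
      have "\<pi> (kdiff_vec C S) \<in> B" for S
      proof -
        have "kdiff_vec (\<lambda>S. c S - \<pi> (C S)) S \<in> B" by (rule kdiff_vec_subspace[OF B C(2)])
        then have "kdiff_vec c S - \<pi> (kdiff_vec C S) \<in> B" by (simp add: kdiff_vec_diff kdiff_vec_hom[OF hom])
        from vmod.subspace_diff[OF B cyc[rule_format, of S] this] show ?thesis by simp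
      qed
      then obtain e where e: "chain (free_mod D) (Suc p) j e" "\<And>S. \<pi> (C S - kdiff_vec e S) \<in> B"
        using h C(1) by (auto simp: koszul_vanish_def)
      have "c S - kdiff_vec (\<lambda>S. \<pi> (e S)) S \<in> B" for S
        using vmod.subspace_add[OF B C(2)[of S] e(2)[of S]] by (simp add: diff kdiff_vec_hom[OF hom])
      then show "\<exists>e. chain Z (Suc p) j e \<and> (\<forall>S. c S - kdiff_vec e S \<in> B)" using push[OF e(1)] by blast
    qed
  next
    assume h: "koszul_vanish Z B p j"
    show "koszul_vanish (free_mod D) {v. \<pi> v \<in> B} p j"
      unfolding koszul_vanish_def
    proof (intro allI impI)
      fix c assume c: "chain (free_mod D) p j c" and cyc: "\<forall>S. kdiff_vec c S \<in> {v. \<pi> v \<in> B}"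
      have "\<forall>S. kdiff_vec (\<lambda>S. \<pi> (c S)) S \<in> B" using cyc by (simp add: kdiff_vec_hom[OF hom])
      then obtain e where e: "chain Z (Suc p) j e" "\<And>S. \<pi> (c S) - kdiff_vec e S \<in> B"
        using h push[OF c] by (auto simp: koszul_vanish_def)
      obtain E where E: "chain (free_mod D) (Suc p) j E" "\<And>S. e S - \<pi> (E S) \<in> B" using lift[OF e(1)] by blast
      have "\<pi> (c S - kdiff_vec E S) \<in> B" for S
      proof -
        have "kdiff_vec (\<lambda>S. e S - \<pi> (E S)) S \<in> B" by (rule kdiff_vec_subspace[OF B E(2)])
        then have "kdiff_vec e S - \<pi> (kdiff_vec E S) \<in> B" by (simp add: kdiff_vec_diff kdiff_vec_hom[OF hom])
        from vmod.subspace_add[OF B e(2)[of S] this] show ?thesis by (simp add: diff)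
      qed
      then show "\<exists>e. chain (free_mod D) (Suc p) j e \<and> (\<forall>S. c S - kdiff_vec e S \<in> {v. \<pi> v \<in> B})"
        using E(1) by auto
    qed
  qed
qed

end

section \<open>Free resolutions in terms of infinite vectors\<close>

definition supported :: "nat \<Rightarrow> (nat \<Rightarrow> 'a::zero) set" where
  "supported n = {v. \<forall>i\<ge>n. v i = 0}"

definition matv :: "(nat \<Rightarrow> nat \<Rightarrow> 'a::comm_ring_1) \<Rightarrow> nat \<Rightarrow> nat \<Rightarrow> (nat \<Rightarrow> 'a) \<Rightarrow> nat \<Rightarrow> 'a" where
  "matv a m n v = (\<lambda>i. if i < m then (\<Sum>c<n. a i c * v c) else 0)"

definition vpart :: "nat list \<Rightarrow> int \<Rightarrow> (nat \<Rightarrow> ('x::finite, 'k::comm_ring_1) mpoly) \<Rightarrow> nat \<Rightarrow> ('x, 'k) mpoly" where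
  "vpart D t v = (\<lambda>i. if i < length D then wpart UNIV (t - int (D ! i)) (v i) else 0)"

lemma module_hom_matv: "module_hom vscale vscale (matv a m n)"
  by unfold_locales
    (auto simp: matv_def vscale_def plus_fun_def fun_eq_iff algebra_simps sum.distrib sum_distrib_left)

lemma matv_cong: "(\<And>i c. i < m \<Longrightarrow> c < n \<Longrightarrow> a i c = b i c) \<Longrightarrow> matv a m n = matv b m n"
  by (auto simp: matv_def fun_eq_iff intro!: sum.cong)

lemma supported_subspace: "vmod.subspace (supported n)"
  by (auto intro!: vmod.subspaceI simp: supported_def vscale_def plus_fun_def)

lemma free_mod_supported: "free_mod D t \<subseteq> supported (length D)"
  by (auto simp: free_mod_def supported_def)

lemma vpart_free: "vpart D t v \<in> free_mod D t"
  by (simp add: vpart_def free_mod_def wpart_hom)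

lemma vpart_of_free: "v \<in> free_mod D t \<Longrightarrow> vpart D t v = v"
  by (auto simp: vpart_def free_mod_def wpart_of_hom fun_eq_iff)

text \<open>Allows exactness, which a resolution asserts for arbitrary vectors, to be used
  separately in each degree: a preimage of a homogeneous vector may be replaced by its component of
  the same degree.\<close>

lemma matv_vpart:
  assumes "\<And>i c. i < length D \<Longrightarrow> c < length D' \<Longrightarrow> a i c \<in> hom_part (int (D' ! c) - int (D ! i))"
  shows "matv a (length D) (length D') (vpart D' t w) = vpart D t (matv a (length D) (length D') w)"
proof
  fix i
  show "matv a (length D) (length D') (vpart D' t w) i = vpart D t (matv a (length D) (length D') w) i"
  proof (cases "i < length D")
    case True
    have "(\<Sum>c<length D'. a i c * wpart UNIV (t - int (D' ! c)) (w c)) =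
       (\<Sum>c<length D'. wpart UNIV (t - int (D ! i)) (a i c * w c))"
    proof (intro sum.cong refl)
      fix c assume "c \<in> {..<length D'}"
      then have "a i c \<in> hom_part (int (D' ! c) - int (D ! i))" using assms[OF True] by simp
      from wpart_mult_hom[OF this, of "t - int (D ! i)" "w c"]
      show "a i c * wpart UNIV (t - int (D' ! c)) (w c) = wpart UNIV (t - int (D ! i)) (a i c * w c)"
        by simp
    qed
    then show ?thesis using True by (simp add: matv_def vpart_def wpart_sum)
  qed (simp add: matv_def vpart_def)
qed

lemma matv_free:
  assumes "\<And>i c. i < length D \<Longrightarrow> c < length D' \<Longrightarrow> a i c \<in> hom_part (int (D' ! c) - int (D ! i))"
    and "w \<in> free_mod D' t"
  shows "matv a (length D) (length D') w \<in> free_mod D t"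
  using matv_vpart[OF assms(1), of t w] vpart_of_free[OF assms(2)] vpart_free by metis

definition vecfun :: "'a::zero vec \<Rightarrow> nat \<Rightarrow> 'a" where
  "vecfun v = (\<lambda>i. if i < dim_vec v then v $ i else 0)"

lemma vecfun_image: "vecfun ` carrier_vec n = (supported n :: (nat \<Rightarrow> 'a::zero) set)"
proof (intro equalityI subsetI)
  fix v :: "nat \<Rightarrow> 'a" assume "v \<in> supported n"
  then have "v = vecfun (vec n v)" by (auto simp: vecfun_def supported_def fun_eq_iff)
  then show "v \<in> vecfun ` carrier_vec n" by (metis image_eqI vec_carrier)
qed (auto simp: vecfun_def supported_def)

lemma vecfun_inj: "inj_on vecfun (carrier_vec n :: 'a::zero vec set)"
proof (rule inj_onI, rule eq_vecI)
  fix v w :: "'a vec" and i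
  assume vw: "v \<in> carrier_vec n" "w \<in> carrier_vec n" "vecfun v = vecfun w"
  then show "dim_vec v = dim_vec w" by (metis carrier_vecD)
  assume "i < dim_vec w"
  then show "v $ i = w $ i" using fun_cong[OF vw(3), of i] vw(1,2) by (simp add: vecfun_def)
qed

lemma vecfun_zero: "vecfun (0\<^sub>v n) = 0"
  by (auto simp: vecfun_def zero_fun_def)

lemma vecfun_mult:
  assumes "A \<in> carrier_mat m n" "w \<in> carrier_vec n"
  shows "vecfun (A *\<^sub>v w) = matv (\<lambda>i c. A $$ (i, c)) m n (vecfun w)"
proof
  fix i
  show "vecfun (A *\<^sub>v w) i = matv (\<lambda>i c. A $$ (i, c)) m n (vecfun w) i"
    using assms by (auto simp: vecfun_def matv_def scalar_prod_def atLeast0LessThan intro!: sum.cong)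
qed

lemma vecfun_scalar_prod:
  assumes "g \<in> carrier_vec n" "w \<in> carrier_vec n"
  shows "g \<bullet> w = (\<Sum>i<n. g $ i * vecfun w i)"
  using assms by (auto simp: scalar_prod_def vecfun_def atLeast0LessThan intro!: sum.cong)

lemma vecfun_eq_iff: "v \<in> carrier_vec n \<Longrightarrow> w \<in> carrier_vec n \<Longrightarrow> vecfun v = vecfun w \<longleftrightarrow> v = w"
  using inj_on_eq_iff[OF vecfun_inj] by blast

text \<open>The clauses of \<open>minimal_graded_free_resolution\<close> for vectors in one common
  type. The entry degrees become integer differences; a negative one forces the entry to be
  0.\<close>

definition fun_resolution :: "('x::finite, 'k::comm_ring_1) mpoly set \<Rightarrow> (nat \<Rightarrow> nat list) \<Rightarrow>
    (nat \<Rightarrow> ('x, 'k) mpoly) \<Rightarrow> (nat \<Rightarrow> nat \<Rightarrow> nat \<Rightarrow> ('x, 'k) mpoly) \<Rightarrow> bool" where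
  "fun_resolution J D g a \<longleftrightarrow>
     (\<forall>c<length (D 0). g c \<in> hom_part (int (D 0 ! c))) \<and>
     (\<forall>i. \<forall>r<length (D i). \<forall>c<length (D (Suc i)). a i r c \<in> hom_part (int (D (Suc i) ! c) - int (D i ! r))) \<and>
     (\<forall>f. \<exists>v\<in>supported (length (D 0)). f - (\<Sum>c<length (D 0). g c * v c) \<in> J) \<and>
     {v \<in> supported (length (D 0)). (\<Sum>c<length (D 0). g c * v c) \<in> J} =
       matv (a 0) (length (D 0)) (length (D 1)) ` supported (length (D 1)) \<and>
     (\<forall>i. {v \<in> supported (length (D (Suc i))). matv (a i) (length (D i)) (length (D (Suc i))) v = 0} =
       matv (a (Suc i)) (length (D (Suc i))) (length (D (Suc (Suc i)))) ` supported (length (D (Suc (Suc i))))) \<and>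
     (\<forall>i. \<forall>r<length (D i). \<forall>c<length (D (Suc i)). lookup (a i r c) 0 = 0)"

text \<open>\<open>vecfun\<close> is injective on vectors of fixed dimension and intertwines the two
  matrix actions, so both exactness statements are equivalent.\<close>

lemma image_eq_transfer:
  assumes "A \<in> carrier_mat m n"
    and P: "\<And>v. v \<in> carrier_vec m \<Longrightarrow> P v \<longleftrightarrow> Q (vecfun v)"
  shows "{v \<in> carrier_vec m. P v} = (\<lambda>w. A *\<^sub>v w) ` carrier_vec n \<longleftrightarrow>
    {v \<in> supported m. Q v} = matv (\<lambda>i c. A $$ (i, c)) m n ` supported n"
proof -
  have "{v \<in> carrier_vec m. P v} = (\<lambda>w. A *\<^sub>v w) ` carrier_vec n \<longleftrightarrow>
     vecfun ` {v \<in> carrier_vec m. P v} = vecfun ` (\<lambda>w. A *\<^sub>v w) ` carrier_vec n"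
    by (rule inj_on_image_eq_iff[OF vecfun_inj, symmetric])
      (use assms(1) mult_mat_vec_carrier in auto)
  also have "vecfun ` {v \<in> carrier_vec m. P v} = {v \<in> supported m. Q v}"
    unfolding vecfun_image[symmetric] using P by auto
  also have "vecfun ` (\<lambda>w. A *\<^sub>v w) ` carrier_vec n = matv (\<lambda>i c. A $$ (i, c)) m n ` supported n"
    unfolding vecfun_image[symmetric] image_image using vecfun_mult[OF assms(1)] by (intro image_cong) auto
  finally show ?thesis .
qed

lemma minimal_graded_free_resolution_iff:
  fixes J :: "('x::finite, 'k::comm_ring_1) mpoly set"
  shows "minimal_graded_free_resolution J D g A \<longleftrightarrow>
    g \<in> carrier_vec (length (D 0)) \<and> (\<forall>i. A i \<in> carrier_mat (length (D i)) (length (D (Suc i)))) \<and>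
    fun_resolution J D (\<lambda>c. g $ c) (\<lambda>i r c. A i $$ (r, c))"
proof (cases "g \<in> carrier_vec (length (D 0)) \<and> (\<forall>i. A i \<in> carrier_mat (length (D i)) (length (D (Suc i))))")
  case True
  then have g: "g \<in> carrier_vec (length (D 0))" and A: "\<And>i. A i \<in> carrier_mat (length (D i)) (length (D (Suc i)))"
    by auto
  have 1: "(\<forall>f. \<exists>v\<in>carrier_vec (length (D 0)). f - g \<bullet> v \<in> J) \<longleftrightarrow>
    (\<forall>f. \<exists>v\<in>supported (length (D 0)). f - (\<Sum>c<length (D 0). g $ c * v c) \<in> J)"
    unfolding vecfun_image[symmetric] using vecfun_scalar_prod[OF g] by auto
  have 2: "{v \<in> carrier_vec (length (D 0)). g \<bullet> v \<in> J} = (\<lambda>w. A 0 *\<^sub>v w) ` carrier_vec (length (D 1)) \<longleftrightarrow>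
    {v \<in> supported (length (D 0)). (\<Sum>c<length (D 0). g $ c * v c) \<in> J} =
       matv (\<lambda>r c. A 0 $$ (r, c)) (length (D 0)) (length (D 1)) ` supported (length (D 1))"
    by (rule image_eq_transfer) (use A[of 0] vecfun_scalar_prod[OF g] in \<open>simp_all add: One_nat_def\<close>)
  have 3: "{v \<in> carrier_vec (length (D (Suc i))). A i *\<^sub>v v = 0\<^sub>v (length (D i))} =
       (\<lambda>w. A (Suc i) *\<^sub>v w) ` carrier_vec (length (D (Suc (Suc i)))) \<longleftrightarrow>
     {v \<in> supported (length (D (Suc i))). matv (\<lambda>r c. A i $$ (r, c)) (length (D i)) (length (D (Suc i))) v = 0} =
       matv (\<lambda>r c. A (Suc i) $$ (r, c)) (length (D (Suc i))) (length (D (Suc (Suc i)))) ` supported (length (D (Suc (Suc i))))"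
    for i
  proof (rule image_eq_transfer)
    fix v :: "('x, 'k) mpoly vec" assume v: "v \<in> carrier_vec (length (D (Suc i)))"
    have "A i *\<^sub>v v \<in> carrier_vec (length (D i))" using A v by (rule mult_mat_vec_carrier)
    then show "A i *\<^sub>v v = 0\<^sub>v (length (D i)) \<longleftrightarrow>
       matv (\<lambda>r c. A i $$ (r, c)) (length (D i)) (length (D (Suc i))) (vecfun v) = 0"
      using vecfun_eq_iff[of "A i *\<^sub>v v" "length (D i)" "0\<^sub>v (length (D i))"]
      by (simp add: vecfun_zero vecfun_mult[OF A[of i] v, symmetric])
  qed (rule A)
  have 4: "(\<forall>m\<in>keys f. d + mon_deg m = e) \<longleftrightarrow> f \<in> hom_part (int e - int d)" for f :: "('x, 'k) mpoly" and d e
    unfolding hom_part_def mon_deg_eq_wt by auto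
  show ?thesis
    unfolding minimal_graded_free_resolution_def fun_resolution_def 4 1 2 3 ideal_gen_Var graded_part_eq mem_Collect_eq
    by (simp only: g A simp_thms)
qed (auto simp: minimal_graded_free_resolution_def)

context koszul
begin

text \<open>The zeroth Koszul homology of F/N is F modulo N and the variable multiples of F. As N
  has no constant terms this is F modulo its variable multiples, which lives exactly in the degrees
  of the basis elements.\<close>

lemma koszul_vanish_0_iff:
  fixes N :: "(nat \<Rightarrow> ('x, 'k::comm_ring_1) mpoly) set"
  assumes N: "vmod.subspace N"
    and min: "\<And>v i. v \<in> N \<Longrightarrow> v \<in> supported (length D) \<Longrightarrow> lookup (v i) 0 = 0"
  shows "koszul_vanish (free_mod D) N 0 j \<longleftrightarrow> j \<notin> int ` set D"
proof
  assume h: "koszul_vanish (free_mod D) N 0 j"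
  show "j \<notin> int ` set D"
  proof
    assume "j \<in> int ` set D"
    then obtain i where i: "i < length D" "j = int (D ! i)" by (auto simp: in_set_conv_nth)
    \<comment> \<open>A basis vector of degree \<open>j\<close> is not a boundary modulo N:
      boundaries and N have constant term 0 in component \<open>i\<close>, while \<open>u\<close>
      has constant term 1.\<close>
    define u :: "nat \<Rightarrow> ('x, 'k) mpoly" where "u = (\<lambda>l. if l = i then 1 else 0)"
    define c where "c = (\<lambda>S::'x set. if S = {} then u else 0)"
    have "u \<in> free_mod D j" using i by (auto simp: free_mod_def u_def hom_part_def)
    then have c: "chain (free_mod D) 0 j c" by (intro chainI) (auto simp: c_def)
    have "kdiff_vec c S = 0" for S by (simp add: kdiff_vec_def c_def)
    then obtain e where e: "chain (free_mod D) (Suc 0) j e" "\<And>S. c S - kdiff_vec e S \<in> N"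
      using h c vmod.subspace_0[OF N] by (auto simp: koszul_vanish_def)
    have "kdiff_vec e {} \<in> free_mod D j"
      using chain_mem[OF chain_kdiff_vec[OF graded_mod_free e(1)], of "{}"] by simp
    then have "c {} - kdiff_vec e {} \<in> free_mod D j" using \<open>u \<in> free_mod D j\<close>
      by (simp add: c_def graded_modD(3)[OF graded_mod_free])
    then have "lookup ((c {} - kdiff_vec e {}) i) 0 = 0" using min e(2) free_mod_supported by blast
    moreover have "lookup (kdiff_vec e {} i) 0 = 0" by (simp add: kdiff_vec_apply lookup_kdiff)
    ultimately show False by (simp add: c_def u_def lookup_minus)
  qed
next
  assume j: "j \<notin> int ` set D"
  show "koszul_vanish (free_mod D) N 0 j"
    unfolding koszul_vanish_def
  proof (intro allI impI)
    fix c :: "'x set \<Rightarrow> nat \<Rightarrow> ('x, 'k) mpoly"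
    assume c: "chain (free_mod D) 0 j c"
    have w: "c {} \<in> free_mod D j" using chain_mem[OF c, of "{}"] by simp
    have "lookup (c {} i) 0 = 0" for i
    proof (cases "i < length D")
      case True
      then have "c {} i \<in> hom_part (j - int (D ! i))" "j - int (D ! i) \<noteq> 0" using w j by (auto simp: free_mod_def)
      then show ?thesis by (rule hom_part_no_const)
    qed (use w in \<open>auto simp: free_mod_def\<close>)
    from free_exact_0[OF w this] obtain e where e: "chain (free_mod D) 1 j e" "kdiff_vec e {} = c {}" by blast
    have "c S - kdiff_vec e S = 0" for S
      using e(2) kdiff_vec_degree_1[OF e(1)] chain_card[OF c, of S] by (cases "S = {}") auto
    then show "\<exists>e. chain (free_mod D) (Suc 0) j e \<and> (\<forall>S. c S - kdiff_vec e S \<in> N)"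
      using e(1) vmod.subspace_0[OF N] by (auto simp: One_nat_def)
  qed
qed

text \<open>The presentation of N by the next free module F' identifies F' modulo its kernel with N;
  the connecting map then raises the homological index by one.\<close>

lemma koszul_vanish_syzygy_step:
  fixes a :: "nat \<Rightarrow> nat \<Rightarrow> ('x, 'k::comm_ring_1) mpoly"
  assumes hom: "\<And>i c. i < length D \<Longrightarrow> c < length D' \<Longrightarrow> a i c \<in> hom_part (int (D' ! c) - int (D ! i))"
    and N: "vmod.subspace N" and img: "N \<inter> supported (length D) = matv a (length D) (length D') ` supported (length D')"
    and min: "\<And>i c. i < length D \<Longrightarrow> c < length D' \<Longrightarrow> lookup (a i c) 0 = 0"
  shows "koszul_vanish (free_mod D') {v. matv a (length D) (length D') v = 0} p j \<longleftrightarrow> koszul_vanish (free_mod D) N (Suc p) j"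
proof -
  let ?\<pi> = "matv a (length D) (length D')"
  have min': "lookup (v i) 0 = 0" if "v \<in> N \<inter> free_mod D t" for v i t
  proof -
    from that have "v \<in> N \<inter> supported (length D)" using free_mod_supported by blast
    then obtain w where "v = ?\<pi> w" using img by blast
    then show ?thesis
      by (cases "i < length D") (auto simp: matv_def lookup_sum min intro!: sum.neutral lookup_mult_zero_right
         simp: mult.commute[of "a _ _"])
  qed
  have "koszul_vanish (free_mod D') {v. ?\<pi> v \<in> {0}} p j \<longleftrightarrow> koszul_vanish (\<lambda>t. N \<inter> free_mod D t) {0} p j"
  proof (rule koszul_vanish_presentation)
    show "module_hom vscale vscale ?\<pi>" by (rule module_hom_matv)
    show "vmod.subspace {0}" by simp
    show "graded_mod (\<lambda>t. N \<inter> free_mod D t)" by (rule graded_mod_Int[OF N])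
    fix t
    show "?\<pi> v \<in> N \<inter> free_mod D t" if "v \<in> free_mod D' t" for v
      using matv_free[OF hom that] img that free_mod_supported[of D' t] by blast
    show "\<exists>v\<in>free_mod D' t. z - ?\<pi> v \<in> {0}" if "z \<in> N \<inter> free_mod D t" for z
    proof -
      have "z \<in> N \<inter> supported (length D)" using that by (auto intro: subsetD[OF free_mod_supported])
      then obtain w where w: "z = ?\<pi> w" unfolding img by (elim imageE)
      have "z = vpart D t z" using that by (simp add: vpart_of_free)
      also have "\<dots> = ?\<pi> (vpart D' t w)" unfolding w by (rule matv_vpart[OF hom, symmetric])
      finally show ?thesis using vpart_free by (intro bexI[of _ "vpart D' t w"]) auto
    qed
  qed
  also have "\<dots> \<longleftrightarrow> koszul_vanish (free_mod D) N (Suc p) j"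
    using syzygy_vanish_imp[OF N] vanish_imp_syzygy[OF N] min' by blast
  finally show ?thesis by simp
qed

text \<open>R/J is the free module on one generator of degree 0 modulo J; components beyond the
  first are zero for all chains.\<close>

definition quotient_koszul_vanish :: "('x, 'k::comm_ring_1) mpoly set \<Rightarrow> nat \<Rightarrow> int \<Rightarrow> bool" where
  "quotient_koszul_vanish J p j \<longleftrightarrow> koszul_vanish (free_mod [0]) {v. \<forall>i. v i \<in> J} p j"

lemma subspace_components: "is_ideal J \<Longrightarrow> vmod.subspace {v. \<forall>i. v i \<in> J}"
  by (auto intro!: vmod.subspaceI simp: plus_fun_def vscale_def zero_fun_def
     rmod.subspace_0 rmod.subspace_add rmod.subspace_scale)

text \<open>Computes the degrees in \<open>D i\<close> independently of the chosen resolution. The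
  hypothesis on \<open>wpart\<close> says that \<open>J\<close> is homogeneous.\<close>

lemma resolution_koszul:
  fixes J :: "('x, 'k::comm_ring_1) mpoly set"
  assumes res: "minimal_graded_free_resolution J D g A"
    and J: "is_ideal J" and hJ: "\<And>f t. f \<in> J \<Longrightarrow> wpart UNIV t f \<in> J"
  shows "quotient_koszul_vanish J i j \<longleftrightarrow> j \<notin> int ` set (D i)"
proof -
  define a where "a = (\<lambda>i r c. A i $$ (r, c))"
  define n where "n i = length (D i)" for i
  note fr = res[unfolded minimal_graded_free_resolution_iff, THEN conjunct2, THEN conjunct2,
      folded a_def, unfolded fun_resolution_def, folded n_def]
  note fr' = fr[THEN conjunct2]
  note fr'' = fr'[THEN conjunct2]
  note fr3 = fr''[THEN conjunct2]
  have ghom: "\<And>c. c < n 0 \<Longrightarrow> g $ c \<in> hom_part (int (D 0 ! c))"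
    using fr[THEN conjunct1] by simp
  have ahom: "\<And>i r c. r < n i \<Longrightarrow> c < n (Suc i) \<Longrightarrow> a i r c \<in> hom_part (int (D (Suc i) ! c) - int (D i ! r))"
    using fr'[THEN conjunct1] by simp
  have gsurj: "\<And>f. \<exists>v\<in>supported (n 0). f - (\<Sum>c<n 0. g $ c * v c) \<in> J"
    using fr''[THEN conjunct1] by simp
  have ex0: "{v \<in> supported (n 0). (\<Sum>c<n 0. g $ c * v c) \<in> J} = matv (a 0) (n 0) (n 1) ` supported (n 1)"
    using fr3[THEN conjunct1] .
  have exS: "\<And>i. {v \<in> supported (n (Suc i)). matv (a i) (n i) (n (Suc i)) v = 0} =
       matv (a (Suc i)) (n (Suc i)) (n (Suc (Suc i))) ` supported (n (Suc (Suc i)))"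
    using fr3[THEN conjunct2, THEN conjunct1] by simp
  have amin: "\<And>i r c. r < n i \<Longrightarrow> c < n (Suc i) \<Longrightarrow> lookup (a i r c) 0 = 0"
    using fr3[THEN conjunct2, THEN conjunct2] by simp
  let ?B = "{v :: nat \<Rightarrow> ('x, 'k) mpoly. \<forall>i. v i \<in> J}"
  let ?\<gamma> = "matv (\<lambda>r c. g $ c) 1 (n 0)"
  \<comment> \<open>\<open>N i\<close> is the kernel of the map out of the \<open>i\<close>-th free
    module, so the quotient by it is the \<open>i\<close>-th syzygy module of R/J.\<close>
  define N where "N = (\<lambda>i. case i of 0 \<Rightarrow> {v. ?\<gamma> v \<in> ?B} | Suc i \<Rightarrow> {v. matv (a i) (n i) (n (Suc i)) v = 0})"
  have B: "vmod.subspace ?B" by (rule subspace_components[OF J])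
  have N: "vmod.subspace (N i)" for i
  proof (cases i)
    case 0
    interpret module_hom vscale vscale ?\<gamma> by (rule module_hom_matv)
    show ?thesis using subspace_linear_preimage[OF B] by (simp add: N_def 0)
  next
    case (Suc l)
    interpret module_hom vscale vscale "matv (a l) (n l) (n (Suc l))" by (rule module_hom_matv)
    show ?thesis using subspace_kernel by (simp add: N_def Suc)
  qed
  have \<gamma>: "?\<gamma> v \<in> ?B \<longleftrightarrow> (\<Sum>c<n 0. g $ c * v c) \<in> J" for v
    using rmod.subspace_0[OF J] by (auto simp: matv_def)
  have img: "N i \<inter> supported (n i) = matv (a i) (n i) (n (Suc i)) ` supported (n (Suc i))" for i
  proof (cases i)
    case 0
    have "N 0 \<inter> supported (n 0) = {v \<in> supported (n 0). (\<Sum>c<n 0. g $ c * v c) \<in> J}"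
      unfolding N_def using \<gamma> by auto
    then show ?thesis using ex0 0 by (simp add: One_nat_def)
  next
    case (Suc l)
    then show ?thesis using exS[of l] unfolding N_def by auto
  qed
  have base: "koszul_vanish (free_mod (D 0)) (N 0) p j \<longleftrightarrow> quotient_koszul_vanish J p j" for p
    unfolding N_def nat.case quotient_koszul_vanish_def
  proof (rule koszul_vanish_presentation)
    show "module_hom vscale vscale ?\<gamma>" by (rule module_hom_matv)
    show "vmod.subspace ?B" by (rule B)
    show "graded_mod (free_mod [0] :: int \<Rightarrow> (nat \<Rightarrow> ('x, 'k) mpoly) set)" by (rule graded_mod_free)
    fix t
    have gh: "g $ c \<in> hom_part (int (D 0 ! c) - int ([0] ! r))" if "r < length [0::nat]" "c < length (D 0)" for r c
      using that ghom[of c] by (simp add: n_def)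
    show "?\<gamma> v \<in> free_mod [0] t" if "v \<in> free_mod (D 0) t" for v
      using matv_free[OF gh that] by (simp add: n_def One_nat_def)
    show "\<exists>v\<in>free_mod (D 0) t. z - ?\<gamma> v \<in> ?B" if z: "z \<in> free_mod [0] t" for z
    proof -
      obtain v where v: "v \<in> supported (n 0)" "z 0 - (\<Sum>c<n 0. g $ c * v c) \<in> J" using gsurj by blast
      have "matv (\<lambda>r c. g $ c) 1 (n 0) (vpart (D 0) t v) = vpart [0] t (?\<gamma> v)"
        using matv_vpart[OF gh, of t v] by (simp add: n_def One_nat_def)
      moreover have "(z - vpart [0] t (?\<gamma> v)) i \<in> J" for i
      proof (cases "i = 0")
        case True
        have "z 0 = wpart UNIV t (z 0)" using z by (auto simp: free_mod_def wpart_of_hom)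
        then have "(z - vpart [0] t (?\<gamma> v)) 0 = wpart UNIV t (z 0 - (\<Sum>c<n 0. g $ c * v c))"
          by (simp add: vpart_def matv_def wpart_diff)
        then show ?thesis using hJ[OF v(2)] True by simp
      next
        case False
        then have "z i = 0" "vpart [0] t (?\<gamma> v) i = 0" using z by (auto simp: free_mod_def vpart_def One_nat_def)
        then show ?thesis using rmod.subspace_0[OF J] by simp
      qed
      ultimately show ?thesis using vpart_free[of "D 0" t v] by (intro bexI[of _ "vpart (D 0) t v"]) auto
    qed
  qed
  have step: "koszul_vanish (free_mod (D (Suc i))) (N (Suc i)) p j \<longleftrightarrow> koszul_vanish (free_mod (D i)) (N i) (Suc p) j" for i p
    using koszul_vanish_syzygy_step[of "D i" "D (Suc i)" "a i" "N i" p j] ahom amin N[of i] img[of i]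
    by (simp add: N_def n_def)
  \<comment> \<open>Each syzygy step trades one resolution index for one homological index;
    \<open>p = 0\<close> then leaves the zeroth homology, where basis degrees are visible.\<close>
  have "koszul_vanish (free_mod (D i)) (N i) p j \<longleftrightarrow> quotient_koszul_vanish J (p + i) j" for p
    by (induction i arbitrary: p) (simp_all add: base step)
  from this[of 0] have "quotient_koszul_vanish J i j \<longleftrightarrow> koszul_vanish (free_mod (D i)) (N i) 0 j" by simp
  also have "\<dots> \<longleftrightarrow> j \<notin> int ` set (D i)"
  proof (rule koszul_vanish_0_iff[OF N])
    fix v l assume "v \<in> N i" "v \<in> supported (length (D i))"
    then obtain w where "v = matv (a i) (n i) (n (Suc i)) w" using img[of i] by (auto simp: n_def)
    then show "lookup (v l) 0 = 0"
      using amin[of l i]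
      by (auto simp: matv_def lookup_sum intro!: sum.neutral) (metis lookup_mult_zero_right mult.commute)
  qed
  finally show ?thesis .
qed

end

section \<open>Existence of minimal resolutions\<close>

lemma finite_expos: "finite {m :: ('x::finite) expo. int (wt UNIV m) = t}"
proof (rule finite_imageD)
  have "lookup ` {m :: 'x expo. int (wt UNIV m) = t} \<subseteq> {f. \<forall>x. (x \<in> UNIV \<longrightarrow> f x \<in> {..nat t}) \<and> (x \<notin> UNIV \<longrightarrow> f x = 0)}"
  proof
    fix f assume "f \<in> lookup ` {m :: 'x expo. int (wt UNIV m) = t}"
    then obtain m :: "'x expo" where m: "f = lookup m" "int (wt UNIV m) = t" by blast
    then have "f x \<le> nat t" for x using lookup_le_wt[of x UNIV m] by simp
    then show "f \<in> {f. \<forall>x. (x \<in> UNIV \<longrightarrow> f x \<in> {..nat t}) \<and> (x \<notin> UNIV \<longrightarrow> f x = 0)}" by simp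
  qed
  then show "finite (lookup ` {m :: 'x expo. int (wt UNIV m) = t})"
    by (rule finite_subset) (rule finite_set_of_finite_funs, auto)
  show "inj_on lookup {m :: 'x expo. int (wt UNIV m) = t}"
    by (rule inj_onI) (simp only: poly_mapping_eq_iff)
qed

text \<open>The same vectors over the base field, for dimension arguments in a fixed degree.\<close>

definition kscale :: "'k::field \<Rightarrow> (nat \<Rightarrow> ('x::finite, 'k) mpoly) \<Rightarrow> nat \<Rightarrow> ('x, 'k) mpoly" where
  "kscale k v = vscale (single 0 k) v"

interpretation kvec: vector_space "kscale :: 'k::field \<Rightarrow> (nat \<Rightarrow> ('x::finite, 'k) mpoly) \<Rightarrow> nat \<Rightarrow> ('x, 'k) mpoly"
  by unfold_locales
    (simp_all add: kscale_def vmod.scale_right_distrib vmod.scale_left_distrib[symmetric] single_add[symmetric] mult_single)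

lemma free_mod_finite_dim:
  "\<exists>T. finite T \<and> (free_mod D t :: (nat \<Rightarrow> ('x::finite, 'k::field) mpoly) set) \<subseteq> kvec.span T"
proof (intro exI conjI subsetI)
  define u :: "nat \<Rightarrow> 'x expo \<Rightarrow> nat \<Rightarrow> ('x, 'k) mpoly" where "u = (\<lambda>i m l. if l = i then single m 1 else 0)"
  let ?T = "(\<lambda>(i, m). u i m) ` Sigma {..<length D} (\<lambda>i. {m. int (wt UNIV m) = t - int (D ! i)})"
  show "finite ?T" by (intro finite_imageI finite_SigmaI finite_expos) simp
  fix v :: "nat \<Rightarrow> ('x, 'k) mpoly" assume v: "v \<in> free_mod D t"
  have "v = (\<Sum>i<length D. \<Sum>m\<in>keys (v i). kscale (lookup (v i) m) (u i m))"
  proof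
    fix l
    have "(\<Sum>i<length D. \<Sum>m\<in>keys (v i). kscale (lookup (v i) m) (u i m)) l =
       (\<Sum>i<length D. if i = l then \<Sum>m\<in>keys (v l). single m (lookup (v l) m) else 0)"
      unfolding sum_fun_apply
      by (intro sum.cong refl) (auto simp: kscale_def vscale_def u_def mult_single intro!: sum.cong sum.neutral)
    also have "\<dots> = v l" using v by (auto simp: sum_monomials free_mod_def)
    finally show "v l = (\<Sum>i<length D. \<Sum>m\<in>keys (v i). kscale (lookup (v i) m) (u i m)) l" by simp
  qed
  also have "\<dots> \<in> kvec.span ?T"
  proof (intro kvec.span_sum kvec.span_scale kvec.span_base)
    fix i m assume "i \<in> {..<length D}" "m \<in> keys (v i)"
    then have "(i, m) \<in> Sigma {..<length D} (\<lambda>i. {m. int (wt UNIV m) = t - int (D ! i)})"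
      using v by (auto simp: free_mod_def hom_part_def)
    then show "u i m \<in> ?T" by (metis (no_types, lifting) case_prod_conv image_eqI)
  qed
  finally show "v \<in> kvec.span ?T" .
qed

text \<open>A maximal linearly independent subset over the field is finite because a single degree
  is finite-dimensional, and its span over the field lies in its span over R.\<close>

lemma finite_basis_in_free_mod:
  fixes V :: "(nat \<Rightarrow> ('x::finite, 'k::field) mpoly) set"
  assumes "V \<subseteq> free_mod D t"
  shows "\<exists>B. finite B \<and> B \<subseteq> V \<and> V \<subseteq> vmod.span B"
proof -
  obtain B where B: "B \<subseteq> V" "kvec.independent B" "V \<subseteq> kvec.span B"
    using kvec.maximal_independent_subset .
  obtain T :: "(nat \<Rightarrow> ('x, 'k) mpoly) set" where T: "finite T" "free_mod D t \<subseteq> kvec.span T"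
    using free_mod_finite_dim by blast
  have "finite B" using kvec.independent_span_bound[OF T(1) B(2)] B(1) T(2) assms by blast
  moreover have "kvec.span B \<subseteq> vmod.span B"
    by (rule kvec.span_minimal)
      (auto intro!: kvec.subspaceI simp: vmod.span_base vmod.span_zero vmod.span_add kscale_def vmod.span_scale)
  ultimately show ?thesis using B by blast
qed

lemma sum_vparts:
  assumes "v \<in> supported (length D)"
  shows "\<exists>T. finite T \<and> (\<forall>t\<in>T. 0 \<le> t) \<and> v = (\<Sum>t\<in>T. vpart D t v)"
proof (intro exI conjI)
  define T where "T = (\<Union>i<length D. (\<lambda>m. int (wt UNIV m) + int (D ! i)) ` keys (v i))"
  show fT: "finite T" unfolding T_def by simp
  show "\<forall>t\<in>T. 0 \<le> t" by (auto simp: T_def)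
  show "v = (\<Sum>t\<in>T. vpart D t v)"
  proof
    fix i
    show "v i = (\<Sum>t\<in>T. vpart D t v) i"
    proof (cases "i < length D")
      case True
      have "(\<Sum>t\<in>T. wpart UNIV (t - int (D ! i)) (v i)) = (\<Sum>t\<in>(\<lambda>t. t - int (D ! i)) ` T. wpart UNIV t (v i))"
        by (subst sum.reindex) (auto simp: inj_on_def)
      also have "\<dots> = v i"
      proof (rule sum_wparts)
        show "finite ((\<lambda>t. t - int (D ! i)) ` T)" using fT by simp
        fix m assume "m \<in> keys (v i)"
        then have "int (wt UNIV m) + int (D ! i) \<in> T" using True by (auto simp: T_def)
        then show "int (wt UNIV m) \<in> (\<lambda>t. t - int (D ! i)) ` T" by (rule rev_image_eqI) simp
      qed
      finally show ?thesis using True by (simp add: sum_fun_apply vpart_def)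
    next
      case False
      then show ?thesis using assms by (simp add: sum_fun_apply vpart_def supported_def)
    qed
  qed
qed

lemma fun_resolution_cong:
  assumes res: "fun_resolution J D g a"
    and g: "\<And>c. c < length (D 0) \<Longrightarrow> g c = g' c"
    and a: "\<And>i r c. r < length (D i) \<Longrightarrow> c < length (D (Suc i)) \<Longrightarrow> a i r c = a' i r c"
  shows "fun_resolution J D g' a'"
proof -
  have m: "matv (a i) (length (D i)) (length (D (Suc i))) = matv (a' i) (length (D i)) (length (D (Suc i)))" for i
    by (rule matv_cong) (rule a)
  have m0: "matv (a 0) (length (D 0)) (length (D 1)) = matv (a' 0) (length (D 0)) (length (D 1))"
    using m[of 0] by (simp add: One_nat_def)
  have s: "(\<Sum>c<length (D 0). g c * v c) = (\<Sum>c<length (D 0). g' c * v c)" for v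
    using g by (intro sum.cong) auto
  show ?thesis
    using res unfolding fun_resolution_def m m0 s using g a by simp
qed

context koszul
begin

lemma koszul_vanish_Int_supported: "koszul_vanish (free_mod D) (N \<inter> supported (length D)) p j \<longleftrightarrow> koszul_vanish (free_mod D) N p j"
proof -
  have s: "c S \<in> supported (length D)" if "chain (free_mod D) p j c" for c :: "'x set \<Rightarrow> nat \<Rightarrow> ('x, 'a) mpoly" and S p
    using chain_mem[OF that, of S] chain_card[OF that, of S] subsetD[OF free_mod_supported] vmod.subspace_0[OF supported_subspace]
    by (cases "card S = p") auto
  have d: "kdiff_vec c S \<in> supported (length D)" if "chain (free_mod D) p j c" for c :: "'x set \<Rightarrow> nat \<Rightarrow> ('x, 'a) mpoly" and S p
    by (rule kdiff_vec_subspace[OF supported_subspace]) (rule s[OF that])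
  have "kdiff_vec c S \<in> N \<inter> supported (length D) \<longleftrightarrow> kdiff_vec c S \<in> N" if "chain (free_mod D) p j c" for c :: "'x set \<Rightarrow> nat \<Rightarrow> ('x, 'a) mpoly" and S
    using d[OF that] by simp
  moreover have "c S - kdiff_vec e S \<in> N \<inter> supported (length D) \<longleftrightarrow> c S - kdiff_vec e S \<in> N"
    if "chain (free_mod D) p j c" "chain (free_mod D) (Suc p) j e" for c e :: "'x set \<Rightarrow> nat \<Rightarrow> ('x, 'a) mpoly" and S
    using vmod.subspace_diff[OF supported_subspace s[OF that(1)] d[OF that(2)]] by simp
  ultimately show ?thesis unfolding koszul_vanish_def by meson
qed

text \<open>The invariant of the construction of a resolution. The bound \<open>b\<close> on total
  degrees is uniform in \<open>p\<close>, so it survives the index shift to the next syzygy module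
  unchanged.\<close>

definition syz_state :: "int \<Rightarrow> nat list \<Rightarrow> (nat \<Rightarrow> ('x, 'k::comm_ring_1) mpoly) set \<Rightarrow> bool" where
  "syz_state b D N \<longleftrightarrow> vmod.subspace N \<and> N \<subseteq> supported (length D) \<and> (\<forall>v\<in>N. \<forall>t. vpart D t v \<in> N) \<and>
     (\<forall>v\<in>N. \<forall>i. lookup (v i) 0 = 0) \<and> (\<forall>p j. b < j \<longrightarrow> koszul_vanish (free_mod D) N p j)"

text \<open>Since \<open>N/\<mm>N\<close> vanishes in degrees above \<open>b\<close>, the module is generated in degrees at most \<open>b\<close>,
  where it is finite-dimensional.\<close>

lemma syz_state_finitely_generated:
  fixes N :: "(nat \<Rightarrow> ('x, 'k::field) mpoly) set"
  assumes st: "syz_state b D N" and b: "0 \<le> b"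
  shows "\<exists>gs. (\<forall>(d, v)\<in>set gs. v \<in> N \<inter> free_mod D (int d)) \<and> N \<subseteq> vmod.span (snd ` set gs)"
proof -
  have N: "vmod.subspace N" and Ns: "N \<subseteq> supported (length D)" and vp: "\<And>v t. v \<in> N \<Longrightarrow> vpart D t v \<in> N"
    and min: "\<And>v i. v \<in> N \<Longrightarrow> lookup (v i) 0 = 0" and h: "\<And>p j. b < j \<Longrightarrow> koszul_vanish (free_mod D) N p j"
    using st by (auto simp: syz_state_def)
  have "\<forall>t. \<exists>B. finite B \<and> B \<subseteq> N \<inter> free_mod D t \<and> N \<inter> free_mod D t \<subseteq> vmod.span B"
    by (intro allI finite_basis_in_free_mod) auto
  then obtain B where B: "\<And>t. finite (B t)" "\<And>t. B t \<subseteq> N \<inter> free_mod D t" "\<And>t. N \<inter> free_mod D t \<subseteq> vmod.span (B t)"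
    by metis
  define G where "G = (\<Union>t\<le>nat b. Pair t ` B (int t))"
  have "finite G" unfolding G_def using B(1) by simp
  then obtain gs where gs: "set gs = G" using finite_list by blast
  have low: "N \<inter> free_mod D (int t) \<subseteq> vmod.span (snd ` G)" for t
  proof (induction t rule: less_induct)
    case (less t)
    show ?case
    proof (cases "int t \<le> b")
      case True
      then have "Pair t ` B (int t) \<subseteq> G" unfolding G_def by (intro UN_upper) simp
      then have "snd ` Pair t ` B (int t) \<subseteq> snd ` G" by (rule image_mono)
      then have "B (int t) \<subseteq> snd ` G" by (simp add: image_image)
      then show ?thesis using B(3)[of "int t"] vmod.span_mono by blast
    next
      case False
      \<comment> \<open>The zeroth homology of N is governed by the first homology of F/N. Its
        vanishing says that degree \<open>t\<close> of N consists of combinations of variables times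
        elements of degree \<open>t - 1\<close>.\<close>
      have hN: "koszul_vanish (\<lambda>t. N \<inter> free_mod D t) {0} 0 (int t)"
        by (rule vanish_imp_syzygy[OF N]) (use h False min in auto)
      show ?thesis
      proof
        fix v assume v: "v \<in> N \<inter> free_mod D (int t)"
        define c where "c = (\<lambda>S::'x set. if S = {} then v else 0)"
        have "chain (\<lambda>t. N \<inter> free_mod D t) 0 (int t) c" using v by (intro chainI) (auto simp: c_def)
        moreover have "kdiff_vec c S = 0" for S by (simp add: kdiff_vec_def c_def)
        ultimately obtain e where e: "chain (\<lambda>t. N \<inter> free_mod D t) (Suc 0) (int t) e" "\<And>S. c S - kdiff_vec e S = 0"
          using hN by (auto simp: koszul_vanish_def)
        have "v = kdiff_vec e {}" using e(2)[of "{}"] by (simp add: c_def)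
        also have "\<dots> \<in> vmod.span (snd ` G)"
          unfolding kdiff_vec_def
        proof (intro vmod.span_sum vmod.span_scale)
          fix u
          have "e {u} \<in> N \<inter> free_mod D (int (t - 1))"
            using chain_mem[OF e(1), of "{u}"] False b by (simp add: of_nat_diff)
          then show "e {u} \<in> vmod.span (snd ` G)" using less.IH[of "t - 1"] False b by auto
        qed
        finally show "v \<in> vmod.span (snd ` G)" .
      qed
    qed
  qed
  have "N \<subseteq> vmod.span (snd ` G)"
  proof
    fix v assume v: "v \<in> N"
    obtain T where T: "finite T" "\<forall>t\<in>T. 0 \<le> t" "v = (\<Sum>t\<in>T. vpart D t v)"
      using sum_vparts subsetD[OF Ns v] by blast
    have "vpart D t v \<in> vmod.span (snd ` G)" if "t \<in> T" for t
    proof -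
      have "vpart D t v \<in> N \<inter> free_mod D (int (nat t))" using T(2) that vp[OF v] by (simp add: vpart_free)
      then show ?thesis by (rule subsetD[OF low])
    qed
    then show "v \<in> vmod.span (snd ` G)" by (subst T(3)) (rule vmod.span_sum)
  qed
  moreover have "v \<in> N \<inter> free_mod D (int d)" if "(d, v) \<in> G" for d v
  proof -
    from that have "v \<in> B (int d)" unfolding G_def by auto
    then show ?thesis by (rule subsetD[OF B(2)])
  qed
  ultimately show ?thesis unfolding gs[symmetric] by (intro exI[of _ gs]) auto
qed

definition syz_next :: "nat list \<Rightarrow> (nat \<Rightarrow> ('x, 'k::comm_ring_1) mpoly) set \<Rightarrow> nat list \<Rightarrow>
    (nat \<Rightarrow> ('x, 'k) mpoly) set \<Rightarrow> (nat \<Rightarrow> nat \<Rightarrow> ('x, 'k) mpoly) \<Rightarrow> bool" where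
  "syz_next D N D' N' a \<longleftrightarrow>
     (\<forall>r<length D. \<forall>c<length D'. a r c \<in> hom_part (int (D' ! c) - int (D ! r)) \<and> lookup (a r c) 0 = 0) \<and>
     N = matv a (length D) (length D') ` supported (length D') \<and>
     N' = {v \<in> supported (length D'). matv a (length D) (length D') v = 0}"

text \<open>Choosing as few homogeneous generators as possible makes the next syzygies free of
  constant terms, since a constant coefficient would make a generator redundant.\<close>

lemma syz_state_step:
  fixes N :: "(nat \<Rightarrow> ('x, 'k::field) mpoly) set"
  assumes st: "syz_state b D N" and b: "0 \<le> b"
  shows "\<exists>D' N' a. syz_next D N D' N' a \<and> syz_state b D' N'"
proof -
  have N: "vmod.subspace N" and Ns: "N \<subseteq> supported (length D)"
    and min: "\<And>v i. v \<in> N \<Longrightarrow> lookup (v i) 0 = 0" and h: "\<And>p j. b < j \<Longrightarrow> koszul_vanish (free_mod D) N p j"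
    using st by (auto simp: syz_state_def)
  define P where "P = (\<lambda>gs. (\<forall>(d, v)\<in>set gs. v \<in> N \<inter> free_mod D (int d)) \<and> N \<subseteq> vmod.span (snd ` set gs))"
  obtain gs where gs: "P gs" and least: "\<And>gs'. P gs' \<Longrightarrow> length gs \<le> length gs'"
    using syz_state_finitely_generated[OF st b] ex_has_least_nat[of P _ length] unfolding P_def by blast
  define D' where "D' = map fst gs"
  define a where "a = (\<lambda>r c. snd (gs ! c) r)"
  define n where "n = length gs"
  have nD': "length D' = n" by (simp add: D'_def n_def)
  have gen: "snd (gs ! c) \<in> N" "snd (gs ! c) \<in> free_mod D (int (D' ! c))" if "c < n" for c
  proof -
    have "(fst (gs ! c), snd (gs ! c)) \<in> set gs" using that by (simp add: n_def)
    then show "snd (gs ! c) \<in> N" "snd (gs ! c) \<in> free_mod D (int (D' ! c))"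
      using gs that unfolding P_def D'_def n_def by fastforce+
  qed
  have hom: "a r c \<in> hom_part (int (D' ! c) - int (D ! r))" if "r < length D" "c < length D'" for r c
    using gen(2)[of c] that nD' by (simp add: a_def free_mod_def)
  have amin: "lookup (a r c) 0 = 0" if "r < length D" "c < length D'" for r c
    using min[OF gen(1)] that nD' by (simp add: a_def)
  let ?\<pi> = "matv a (length D) (length D')"
  have mat: "?\<pi> w = (\<Sum>c<n. vscale (w c) (snd (gs ! c)))" for w
  proof
    fix i
    show "?\<pi> w i = (\<Sum>c<n. vscale (w c) (snd (gs ! c))) i"
    proof (cases "i < length D")
      case True
      then show ?thesis by (simp add: matv_def sum_fun_apply vscale_def nD' a_def mult.commute)
    next
      case False
      then have "snd (gs ! c) i = 0" if "c < n" for c using gen(2)[OF that] by (simp add: free_mod_def)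
      then show ?thesis using False by (simp add: matv_def sum_fun_apply vscale_def)
    qed
  qed
  have img: "N = ?\<pi> ` supported (length D')"
  proof
    show "?\<pi> ` supported (length D') \<subseteq> N"
      using gen(1) by (auto simp: mat intro!: vmod.subspace_sum[OF N] vmod.subspace_scale[OF N])
    interpret module_hom vscale vscale ?\<pi> by (rule module_hom_matv)
    have "snd ` set gs \<subseteq> ?\<pi> ` supported (length D')"
    proof
      fix v assume "v \<in> snd ` set gs"
      then obtain c where c: "c < n" "v = snd (gs ! c)" by (auto simp: in_set_conv_nth n_def)
      define w :: "nat \<Rightarrow> ('x, 'k) mpoly" where "w = (\<lambda>i. if i = c then 1 else 0)"
      have "?\<pi> w = (\<Sum>i<n. if i = c then v else 0)"
        unfolding mat by (intro sum.cong refl) (auto simp: w_def c)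
      then have "v = ?\<pi> w" using c by simp
      moreover have "w \<in> supported (length D')" using c by (simp add: supported_def w_def nD')
      ultimately show "v \<in> ?\<pi> ` supported (length D')" by blast
    qed
    then have "vmod.span (snd ` set gs) \<subseteq> ?\<pi> ` supported (length D')"
      by (rule vmod.span_minimal) (rule subspace_image[OF supported_subspace])
    then show "N \<subseteq> ?\<pi> ` supported (length D')" using gs unfolding P_def by blast
  qed
  define N' where "N' = {v \<in> supported (length D'). ?\<pi> v = 0}"
  have N'_eq: "N' = {v. ?\<pi> v = 0} \<inter> supported (length D')" by (auto simp: N'_def)
  have "syz_next D N D' N' a" unfolding syz_next_def using hom amin img N'_def by blast
  moreover have "syz_state b D' N'"
    unfolding syz_state_def
  proof (intro conjI ballI allI impI)
    interpret module_hom vscale vscale ?\<pi> by (rule module_hom_matv)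
    show "vmod.subspace N'"
      unfolding N'_eq by (rule vmod.subspace_inter[OF subspace_kernel supported_subspace])
    show "N' \<subseteq> supported (length D')" by (auto simp: N'_def)
    have vp0: "vpart D t 0 = (0 :: nat \<Rightarrow> ('x, 'k) mpoly)" for t by (auto simp: vpart_def zero_fun_def)
    have vp: "?\<pi> (vpart D' t v) = 0" if "v \<in> N'" for v t
      using matv_vpart[OF hom, of t v] that vp0 by (simp add: N'_def)
    show "vpart D' t v \<in> N'" if "v \<in> N'" for v t
      using vp[OF that] subsetD[OF free_mod_supported vpart_free] by (simp add: N'_def)
    show "koszul_vanish (free_mod D') N' p j" if "b < j" for p j
    proof -
      have "N \<inter> supported (length D) = ?\<pi> ` supported (length D')" using img Ns by blast
      then have "koszul_vanish (free_mod D') {v. ?\<pi> v = 0} p j"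
        using koszul_vanish_syzygy_step[OF hom N _ amin] h[OF that] by blast
      then show ?thesis unfolding N'_eq by (simp only: koszul_vanish_Int_supported)
    qed
    fix w i assume w: "w \<in> N'"
    show "lookup (w i) 0 = 0"
    proof (rule ccontr)
      assume u: "lookup (w i) 0 \<noteq> 0"
      have i: "i < n"
      proof (rule ccontr)
        assume "\<not> i < n"
        then have "w i = 0" using w by (simp add: N'_def supported_def nD')
        then show False using u by simp
      qed
      define u where "u = lookup (w i) 0"
      \<comment> \<open>Passing to the degree of the \<open>i\<close>-th generator keeps a relation
        but strips the \<open>i\<close>-th entry down to its constant term \<open>u\<close>. That is
        invertible in the field, so the relation can be solved for the \<open>i\<close>-th
        generator.\<close>
      define w' where "w' = vpart D' (int (D' ! i)) w"
      have "w' i \<in> hom_part 0" using i by (simp add: w'_def vpart_def nD' wpart_hom)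
      moreover have "lookup (w' i) 0 = u" using i by (simp add: w'_def vpart_def nD' lookup_wpart u_def)
      ultimately have w'i: "w' i = single 0 u" by (metis hom_part_const)
      have "0 = (\<Sum>c<n. vscale (w' c) (snd (gs ! c)))" using vp[OF w] mat unfolding w'_def by metis
      also have "\<dots> = vscale (w' i) (snd (gs ! i)) + (\<Sum>c\<in>{..<n} - {i}. vscale (w' c) (snd (gs ! c)))"
        using i by (intro sum.remove) auto
      finally have "vscale (single 0 u) (snd (gs ! i)) = - (\<Sum>c\<in>{..<n} - {i}. vscale (w' c) (snd (gs ! c)))"
        unfolding w'i by (simp add: eq_neg_iff_add_eq_0)
      then have "vscale (single 0 (1 / u)) (vscale (single 0 u) (snd (gs ! i))) =
         vscale (single 0 (1 / u)) (- (\<Sum>c\<in>{..<n} - {i}. vscale (w' c) (snd (gs ! c))))" by simp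
      then have red: "snd (gs ! i) = vscale (single 0 (1 / u)) (- (\<Sum>c\<in>{..<n} - {i}. vscale (w' c) (snd (gs ! c))))"
        using u by (simp add: mult_single u_def)
      define gs' where "gs' = take i gs @ drop (Suc i) gs"
      have sub: "set gs' \<subseteq> set gs" unfolding gs'_def using set_take_subset set_drop_subset by fastforce
      have mem: "gs ! c \<in> set gs'" if "c < n" "c \<noteq> i" for c
      proof (cases "c < i")
        case True
        then have "gs ! c = take i gs ! c" "c < length (take i gs)" using that i by (auto simp: n_def)
        then show ?thesis unfolding gs'_def by (metis UnI1 nth_mem set_append)
      next
        case False
        then have "gs ! c = drop (Suc i) gs ! (c - Suc i)" "c - Suc i < length (drop (Suc i) gs)"
          using that i by (auto simp: n_def)
        then show ?thesis unfolding gs'_def by (metis UnI2 nth_mem set_append)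
      qed
      have "snd (gs ! c) \<in> vmod.span (snd ` set gs')" if "c < n" for c
      proof (cases "c = i")
        case True
        have "(\<Sum>c\<in>{..<n} - {i}. vscale (w' c) (snd (gs ! c))) \<in> vmod.span (snd ` set gs')"
          using mem by (intro vmod.span_sum vmod.span_scale vmod.span_base) auto
        then show ?thesis unfolding True by (subst red) (intro vmod.span_scale vmod.span_neg)
      next
        case False
        then show ?thesis using mem[OF that] by (intro vmod.span_base) auto
      qed
      then have "\<forall>x\<in>set gs. snd x \<in> vmod.span (snd ` set gs')" by (metis in_set_conv_nth n_def)
      then have "snd ` set gs \<subseteq> vmod.span (snd ` set gs')" by blast
      then have "vmod.span (snd ` set gs) \<subseteq> vmod.span (snd ` set gs')"
        by (rule vmod.span_minimal) (rule vmod.subspace_span)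
      then have "P gs'" using gs sub unfolding P_def by blast
      then have "length gs \<le> length gs'" by (rule least)
      then show False using i by (simp add: gs'_def n_def)
    qed
  qed
  ultimately show ?thesis by blast
qed

text \<open>Pigeonhole: a multidegree of total degree above \<open>k\<close> times the number of
  variables has an exponent above \<open>k\<close>, and there the homotopy contracts.\<close>

lemma monomial_ideal_koszul_vanish:
  fixes c :: "'x set \<Rightarrow> nat \<Rightarrow> ('x, 'k::comm_ring_1) mpoly"
  assumes ins: "\<And>m v. m \<in> M \<Longrightarrow> k < lookup m v \<Longrightarrow> m - single v 1 \<in> M"
    and j: "int (card (UNIV :: 'x set) * k) < j"
    and c: "chain (free_mod [0]) p j c" and cyc: "\<And>S i. kdiff_vec c S i \<in> monomial_ideal M"
  shows "\<exists>e. chain (free_mod [0]) (Suc p) j e \<and> (\<forall>S i. (c S - kdiff_vec e S) i \<in> monomial_ideal M)"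
proof (rule homology_vanishes[OF c _ cyc])
  show "m - single v 1 \<in> M" if "m \<in> M" "k < lookup m v" for m v
    using that by (rule ins)
  fix S i m assume m: "m \<in> keys (c S i)"
  then have "c S \<noteq> 0" by (auto simp: zero_fun_def)
  then have S: "card S = p" using chain_card[OF c] by blast
  have cS: "c S \<in> free_mod [0] (j - int p)" by (rule chain_mem[OF c S])
  then have "i = 0" using m by (cases i) (auto simp: free_mod_def)
  then have "int (wt UNIV m) = j - int p" using cS m by (auto simp: free_mod_def hom_part_def)
  then have "int (wt UNIV (m + ind S)) = j" using S by (simp add: wt_add wt_ind)
  then have big: "card (UNIV :: 'x set) * k < wt UNIV (m + ind S)" using j by linarith
  show "\<exists>v. k < lookup (m + ind S) v"
  proof (rule ccontr)
    assume "\<nexists>v. k < lookup (m + ind S) v"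
    then have "wt UNIV (m + ind S) \<le> (\<Sum>v\<in>(UNIV::'x set). k)"
      unfolding wt_def by (intro sum_mono) (simp add: not_less)
    then show False using big by simp
  qed
qed

lemma minimal_resolution_exists:
  fixes M :: "'x expo set"
  assumes up: "upclosed M" and zero: "0 \<notin> M"
    and ins: "\<And>m v. m \<in> M \<Longrightarrow> k < lookup m v \<Longrightarrow> m - single v 1 \<in> M"
  shows "\<exists>D g A. minimal_graded_free_resolution (monomial_ideal M :: ('x, 'k::field) mpoly set) D g A"
proof -
  let ?J = "monomial_ideal M :: ('x, 'k) mpoly set"
  define b where "b = int (card (UNIV :: 'x set) * k)"
  define N0 where "N0 = {v :: nat \<Rightarrow> ('x, 'k) mpoly. \<forall>i. v i \<in> ?J} \<inter> supported (length [0::nat])"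
  have J: "is_ideal ?J" by (rule monomial_ideal_ideal[OF up])
  have st0: "syz_state b [0] N0"
    unfolding syz_state_def
  proof (intro conjI ballI allI impI)
    show "vmod.subspace N0"
      unfolding N0_def by (rule vmod.subspace_inter[OF subspace_components[OF J] supported_subspace])
    show "N0 \<subseteq> supported (length [0::nat])" by (simp add: N0_def)
    show "vpart [0] t v \<in> N0" if "v \<in> N0" for v t
      using that by (auto simp: N0_def vpart_def monomial_ideal_def keys_wpart supported_def)
    show "lookup (v i) 0 = 0" if "v \<in> N0" for v i
    proof -
      have "v i \<in> ?J" using that by (auto simp: N0_def)
      then show ?thesis using zero by (cases "0 \<in> keys (v i)") (auto simp: monomial_ideal_def not_in_keys_iff_lookup_eq_zero)
    qed
    show "koszul_vanish (free_mod [0]) N0 p j" if "b < j" for p j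
    proof -
      have "koszul_vanish (free_mod [0]) {v :: nat \<Rightarrow> ('x, 'k) mpoly. \<forall>i. v i \<in> ?J} p j"
        unfolding koszul_vanish_def
      proof (intro allI impI)
        fix c :: "'x set \<Rightarrow> nat \<Rightarrow> ('x, 'k) mpoly"
        assume c: "chain (free_mod [0]) p j c" and cyc: "\<forall>S. kdiff_vec c S \<in> {v. \<forall>i. v i \<in> ?J}"
        have "\<exists>e. chain (free_mod [0]) (Suc p) j e \<and> (\<forall>S i. (c S - kdiff_vec e S) i \<in> ?J)"
          using that cyc by (intro monomial_ideal_koszul_vanish[OF ins _ c]) (auto simp: b_def)
        then show "\<exists>e. chain (free_mod [0]) (Suc p) j e \<and> (\<forall>S. c S - kdiff_vec e S \<in> {v. \<forall>i. v i \<in> ?J})"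
          by simp
      qed
      then show ?thesis unfolding N0_def by (simp only: koszul_vanish_Int_supported)
    qed
  qed
  \<comment> \<open>A matrix belongs to a transition and not to a state, so dependent choice runs on
    the pairs of degrees and submodule only; the matrices are chosen afterwards.\<close>
  define Q where "Q = (\<lambda>(D, N) (D', N'). \<exists>a. syz_next D N D' (N' :: (nat \<Rightarrow> ('x, 'k) mpoly) set) a)"
  have "\<exists>f. \<forall>n. (syz_state b (fst (f n)) (snd (f n)) \<and> (n = 0 \<longrightarrow> f n = ([0], N0))) \<and> Q (f n) (f (Suc n))"
  proof (rule dependent_nat_choice)
    show "\<exists>x. syz_state b (fst x) (snd x) \<and> (0 = (0::nat) \<longrightarrow> x = ([0], N0))"
      using st0 by (intro exI[of _ "([0], N0)"]) simp
    show "\<exists>y. (syz_state b (fst y) (snd y) \<and> (Suc n = 0 \<longrightarrow> y = ([0], N0))) \<and> Q x y"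
      if x: "syz_state b (fst x) (snd x) \<and> (n = 0 \<longrightarrow> x = ([0], N0))" for x n
    proof -
      obtain D' N' a where "syz_next (fst x) (snd x) D' N' a" "syz_state b D' N'"
        using syz_state_step[of b "fst x" "snd x"] x unfolding b_def by (metis of_nat_0_le_iff)
      then show ?thesis by (intro exI[of _ "(D', N')"]) (auto simp: Q_def split_beta)
    qed
  qed
  then obtain f where f: "f 0 = ([0], N0)" "\<And>n. Q (f n) (f (Suc n))" by blast
  define D where "D = (\<lambda>i. fst (f i))"
  define N where "N = (\<lambda>i. snd (f i))"
  have "\<forall>i. \<exists>a. syz_next (D i) (N i) (D (Suc i)) (N (Suc i)) a"
    using f(2) by (simp add: Q_def D_def N_def split_beta)
  then obtain a where a: "\<And>i. syz_next (D i) (N i) (D (Suc i)) (N (Suc i)) (a i)" by metis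
  have D0: "D 0 = [0]" "N 0 = N0" using f(1) by (simp_all add: D_def N_def)
  have Nimg: "N i = matv (a i) (length (D i)) (length (D (Suc i))) ` supported (length (D (Suc i)))"
    and Nker: "N (Suc i) = {v \<in> supported (length (D (Suc i))). matv (a i) (length (D i)) (length (D (Suc i))) v = 0}" for i
    using a[of i] unfolding syz_next_def by auto
  have N0_eq: "{v \<in> supported (length (D 0)). (\<Sum>c<length (D 0). 1 * v c) \<in> ?J} = N 0"
  proof (rule Set.set_eqI)
    fix v :: "nat \<Rightarrow> ('x, 'k) mpoly"
    have "(\<forall>i. v i \<in> ?J) \<longleftrightarrow> v 0 \<in> ?J" if "v \<in> supported 1"
    proof
      assume "v 0 \<in> ?J"
      show "\<forall>i. v i \<in> ?J"
      proof
        fix i show "v i \<in> ?J"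
          using \<open>v 0 \<in> ?J\<close> that rmod.subspace_0[OF J] by (cases i) (auto simp: supported_def One_nat_def)
      qed
    qed simp
    then show "v \<in> {v \<in> supported (length (D 0)). (\<Sum>c<length (D 0). 1 * v c) \<in> ?J} \<longleftrightarrow> v \<in> N 0"
      by (auto simp: D0 N0_def One_nat_def)
  qed
  have "fun_resolution ?J D (\<lambda>_. 1) a"
    unfolding fun_resolution_def
  proof (intro conjI)
    show "\<forall>c<length (D 0). 1 \<in> (hom_part (int (D 0 ! c)) :: ('x, 'k) mpoly set)"
      by (simp add: D0 hom_part_def)
    show "\<forall>f. \<exists>v\<in>supported (length (D 0)). f - (\<Sum>c<length (D 0). 1 * v c) \<in> ?J"
    proof
      fix f :: "('x, 'k) mpoly"
      show "\<exists>v\<in>supported (length (D 0)). f - (\<Sum>c<length (D 0). 1 * v c) \<in> ?J"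
        by (rule bexI[of _ "\<lambda>i. if i = 0 then f else 0"]) (auto simp: D0 supported_def rmod.subspace_0[OF J])
    qed
    show "{v \<in> supported (length (D 0)). (\<Sum>c<length (D 0). 1 * v c) \<in> ?J} =
      matv (a 0) (length (D 0)) (length (D 1)) ` supported (length (D 1))"
      unfolding N0_eq using Nimg[of 0] by (simp add: One_nat_def)
    show "\<forall>i. {v \<in> supported (length (D (Suc i))). matv (a i) (length (D i)) (length (D (Suc i))) v = 0} =
      matv (a (Suc i)) (length (D (Suc i))) (length (D (Suc (Suc i)))) ` supported (length (D (Suc (Suc i))))"
      using Nker Nimg by metis
  qed (use a in \<open>auto simp: syz_next_def\<close>)
  then have "fun_resolution ?J D (\<lambda>c. vec (length (D 0)) (\<lambda>_. 1) $ c)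
     (\<lambda>i r c. mat (length (D i)) (length (D (Suc i))) (\<lambda>(r, c). a i r c) $$ (r, c))"
    by (rule fun_resolution_cong) auto
  then have "minimal_graded_free_resolution ?J D (vec (length (D 0)) (\<lambda>_. 1))
     (\<lambda>i. mat (length (D i)) (length (D (Suc i))) (\<lambda>(r, c). a i r c))"
    unfolding minimal_graded_free_resolution_iff by simp
  then show ?thesis by blast
qed

text \<open>There are no \<open>p\<close>-element sets of variables. Via
  \<open>resolution_koszul\<close> this is the length bound of the Hilbert syzygy theorem.\<close>

lemma quotient_koszul_vanish_above: "card (UNIV :: 'x set) < p \<Longrightarrow> is_ideal J \<Longrightarrow> quotient_koszul_vanish J p j"
  unfolding quotient_koszul_vanish_def koszul_vanish_def
proof (intro allI impI)
  fix c :: "'x set \<Rightarrow> nat \<Rightarrow> ('x, 'a) mpoly"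
  assume p: "card (UNIV :: 'x set) < p" and J: "is_ideal J" and c: "chain (free_mod [0]) p j c"
  have "c S = 0" for S
    using chain_card[OF c, of S] card_mono[of "UNIV :: 'x set" S] p by auto
  moreover have "chain (free_mod [0]) (Suc p) j (\<lambda>_. 0 :: nat \<Rightarrow> ('x, 'a) mpoly)"
    by (simp add: chain_def graded_modD(1)[OF graded_mod_free])
  ultimately show "\<exists>e. chain (free_mod [0]) (Suc p) j e \<and> (\<forall>S. c S - kdiff_vec e S \<in> {v. \<forall>i. v i \<in> J})"
    using rmod.subspace_0[OF J] by (intro exI[of _ "\<lambda>_. 0"]) (simp add: kdiff_vec_def)
qed

text \<open>\<open>Max\<close> can be used only because the Betti table is finite: at most n + 1
  homological indices occur, for n variables, and each carries a finite list of degrees.\<close>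

lemma reg_quotient_ge:
  fixes M :: "'x expo set"
  assumes up: "upclosed M" and zero: "0 \<notin> M"
    and ins: "\<And>m v. m \<in> M \<Longrightarrow> k < lookup m v \<Longrightarrow> m - single v 1 \<in> M"
    and nz: "\<not> quotient_koszul_vanish (monomial_ideal M :: ('x, 'k::field) mpoly set) i (int j)"
  shows "int j - int i \<le> reg_quotient (monomial_ideal M :: ('x, 'k) mpoly set)"
proof -
  let ?J = "monomial_ideal M :: ('x, 'k) mpoly set"
  have J: "is_ideal ?J" by (rule monomial_ideal_ideal[OF up])
  define D where "D = (SOME D. \<exists>g A. minimal_graded_free_resolution ?J D g A)"
  have "\<exists>D. \<exists>g A. minimal_graded_free_resolution ?J D g A"
    by (rule minimal_resolution_exists[OF up zero ins])
  then have "\<exists>g A. minimal_graded_free_resolution ?J D g A" unfolding D_def by (rule someI_ex)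
  then obtain g A where res: "minimal_graded_free_resolution ?J D g A" by blast
  have key: "quotient_koszul_vanish ?J i j \<longleftrightarrow> j \<notin> int ` set (D i)" for i j
    by (rule resolution_koszul[OF res J]) (auto simp: monomial_ideal_def keys_wpart)
  have betti: "betti ?J i j \<noteq> 0 \<longleftrightarrow> j \<in> set (D i)" for i j
    by (simp add: betti_def D_def[symmetric] count_list_0_iff)
  let ?S = "{int j - int i | i j. betti ?J i j \<noteq> 0}"
  have empty: "D i = []" if "card (UNIV :: 'x set) < i" for i
  proof (rule ccontr)
    assume "D i \<noteq> []"
    then have "int (hd (D i)) \<in> int ` set (D i)" by simp
    then show False using key quotient_koszul_vanish_above[OF that J] by blast
  qed
  have "?S \<subseteq> (\<Union>i\<le>card (UNIV :: 'x set). (\<lambda>j. int j - int i) ` set (D i))"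
  proof
    fix s assume "s \<in> ?S"
    then obtain i j where s: "s = int j - int i" "j \<in> set (D i)" using betti by blast
    then have "i \<le> card (UNIV :: 'x set)" using empty[of i] by (cases "card (UNIV :: 'x set) < i") auto
    then show "s \<in> (\<Union>i\<le>card (UNIV :: 'x set). (\<lambda>j. int j - int i) ` set (D i))" using s by blast
  qed
  then have fin: "finite ?S" by (rule finite_subset) simp
  have "j \<in> set (D i)" using nz key[of i "int j"] by auto
  then have "int j - int i \<in> ?S" using betti by blast
  then show ?thesis unfolding reg_quotient_def by (rule Max_ge[OF fin])
qed

end

section \<open>Powers and symbolic powers of squarefree monomial ideals\<close>

text \<open>The exponents of the monomials in the \<open>k\<close>-th power of the edge ideal;
  \<open>UNIV\<close> at 0 matches the unit ideal.\<close>

primrec power_expos :: "('x::finite) set set \<Rightarrow> nat \<Rightarrow> 'x expo set" where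
  "power_expos E 0 = UNIV"
| "power_expos E (Suc k) = {ind e + n | e n. e \<in> E \<and> n \<in> power_expos E k}"

primrec power_gens :: "('x::finite) set set \<Rightarrow> nat \<Rightarrow> 'x expo set" where
  "power_gens E 0 = {0}"
| "power_gens E (Suc k) = {ind e + n | e n. e \<in> E \<and> n \<in> power_gens E k}"

definition rep :: "nat \<Rightarrow> ('x::finite) expo \<Rightarrow> 'x expo" where
  "rep n m = (\<Sum>_<n. m)"

lemma rep_0 [simp]: "rep 0 m = 0"
  by (simp add: rep_def)

lemma rep_Suc: "rep (Suc n) m = m + rep n m"
  by (simp add: rep_def add.commute)

lemma lookup_rep: "lookup (rep n m) x = n * lookup m x"
  by (induction n) (simp_all add: rep_Suc lookup_add)

lemma wt_rep: "wt C (rep n m) = n * wt C m"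
  by (induction n) (simp_all add: rep_Suc wt_add)

lemma power_expos_upclosed: "upclosed (power_expos E k)"
proof (induction k)
  case (Suc k)
  have "ind e + n + m \<in> power_expos E (Suc k)" if "e \<in> E" "n \<in> power_expos E k" for e n m
  proof -
    have "n + m \<in> power_expos E k" using Suc that by (simp add: upclosed_def)
    then show ?thesis using that(1) by (auto simp: add.assoc)
  qed
  then show ?case by (auto simp: upclosed_def)
qed (simp add: upclosed_def)

lemma power_expos_eq_power_gens: "power_expos E k = {g + n | g n. g \<in> power_gens E k}"
proof (induction k)
  case (Suc k)
  show ?case
  proof (intro equalityI subsetI)
    fix m assume "m \<in> power_expos E (Suc k)"
    then obtain e g n where "m = ind e + (g + n)" "e \<in> E" "g \<in> power_gens E k" using Suc by auto
    then have "m = (ind e + g) + n" "ind e + g \<in> power_gens E (Suc k)" by (auto simp: add.assoc)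
    then show "m \<in> {g + n | g n. g \<in> power_gens E (Suc k)}" by blast
  next
    fix m assume "m \<in> {g + n | g n. g \<in> power_gens E (Suc k)}"
    then obtain e g n where "m = ind e + g + n" "e \<in> E" "g \<in> power_gens E k" by auto
    then have "m = ind e + (g + n)" "g + n \<in> power_expos E k" "e \<in> E" using Suc by (auto simp: add.assoc)
    then show "m \<in> power_expos E (Suc k)" by auto
  qed
qed simp

lemma power_gens_finite: "finite (power_gens E k)"
proof (induction k)
  case (Suc k)
  have "power_gens E (Suc k) = (\<lambda>(e, n). ind e + n) ` (E \<times> power_gens E k)" by auto
  then show ?case using Suc by simp
qed simp

lemma power_gens_wt:
  assumes "\<And>e. e \<in> E \<Longrightarrow> card e \<le> d" "g \<in> power_gens E k"
  shows "wt UNIV g \<le> k * d"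
  using assms(2)
proof (induction k arbitrary: g)
  case (Suc k)
  then obtain e n where "g = ind e + n" "e \<in> E" "n \<in> power_gens E k" by auto
  then show ?case using Suc.IH[of n] assms(1)[of e] by (simp add: wt_add wt_ind)
qed simp

lemma power_gens_lookup: "g \<in> power_gens E k \<Longrightarrow> lookup g v \<le> k"
proof (induction k arbitrary: g)
  case (Suc k)
  then obtain e n where "g = ind e + n" "n \<in> power_gens E k" by auto
  then show ?case using Suc.IH[of n] by (simp add: lookup_add lookup_ind)
qed simp

lemma expo_le_decompose:
  assumes "\<And>x. lookup n x \<le> lookup m x"
  obtains p where "(m :: 'x expo) = n + p"
  using expo_diff_add[of n m] assms by metis

text \<open>A product of \<open>k\<close> squarefree monomials has exponents at most
  \<open>k\<close>, so a further factor \<open>v\<close> belongs to the cofactor and can be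
  removed.\<close>

lemma power_expos_insensitive:
  assumes "m \<in> power_expos E k" "k < lookup m v"
  shows "m - single v 1 \<in> power_expos E k"
proof -
  obtain g n where m: "m = g + n" "g \<in> power_gens E k" using assms(1) unfolding power_expos_eq_power_gens by blast
  then have "0 < lookup n v" using power_gens_lookup[OF m(2), of v] assms(2) by (simp add: lookup_add)
  then have n: "n = single v 1 + (n - single v 1)" using single_diff_add[of n v] by simp
  have "m = g + (n - single v 1) + single v 1" unfolding m(1) by (subst n) (simp only: ac_simps)
  then have "m - single v 1 = g + (n - single v 1)" by (simp only: add_diff_cancel_right')
  then show ?thesis using m(2) unfolding power_expos_eq_power_gens by blast
qed

lemma power_expos_nonzero: "{} \<notin> E \<Longrightarrow> 0 \<notin> power_expos E (Suc k)"
proof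
  assume E: "{} \<notin> E" and "0 \<in> power_expos E (Suc k)"
  then obtain e n where e: "0 = ind e + n" "e \<in> E" by auto
  then have "wt UNIV (ind e) = 0" by (metis add_is_0 wt_0 wt_add)
  then show False using e(2) E by (auto simp: wt_ind)
qed

lemma power_expos_rep: "e \<in> E \<Longrightarrow> rep k (ind e) + n \<in> power_expos E k"
  by (induction k) (auto simp: rep_Suc add.assoc)

lemma power_expos_1: "power_expos E 1 = {ind e + n | e n. e \<in> E}"
  by (simp add: One_nat_def)

lemma prod_Var: "(\<Prod>x\<in>e. Var x) = (single (ind e) 1 :: ('x::finite, 'k::comm_ring_1) mpoly)"
proof (induction e rule: infinite_finite_induct)
  case (insert x e)
  then show ?case by (simp add: ind_insert Var_def mult_single)
qed simp_all

lemma edge_ideal_eq: "edge_ideal H = (monomial_ideal (power_expos (edges H) 1) :: ('x::finite, 'k::comm_ring_1) mpoly set)"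
proof -
  have "edge_ideal H = ideal_gen ((\<lambda>u. single u 1 :: ('x, 'k) mpoly) ` ind ` edges H)"
    unfolding edge_ideal_def prod_Var image_image ..
  then show ?thesis unfolding ideal_gen_monomials power_expos_1
    by (auto intro!: arg_cong[where f = monomial_ideal])
qed

lemma ideal_power_eq:
  "ideal_power (monomial_ideal (power_expos E 1)) k = (monomial_ideal (power_expos E k) :: ('x::finite, 'k::comm_ring_1) mpoly set)"
proof (induction k)
  case 0
  then show ?case by (simp add: monomial_ideal_def)
next
  case (Suc k)
  have "{m + n | m n. m \<in> power_expos E 1 \<and> n \<in> power_expos E k} = power_expos E (Suc k)"
  proof (intro equalityI subsetI)
    fix p assume "p \<in> {m + n | m n. m \<in> power_expos E 1 \<and> n \<in> power_expos E k}"
    then obtain e m n where p: "p = ind e + m + n" "e \<in> E" "n \<in> power_expos E k" unfolding power_expos_1 by blast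
    then have "n + m \<in> power_expos E k" using power_expos_upclosed[of E k] by (simp add: upclosed_def)
    moreover have "p = ind e + (n + m)" unfolding p(1) by (simp only: ac_simps)
    ultimately show "p \<in> power_expos E (Suc k)" using p(2) by auto
  next
    fix p assume "p \<in> power_expos E (Suc k)"
    then obtain e n where p: "p = ind e + n" "e \<in> E" "n \<in> power_expos E k" by auto
    then have "ind e \<in> power_expos E 1" unfolding power_expos_1 by (metis (mono_tags, lifting) add.right_neutral mem_Collect_eq)
    then show "p \<in> {m + n | m n. m \<in> power_expos E 1 \<and> n \<in> power_expos E k}" using p by blast
  qed
  then show ?case using Suc ideal_gen_product[OF power_expos_upclosed[of E 1] power_expos_upclosed[of E k]] by simp
qed

section \<open>Vertex covers and the exponents of symbolic powers\<close>

definition cover :: "'x set set \<Rightarrow> 'x set \<Rightarrow> bool" where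
  "cover E C \<longleftrightarrow> (\<forall>e\<in>E. e \<inter> C \<noteq> {})"

definition min_cover :: "'x set set \<Rightarrow> 'x set \<Rightarrow> bool" where
  "min_cover E C \<longleftrightarrow> cover E C \<and> (\<forall>C'. C' \<subseteq> C \<longrightarrow> cover E C' \<longrightarrow> C' = C)"

text \<open>The monomials in the intersection of the \<open>k\<close>-th powers of the primes
  generated by minimal covers; \<open>symbolic_power_eq\<close> connects this with the
  localizations.\<close>

definition symbolic_expos :: "('x::finite) set set \<Rightarrow> nat \<Rightarrow> 'x expo set" where
  "symbolic_expos E k = {m. \<forall>C. min_cover E C \<longrightarrow> k \<le> wt C m}"

lemma min_cover_below:
  assumes "cover E (C :: ('x::finite) set)"
  obtains C' where "C' \<subseteq> C" "min_cover E C'"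
proof -
  obtain C' where C': "C' \<in> {C. cover E C}" "C' \<subseteq> C" "\<forall>D\<in>{C. cover E C}. D \<subseteq> C' \<longrightarrow> C' = D"
    using finite_has_minimal2[of "{C. cover E C}" C] assms by auto
  then have "min_cover E C'" by (auto simp: min_cover_def)
  then show thesis using that C'(2) by blast
qed

lemma min_cover_exists:
  assumes "{} \<notin> E"
  obtains C where "min_cover E (C :: ('x::finite) set)"
proof -
  have "cover E UNIV" using assms by (auto simp: cover_def)
  then show thesis using min_cover_below that by blast
qed

text \<open>Removing \<open>v\<close> uncovers some edge, and that edge is covered by
  \<open>v\<close> alone. Such an edge has weight exactly 1 on \<open>C\<close>.\<close>

lemma min_cover_edge:
  assumes "min_cover E C" "v \<in> C"
  obtains e where "e \<in> E" "e \<inter> C = {v}"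
proof -
  have "C - {v} \<noteq> C" using assms(2) by blast
  then have "\<not> cover E (C - {v})" using assms(1) by (auto simp: min_cover_def)
  then obtain e where "e \<in> E" "e \<inter> (C - {v}) = {}" by (auto simp: cover_def)
  moreover then have "e \<inter> C \<noteq> {}" using assms(1) by (auto simp: min_cover_def cover_def)
  ultimately show thesis using that by blast
qed

lemma symbolic_expos_cover: "m \<in> symbolic_expos E k \<Longrightarrow> cover E C \<Longrightarrow> k \<le> wt C m"
  using min_cover_below[of E C] wt_mono[of _ C m] unfolding symbolic_expos_def by (metis (mono_tags) le_trans mem_Collect_eq)

lemma power_expos_cover: "m \<in> power_expos E k \<Longrightarrow> cover E C \<Longrightarrow> k \<le> wt C m"
proof (induction k arbitrary: m)
  case (Suc k)
  then obtain e n where m: "m = ind e + n" "e \<in> E" "n \<in> power_expos E k" by auto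
  then have "e \<inter> C \<noteq> {}" using Suc.prems(2) by (auto simp: cover_def)
  then have "1 \<le> card (e \<inter> C)" by (simp add: Suc_le_eq card_gt_0_iff One_nat_def)
  then show ?case using Suc.IH[OF m(3) Suc.prems(2)] m by (simp add: wt_add wt_ind)
qed simp

lemma power_expos_subset_symbolic_expos: "power_expos E k \<subseteq> symbolic_expos E k"
  using power_expos_cover by (auto simp: symbolic_expos_def min_cover_def)

lemma symbolic_expos_upclosed: "upclosed (symbolic_expos E k)"
  by (auto simp: upclosed_def symbolic_expos_def wt_add trans_le_add1)

lemma symbolic_expos_nonzero: "{} \<notin> E \<Longrightarrow> 0 \<notin> symbolic_expos E (Suc k)"
  using min_cover_exists[of E] by (auto simp: symbolic_expos_def)

lemma symbolic_expos_insensitive: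
  assumes "m \<in> symbolic_expos E k" "k < lookup m v"
  shows "m - single v 1 \<in> symbolic_expos E k"
  unfolding symbolic_expos_def
proof (intro CollectI allI impI)
  fix C assume C: "min_cover E C"
  have m: "m = single v 1 + (m - single v 1)" using assms(2) single_diff_add[of m v] by simp
  have w: "wt C m = wt C (single v 1) + wt C (m - single v 1)" by (subst m) (rule wt_add)
  show "k \<le> wt C (m - single v 1)"
  proof (cases "v \<in> C")
    case True
    then have "k < wt C m" using assms(2) lookup_le_wt[of v C m] by simp
    then show ?thesis using w True by (simp add: wt_single)
  next
    case False
    then show ?thesis using w assms(1) C by (auto simp: wt_single symbolic_expos_def)
  qed
qed

text \<open>In the localization at the prime of a minimal cover, the variables outside of the cover are
  invertible, and each variable of the cover divides some edge monomial up to these.\<close>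

lemma min_cover_clear_denominators:
  assumes C: "min_cover E C"
  shows "k \<le> wt C m \<Longrightarrow> rep k (ind (- C)) + m \<in> power_expos E k"
proof (induction k arbitrary: m)
  case (Suc k)
  then have "wt C m \<noteq> 0" by simp
  then obtain v where v: "v \<in> C" "lookup m v \<noteq> 0" unfolding wt_def by (meson sum.neutral)
  define m' where "m' = m - single v 1"
  have m: "m = single v 1 + m'" using single_diff_add[of m v] v(2) by (simp add: m'_def)
  obtain e where e: "e \<in> E" "e \<inter> C = {v}" using min_cover_edge[OF C v(1)] .
  \<comment> \<open>Apart from \<open>v\<close>, the edge lies outside \<open>C\<close>. One copy of
    the outside variables together with \<open>v\<close> therefore contains a whole edge, and the
    weight left on \<open>C\<close> drops by 1.\<close>
  have "lookup (ind e) x \<le> lookup (ind (- C) + single v 1) x" for x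
    using e(2) by (auto simp: lookup_ind lookup_add lookup_single when_def)
  then obtain p where p: "ind (- C) + single v 1 = ind e + p" by (rule expo_le_decompose)
  have "wt C m = 1 + wt C m'" unfolding m using v(1) by (simp add: wt_add wt_single)
  then have "rep k (ind (- C)) + m' \<in> power_expos E k" using Suc by simp
  then have "rep k (ind (- C)) + m' + p \<in> power_expos E k" using power_expos_upclosed[of E k] by (auto simp: upclosed_def)
  moreover have "rep (Suc k) (ind (- C)) + m = ind e + (rep k (ind (- C)) + m' + p)"
  proof -
    have "rep (Suc k) (ind (- C)) + m = (ind (- C) + single v 1) + (rep k (ind (- C)) + m')"
      unfolding rep_Suc m by (simp only: ac_simps)
    then show ?thesis unfolding p by (simp only: ac_simps)
  qed
  ultimately show ?case using e(1) by auto
qed simp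

text \<open>The variables not dividing \<open>m\<close> have weight 0 in \<open>m\<close>, so they
  cannot form a cover; an edge they miss lies in the support of \<open>m\<close>.\<close>

lemma symbolic_expos_1: "symbolic_expos E 1 = power_expos E 1"
proof
  show "power_expos E 1 \<subseteq> symbolic_expos E 1" by (rule power_expos_subset_symbolic_expos)
  show "symbolic_expos E 1 \<subseteq> power_expos E 1"
  proof
    fix m assume m: "m \<in> symbolic_expos E 1"
    let ?C = "{x. lookup m x = 0}"
    have "wt ?C m = 0" by (simp add: wt_def)
    then have "\<not> cover E ?C" using symbolic_expos_cover[OF m] by fastforce
    then obtain e where e: "e \<in> E" "e \<inter> ?C = {}" by (auto simp: cover_def)
    then have "lookup (ind e) x \<le> lookup m x" for x by (auto simp: lookup_ind)
    then obtain p where "m = ind e + p" by (rule expo_le_decompose)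
    then show "m \<in> power_expos E 1" using e(1) unfolding power_expos_1 by blast
  qed
qed

section \<open>Minimal primes and localization: the prime ideals generated by the variables of a
  cover\<close>

definition cover_prime :: "('x::finite) set \<Rightarrow> ('x, 'k::comm_ring_1) mpoly set" where
  "cover_prime C = monomial_ideal {m. 1 \<le> wt C m}"

text \<open>Lowest \<open>C\<close>-weight forms multiply. Over a domain this makes the lowest
  \<open>C\<close>-weight a valuation, which gives both primality of \<open>cover_prime\<close> and
  the description of symbolic powers.\<close>

lemma wpart_low_mult:
  fixes f g :: "('x::finite, 'k::comm_ring_1) mpoly"
  assumes f: "\<And>m. m \<in> keys f \<Longrightarrow> i \<le> int (wt C m)" and g: "\<And>m. m \<in> keys g \<Longrightarrow> j \<le> int (wt C m)"
  shows "wpart C (i + j) (f * g) = wpart C i f * wpart C j g"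
proof -
  let ?P = "\<lambda>m. int (wt C m) = i" and ?Q = "\<lambda>m. int (wt C m) = j"
  let ?f' = "part (\<lambda>m. \<not> ?P m) f" and ?g' = "part (\<lambda>m. \<not> ?Q m) g"
  have "f * g = (wpart C i f + ?f') * g" by (simp add: wpart_def part_split)
  also have "\<dots> = wpart C i f * g + ?f' * g" by (rule distrib_right)
  finally have "wpart C (i + j) (f * g) = wpart C (i + j) (wpart C i f * g) + wpart C (i + j) (?f' * g)"
    by (simp add: wpart_def part_add)
  also have "wpart C (i + j) (?f' * g) = 0"
    unfolding wpart_def
  proof (rule part_none)
    fix m assume "m \<in> keys (?f' * g)"
    then obtain a b where "m = a + b" "a \<in> keys ?f'" "b \<in> keys g" by (rule keys_multE)
    then show "int (wt C m) \<noteq> i + j" using f[of a] g[of b] by (auto simp: keys_part wt_add)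
  qed
  also have "wpart C (i + j) (wpart C i f * g) = wpart C i f * wpart C (i + j - i) g"
    by (rule wpart_mult_homogeneous) (simp add: keys_wpart)
  finally show ?thesis by simp
qed

lemma wpart_0_cover_prime: "wpart C 0 f = 0 \<longleftrightarrow> f \<in> cover_prime C"
proof -
  have "wpart C 0 f = 0 \<longleftrightarrow> keys (wpart C 0 f) = {}" by simp
  also have "\<dots> \<longleftrightarrow> f \<in> cover_prime C" by (auto simp: keys_wpart cover_prime_def monomial_ideal_def Suc_le_eq One_nat_def)
  finally show ?thesis .
qed

lemma cover_prime_prime: "is_prime_ideal (cover_prime C :: ('x::{finite,linorder}, 'k::field) mpoly set)"
  unfolding is_prime_ideal_def
proof (intro conjI allI impI)
  show "is_ideal (cover_prime C :: ('x, 'k) mpoly set)"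
    unfolding cover_prime_def by (rule monomial_ideal_ideal) (auto simp: upclosed_def wt_add)
  have "1 \<notin> (cover_prime C :: ('x, 'k) mpoly set)" by (simp add: cover_prime_def monomial_ideal_def)
  then show "cover_prime C \<noteq> (UNIV :: ('x, 'k) mpoly set)" by blast
  fix f g :: "('x, 'k) mpoly" assume "f * g \<in> cover_prime C"
  then have "wpart C 0 f * wpart C 0 g = 0"
    using wpart_low_mult[of f 0 C g 0] by (simp add: wpart_0_cover_prime[symmetric])
  then show "f \<in> cover_prime C \<or> g \<in> cover_prime C" by (simp add: wpart_0_cover_prime)
qed

lemma Var_cover_prime: "Var v \<in> (cover_prime C :: ('x::finite, 'k::comm_ring_1) mpoly set) \<longleftrightarrow> v \<in> C"
  by (simp add: cover_prime_def monomial_ideal_def Var_def wt_single)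

lemma cover_prime_le:
  assumes P: "is_ideal P" and C: "\<And>v. v \<in> C \<Longrightarrow> Var v \<in> P"
  shows "cover_prime C \<subseteq> (P :: ('x::finite, 'k::comm_ring_1) mpoly set)"
proof
  fix f :: "('x, 'k) mpoly" assume f: "f \<in> cover_prime C"
  have "single m (lookup f m) \<in> P" if "m \<in> keys f" for m
  proof -
    have "wt C m \<noteq> 0" using f that by (auto simp: cover_prime_def monomial_ideal_def)
    then obtain v where v: "v \<in> C" "lookup m v \<noteq> 0" unfolding wt_def by (meson sum.neutral)
    then have m: "m - single v 1 + single v 1 = m" using single_diff_add[of m v] by (simp add: add.commute)
    then have "single m (lookup f m) = single (m - single v 1) (lookup f m) * Var v"
      by (simp add: Var_def mult_single)
    then show ?thesis using rmod.subspace_scale[OF P C[OF v(1)]] by simp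
  qed
  then have "(\<Sum>m\<in>keys f. single m (lookup f m)) \<in> P" by (rule rmod.subspace_sum[OF P])
  then show "f \<in> P" by (simp add: sum_monomials)
qed

lemma prime_prod:
  assumes "is_prime_ideal P" "finite A" "(\<Prod>x\<in>A. f x) \<in> P"
  shows "\<exists>x\<in>A. f x \<in> P"
  using assms(2,3)
proof (induction A rule: finite_induct)
  case empty
  then have "P = UNIV" using assms(1) rmod.subspace_scale[of P 1] by (auto simp: is_prime_ideal_def)
  then show ?case using assms(1) by (simp add: is_prime_ideal_def)
next
  case (insert x A)
  then show ?case using assms(1) by (auto simp: is_prime_ideal_def)
qed

text \<open>A prime containing an edge monomial contains one of its variables, so the variables in a
  prime over the ideal form a cover.\<close>

lemma minimal_primes_eq:
  fixes E :: "('x::{finite,linorder}) set set"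
  shows "minimal_primes (monomial_ideal (power_expos E 1) :: ('x, 'k::field) mpoly set) = cover_prime ` {C. min_cover E C}"
proof -
  let ?I = "monomial_ideal (power_expos E 1) :: ('x, 'k) mpoly set"
  have cov: "cover E {v. Var v \<in> P}" if P: "is_prime_ideal P" "?I \<subseteq> P" for P
    unfolding cover_def
  proof
    fix e assume "e \<in> E"
    then have "ind e \<in> power_expos E 1" unfolding power_expos_1 by (metis (mono_tags, lifting) add.right_neutral mem_Collect_eq)
    then have "single (ind e) 1 \<in> ?I" by (simp add: single_in_monomial_ideal)
    then have "(\<Prod>x\<in>e. Var x) \<in> P" using P(2) prod_Var by (metis subsetD)
    then show "e \<inter> {v. Var v \<in> P} \<noteq> {}" using prime_prod[OF P(1), of e Var] by auto
  qed
  have sub: "?I \<subseteq> cover_prime C" if "cover E C" for C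
    using power_expos_cover[OF _ that] by (fastforce simp: cover_prime_def monomial_ideal_def)
  have pid: "is_ideal P" if "is_prime_ideal P" for P :: "('x, 'k) mpoly set"
    using that by (simp add: is_prime_ideal_def)
  show ?thesis
  proof (intro equalityI subsetI)
    fix P assume "P \<in> minimal_primes ?I"
    then have P: "is_prime_ideal P" "?I \<subseteq> P" and min: "\<And>Q. is_prime_ideal Q \<Longrightarrow> ?I \<subseteq> Q \<Longrightarrow> Q \<subseteq> P \<Longrightarrow> Q = P"
      by (auto simp: minimal_primes_def)
    obtain C where C: "C \<subseteq> {v. Var v \<in> P}" "min_cover E C" using min_cover_below[OF cov[OF P]] .
    have "cover_prime C \<subseteq> P" using C(1) by (intro cover_prime_le pid P) auto
    then have "cover_prime C = P" using min[OF cover_prime_prime sub] C(2) by (auto simp: min_cover_def)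
    then show "P \<in> cover_prime ` {C. min_cover E C}" using C(2) by blast
  next
    fix P :: "('x, 'k) mpoly set" assume "P \<in> cover_prime ` {C. min_cover E C}"
    then obtain C where C: "min_cover E C" "P = cover_prime C" by blast
    have "Q = P" if Q: "is_prime_ideal Q" "?I \<subseteq> Q" "Q \<subseteq> P" for Q
    proof -
      have "{v. Var v \<in> Q} \<subseteq> C" using Q(3) C(2) Var_cover_prime by blast
      then have "{v. Var v \<in> Q} = C" using C(1) cov[OF Q(1,2)] by (auto simp: min_cover_def)
      then have "cover_prime C \<subseteq> Q" by (intro cover_prime_le pid Q) auto
      then show ?thesis using Q(3) C(2) by blast
    qed
    then show "P \<in> minimal_primes ?I"
      using cover_prime_prime sub C by (auto simp: minimal_primes_def min_cover_def)
  qed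
qed

text \<open>\<open>Fract\<close> with denominator 0 is a junk value; a denominator outside the ideal
  \<open>P\<close> cannot be 0.\<close>

lemma localized_ideal_iff:
  assumes "is_ideal P"
  shows "to_fract f \<in> localized_ideal P J \<longleftrightarrow> (\<exists>s. s \<notin> P \<and> s * f \<in> J)"
proof
  assume "to_fract f \<in> localized_ideal P J"
  then obtain a s where as: "to_fract f = Fract a s" "a \<in> J" "s \<notin> P" by (auto simp: localized_ideal_def)
  then have "s \<noteq> 0" using rmod.subspace_0[OF assms] by auto
  then have "a = s * f" using as(1) by (simp add: to_fract_def eq_fract mult.commute)
  then show "\<exists>s. s \<notin> P \<and> s * f \<in> J" using as by auto
next
  assume "\<exists>s. s \<notin> P \<and> s * f \<in> J"
  then obtain s where s: "s \<notin> P" "s * f \<in> J" by blast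
  then have "s \<noteq> 0" using rmod.subspace_0[OF assms] by auto
  then have "to_fract f = Fract (s * f) s" by (simp add: to_fract_def eq_fract mult.commute)
  then show "to_fract f \<in> localized_ideal P J" using s by (auto simp: localized_ideal_def)
qed

lemma symbolic_power_eq:
  fixes E :: "('x::{finite,linorder}) set set"
  shows "symbolic_power (monomial_ideal (power_expos E 1)) k = (monomial_ideal (symbolic_expos E k) :: ('x, 'k::field) mpoly set)"
proof -
  have key: "(\<exists>s. s \<notin> cover_prime C \<and> s * f \<in> monomial_ideal (power_expos E k)) \<longleftrightarrow> (\<forall>m\<in>keys f. k \<le> wt C m)"
    if C: "min_cover E C" for C and f :: "('x, 'k) mpoly"
  proof
    assume "\<exists>s. s \<notin> cover_prime C \<and> s * f \<in> monomial_ideal (power_expos E k)"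
    then obtain s where s: "wpart C 0 s \<noteq> 0" "s * f \<in> monomial_ideal (power_expos E k)" by (auto simp: wpart_0_cover_prime)
    show "\<forall>m\<in>keys f. k \<le> wt C m"
    proof (rule ccontr)
      assume "\<not> ?thesis"
      then obtain m0 where m0: "m0 \<in> keys f" "wt C m0 < k" by (auto simp: not_le)
      \<comment> \<open>A multiplier outside the prime has a nonzero part of weight 0, so
        \<open>s * f\<close> has a monomial of the same lowest weight as \<open>f\<close>; in the
        power that weight is at least \<open>k\<close>.\<close>
      obtain m1 where m1: "m1 \<in> keys f" "\<And>m. m \<in> keys f \<Longrightarrow> wt C m1 \<le> wt C m"
        using ex_has_least_nat[of "\<lambda>m. m \<in> keys f" m0 "wt C"] m0(1) by blast
      have "m1 \<in> keys (wpart C (int (wt C m1)) f)" using m1(1) by (simp add: keys_wpart)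
      then have "wpart C 0 s * wpart C (int (wt C m1)) f \<noteq> 0" using s(1) by auto
      then have "wpart C (int (wt C m1)) (s * f) \<noteq> 0"
        using wpart_low_mult[of s 0 C f "int (wt C m1)"] m1(2) by simp
      then obtain m where "m \<in> keys (wpart C (int (wt C m1)) (s * f))" by (metis all_not_in_conv keys_eq_empty)
      then have m: "m \<in> keys (s * f)" "wt C m = wt C m1" by (simp_all add: keys_wpart)
      then have "m \<in> power_expos E k" using s(2) by (auto simp: monomial_ideal_def)
      then have "k \<le> wt C m" by (rule power_expos_cover) (use C in \<open>simp add: min_cover_def\<close>)
      then show False using m(2) m0 m1(2)[of m0] by simp
    qed
  next
    assume f: "\<forall>m\<in>keys f. k \<le> wt C m"
    let ?s = "single (rep k (ind (- C))) 1 :: ('x, 'k) mpoly"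
    have "?s \<notin> cover_prime C" by (simp add: cover_prime_def monomial_ideal_def wt_rep wt_ind)
    moreover have "?s * f \<in> monomial_ideal (power_expos E k)"
      unfolding monomial_ideal_def
    proof (intro CollectI subsetI)
      fix m assume "m \<in> keys (?s * f)"
      then obtain a b where "m = a + b" "a \<in> keys ?s" "b \<in> keys f" by (rule keys_multE)
      then show "m \<in> power_expos E k" using min_cover_clear_denominators[OF C] f by auto
    qed
    ultimately show "\<exists>s. s \<notin> cover_prime C \<and> s * f \<in> monomial_ideal (power_expos E k)" by blast
  qed
  have "symbolic_power (monomial_ideal (power_expos E 1)) k =
     {f :: ('x, 'k) mpoly. \<forall>C. min_cover E C \<longrightarrow> to_fract f \<in> localized_ideal (cover_prime C) (monomial_ideal (power_expos E k))}"
    unfolding symbolic_power_def minimal_primes_eq ideal_power_eq by auto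
  also have "\<dots> = {f. \<forall>C. min_cover E C \<longrightarrow> (\<forall>m\<in>keys f. k \<le> wt C m)}"
  proof -
    have "is_ideal (cover_prime C :: ('x, 'k) mpoly set)" for C using cover_prime_prime[of C] unfolding is_prime_ideal_def by (rule conjunct1)
    then show ?thesis by (simp only: localized_ideal_iff key cong: imp_cong)
  qed
  also have "\<dots> = monomial_ideal (symbolic_expos E k)" by (auto simp: monomial_ideal_def symbolic_expos_def)
  finally show ?thesis .
qed

section \<open>Upper bound for the v-number\<close>

text \<open>Multiply elements of the \<open>Q g\<close> lying outside \<open>P\<close>. In
  contrapositive form: a prime that contains a finite intersection of ideals contains one of
  them.\<close>

lemma prime_avoidance_finite:
  assumes P: "is_prime_ideal P" and "finite G"
    and "\<And>g. g \<in> G \<Longrightarrow> is_ideal (Q g) \<and> \<not> Q g \<subseteq> P"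
  shows "\<exists>x. x \<notin> P \<and> (\<forall>g\<in>G. x \<in> Q g)"
  using assms(2,3)
proof (induction G rule: finite_induct)
  case empty
  then show ?case using P by (auto simp: is_prime_ideal_def)
next
  case (insert g G)
  then obtain x where x: "x \<notin> P" "\<forall>g\<in>G. x \<in> Q g" by blast
  obtain y where y: "y \<notin> P" "y \<in> Q g" using insert.prems[of g] by blast
  have "y * x \<notin> P" using P x(1) y(1) by (auto simp: is_prime_ideal_def)
  moreover have "y * x \<in> Q h" if "h \<in> G" for h
    using rmod.subspace_scale[of "Q h" x y] insert.prems[of h] x(2) that by simp
  moreover have "y * x \<in> Q g"
    using rmod.subspace_scale[of "Q g" y x] insert.prems[of g] y(2) by (simp add: mult.commute)
  ultimately show ?case by (intro exI[of _ "y * x"]) auto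
qed

lemma colon_ideal:
  assumes "is_ideal J"
  shows "is_ideal (colon J S)"
  by (rule rmod.subspaceI)
    (use assms in \<open>auto simp: colon_def rmod.subspace_0 rmod.subspace_add rmod.subspace_scale distrib_right mult.assoc\<close>)

text \<open>Induction peels off one factor: if \<open>f\<close> multiplies the power
  \<open>l + 1\<close> into the power \<open>l + 2\<close>, then for \<open>h\<close> in the power
  \<open>l\<close> the element \<open>f * h\<close> multiplies \<open>I\<close> into the power
  \<open>l + 2\<close>, so strong persistence puts it into the power \<open>l + 1\<close>.\<close>

lemma strong_persistence_colon:
  assumes I: "is_ideal I" and sp: "strong_persistence I"
  shows "colon (ideal_power I (Suc l)) (ideal_power I l) = I"
proof -
  have step: "a * b \<in> ideal_power I (Suc l)" if "a \<in> I" "b \<in> ideal_power I l" for a b l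
    using that by (auto intro!: rmod.span_base)
  have "ideal_power I (Suc 0) = I"
  proof
    have "{a * b | a b. a \<in> I \<and> b \<in> ideal_power I 0} \<subseteq> I"
      using rmod.subspace_scale[OF I] by (auto simp: mult.commute)
    then have "ideal_gen {a * b | a b. a \<in> I \<and> b \<in> ideal_power I 0} \<subseteq> I" by (rule rmod.span_minimal) (rule I)
    then show "ideal_power I (Suc 0) \<subseteq> I" by (simp only: ideal_power.simps)
    show "I \<subseteq> ideal_power I (Suc 0)" using step[of _ 1 0] by auto
  qed
  then have base: "colon (ideal_power I (Suc 0)) (ideal_power I 0) \<subseteq> I"
    unfolding colon_def by (auto simp del: ideal_power.simps(2)) (metis mult.right_neutral)
  have "colon (ideal_power I (Suc l)) (ideal_power I l) \<subseteq> I"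
  proof (induction l)
    case 0
    then show ?case by (rule base)
  next
    case (Suc l)
    have "f * h \<in> ideal_power I (Suc l)" if f: "f \<in> colon (ideal_power I (Suc (Suc l))) (ideal_power I (Suc l))"
      and h: "h \<in> ideal_power I l" for f h
    proof -
      have "f * h * a \<in> ideal_power I (Suc (Suc l))" if "a \<in> I" for a
        using f step[OF that h] unfolding colon_def by (simp only: mem_Collect_eq mult.assoc mult.commute[of h a])
      then have "f * h \<in> colon (ideal_power I (Suc l + 1)) I" unfolding colon_def Suc_eq_plus1[symmetric] by blast
      moreover have "colon (ideal_power I (Suc l + 1)) I = ideal_power I (Suc l)"
        using sp unfolding strong_persistence_def by (metis le_add1 plus_1_eq_Suc)
      ultimately show ?thesis by (simp only:)
    qed
    then have "colon (ideal_power I (Suc (Suc l))) (ideal_power I (Suc l)) \<subseteq> colon (ideal_power I (Suc l)) (ideal_power I l)"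
      unfolding colon_def[of _ "ideal_power I l"] by blast
    then show ?case using Suc by blast
  qed
  moreover have "I \<subseteq> colon (ideal_power I (Suc l)) (ideal_power I l)"
    using step by (auto simp: colon_def simp del: ideal_power.simps)
  ultimately show ?thesis by blast
qed

lemma symbolic_expos_colon:
  assumes E: "E \<noteq> {}"
  shows "colon (monomial_ideal (symbolic_expos E (Suc l))) (monomial_ideal (power_expos E l)) = (monomial_ideal (power_expos E 1) :: ('x::finite, 'k::comm_ring_1) mpoly set)"
proof (intro equalityI subsetI)
  fix f :: "('x, 'k) mpoly" assume f: "f \<in> monomial_ideal (power_expos E 1)"
  show "f \<in> colon (monomial_ideal (symbolic_expos E (Suc l))) (monomial_ideal (power_expos E l))"
    unfolding colon_def
  proof (intro CollectI ballI)
    fix h :: "('x, 'k) mpoly" assume h: "h \<in> monomial_ideal (power_expos E l)"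
    show "f * h \<in> monomial_ideal (symbolic_expos E (Suc l))"
      unfolding monomial_ideal_def
    proof (intro CollectI subsetI)
      fix m assume "m \<in> keys (f * h)"
      then obtain a b where ab: "m = a + b" "a \<in> keys f" "b \<in> keys h" by (rule keys_multE)
      then have "a \<in> power_expos E 1" "b \<in> power_expos E l" using f h by (auto simp: monomial_ideal_def)
      then have "1 \<le> wt C a" "l \<le> wt C b" if "cover E C" for C using power_expos_cover that by blast+
      then show "m \<in> symbolic_expos E (Suc l)" unfolding ab(1) symbolic_expos_def
        by (force simp: wt_add min_cover_def)
    qed
  qed
next
  fix f :: "('x, 'k) mpoly" assume f: "f \<in> colon (monomial_ideal (symbolic_expos E (Suc l))) (monomial_ideal (power_expos E l))"
  have "m \<in> symbolic_expos E 1" if m: "m \<in> keys f" for m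
    unfolding symbolic_expos_def
  proof (intro CollectI allI impI)
    fix C assume C: "min_cover E C"
    then have "C \<noteq> {}" using E by (auto simp: min_cover_def cover_def)
    then obtain v where "v \<in> C" by blast
    then obtain e where e: "e \<in> E" "e \<inter> C = {v}" using min_cover_edge[OF C] by blast
    \<comment> \<open>The \<open>l\<close>-th power of an edge that meets \<open>C\<close> once has
      weight exactly \<open>l\<close> on \<open>C\<close>, so of the required weight
      \<open>Suc l\<close> at least 1 must come from \<open>m\<close>.\<close>
    let ?h = "single (rep l (ind e)) 1 :: ('x, 'k) mpoly"
    have "rep l (ind e) \<in> power_expos E l" using power_expos_rep[OF e(1), of l 0] by simp
    then have "?h \<in> monomial_ideal (power_expos E l)" by (simp add: single_in_monomial_ideal)
    then have "?h * f \<in> monomial_ideal (symbolic_expos E (Suc l))" using f by (auto simp: colon_def mult.commute)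
    moreover have "rep l (ind e) + m \<in> keys (?h * f)"
      using m lookup_single_mult_add[of "rep l (ind e)" 1 f m] by (simp add: in_keys_iff)
    ultimately have "Suc l \<le> wt C (rep l (ind e) + m)" using C by (auto simp: monomial_ideal_def symbolic_expos_def)
    then show "1 \<le> wt C m" using e(2) by (simp add: wt_add wt_rep wt_ind)
  qed
  then show "f \<in> monomial_ideal (power_expos E 1)" unfolding symbolic_expos_1[symmetric] by (auto simp: monomial_ideal_def)
qed

text \<open>\<open>LEAST\<close> carries information only if some witness exists. The product of the
  variables outside a minimal cover \<open>C\<close> is one: its colon ideal is the prime of
  \<open>C\<close>.\<close>

lemma v_number_attained:
  fixes E :: "('x::{finite,linorder}) set set"
  assumes E: "{} \<notin> E"
  shows "\<exists>f. f \<in> graded_part (v_number (monomial_ideal (power_expos E 1) :: ('x, 'k::field) mpoly set)) \<and>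
    is_prime_ideal (colon (monomial_ideal (power_expos E 1) :: ('x, 'k) mpoly set) {f})"
proof -
  let ?I = "monomial_ideal (power_expos E 1) :: ('x, 'k) mpoly set"
  obtain C where C: "min_cover E C" using min_cover_exists[OF E] .
  let ?f = "single (ind (- C)) 1 :: ('x, 'k) mpoly"
  have "colon ?I {?f} = cover_prime C"
  proof (intro equalityI subsetI)
    fix h assume "h \<in> colon ?I {?f}"
    then have h: "?f * h \<in> ?I" by (simp add: colon_def mult.commute)
    have "1 \<le> wt C m" if "m \<in> keys h" for m
    proof -
      have "ind (- C) + m \<in> keys (?f * h)"
        using that lookup_single_mult_add[of "ind (- C)" 1 h m] by (simp add: in_keys_iff)
      then have "ind (- C) + m \<in> power_expos E 1" using h by (auto simp: monomial_ideal_def)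
      then have "1 \<le> wt C (ind (- C) + m)" by (rule power_expos_cover) (use C in \<open>simp add: min_cover_def\<close>)
      then show ?thesis by (simp add: wt_add wt_ind)
    qed
    then show "h \<in> cover_prime C" by (auto simp: cover_prime_def monomial_ideal_def)
  next
    fix h :: "('x, 'k) mpoly" assume h: "h \<in> cover_prime C"
    have "?f * h \<in> ?I"
      unfolding monomial_ideal_def
    proof (intro CollectI subsetI)
      fix m assume "m \<in> keys (?f * h)"
      then obtain a b where ab: "m = a + b" "a \<in> keys ?f" "b \<in> keys h" by (rule keys_multE)
      then have "m = rep 1 (ind (- C)) + b" by (simp add: rep_Suc One_nat_def)
      moreover have "1 \<le> wt C b" using h ab(3) by (auto simp: cover_prime_def monomial_ideal_def)
      ultimately show "m \<in> power_expos E 1" using min_cover_clear_denominators[OF C] by blast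
    qed
    then show "h \<in> colon ?I {?f}" by (simp add: colon_def mult.commute)
  qed
  moreover have "?f \<in> graded_part (wt UNIV (ind (- C)))" by (simp add: graded_part_eq hom_part_def)
  ultimately have "\<exists>e f P. f \<in> graded_part e \<and> P \<in> Ass ?I \<and> colon ?I {f} = P"
    using cover_prime_prime[of C] unfolding Ass_def by blast
  then have "\<exists>f P. f \<in> graded_part (v_number ?I) \<and> P \<in> Ass ?I \<and> colon ?I {f} = P"
    unfolding v_number_def by (rule LeastI_ex)
  then show ?thesis by (auto simp: Ass_def)
qed

lemma v_number_le:
  fixes E :: "('x::{finite,linorder}) set set" and J :: "('x, 'k::field) mpoly set"
  assumes E: "{} \<notin> E" and d: "\<And>e. e \<in> E \<Longrightarrow> card e \<le> d"
    and J: "is_ideal J" and colon: "colon J (monomial_ideal (power_expos E l)) = monomial_ideal (power_expos E 1)"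
  shows "v_number J \<le> v_number (monomial_ideal (power_expos E 1) :: ('x, 'k) mpoly set) + l * d"
proof -
  let ?I = "monomial_ideal (power_expos E 1) :: ('x, 'k) mpoly set"
  obtain f where f: "f \<in> graded_part (v_number ?I)" "is_prime_ideal (colon ?I {f})"
    using v_number_attained[OF E] by blast
  define Q where "Q = (\<lambda>g. colon J {f * single g 1})"
  have Q: "x \<in> Q g \<longleftrightarrow> single g 1 * (x * f) \<in> J" for x g
    by (simp add: Q_def colon_def ac_simps)
  have power: "monomial_ideal (power_expos E l) = (ideal_gen ((\<lambda>u. single u 1) ` power_gens E l) :: ('x, 'k) mpoly set)"
    unfolding ideal_gen_monomials power_expos_eq_power_gens ..
  have inter: "x \<in> colon ?I {f} \<longleftrightarrow> (\<forall>g\<in>power_gens E l. x \<in> Q g)" for x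
  proof
    assume "x \<in> colon ?I {f}"
    then have "x * f \<in> colon J (monomial_ideal (power_expos E l))" unfolding colon by (simp add: colon_def)
    moreover have "single g 1 \<in> (monomial_ideal (power_expos E l) :: ('x, 'k) mpoly set)" if "g \<in> power_gens E l" for g
      unfolding power using that by (intro rmod.span_base) auto
    ultimately have "\<forall>g\<in>power_gens E l. x * f * single g 1 \<in> J" unfolding colon_def by blast
    then show "\<forall>g\<in>power_gens E l. x \<in> Q g" unfolding Q by (metis mult.commute)
  next
    assume g: "\<forall>g\<in>power_gens E l. x \<in> Q g"
    have "is_ideal {b. b * (x * f) \<in> J}"
      by (rule rmod.subspaceI)
        (use J in \<open>auto simp: rmod.subspace_0 rmod.subspace_add rmod.subspace_scale distrib_right mult.assoc\<close>)
    moreover have "(\<lambda>u. single u 1) ` power_gens E l \<subseteq> {b. b * (x * f) \<in> J}" using g Q by auto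
    ultimately have "monomial_ideal (power_expos E l) \<subseteq> {b. b * (x * f) \<in> J}" unfolding power by (intro rmod.span_minimal)
    then have "\<forall>b\<in>monomial_ideal (power_expos E l). b * (x * f) \<in> J" by blast
    then have "x * f \<in> colon J (monomial_ideal (power_expos E l))"
      unfolding colon_def mem_Collect_eq by (simp only: mult.commute[of "x * f"])
    then show "x \<in> colon ?I {f}" unfolding colon by (simp add: colon_def)
  qed
  \<comment> \<open>Otherwise some element outside the prime would lie in every \<open>Q g\<close>,
    contradicting \<open>inter\<close>. The reverse inclusion is part of \<open>inter\<close>, so
    \<open>f\<close> times the monomial \<open>g\<close> witnesses the same prime for
    \<open>J\<close>.\<close>
  obtain g where g: "g \<in> power_gens E l" "Q g \<subseteq> colon ?I {f}"
  proof (rule ccontr)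
    assume "\<not> thesis"
    then have bad: "is_ideal (Q g) \<and> \<not> Q g \<subseteq> colon ?I {f}" if "g \<in> power_gens E l" for g
      using that colon_ideal[OF J] \<open>\<And>g. g \<in> power_gens E l \<Longrightarrow> Q g \<subseteq> colon ?I {f} \<Longrightarrow> thesis\<close> unfolding Q_def by blast
    have "\<exists>x. x \<notin> colon ?I {f} \<and> (\<forall>g\<in>power_gens E l. x \<in> Q g)"
      by (rule prime_avoidance_finite[OF f(2) power_gens_finite]) (rule bad)
    then show False using inter by blast
  qed
  have Qg: "Q g = colon ?I {f}" using g inter by blast
  have "f * single g 1 \<in> graded_part (v_number ?I + wt UNIV g)"
    using hom_part_mult[OF f(1)[unfolded graded_part_eq] hom_part_single[of g 1]] by (simp add: graded_part_eq)
  moreover have "Q g \<in> Ass J" unfolding Ass_def Q_def using f(2) Qg[unfolded Q_def] by auto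
  ultimately have "v_number J \<le> v_number ?I + wt UNIV g"
    unfolding v_number_def[of J] by (intro Least_le) (auto simp: Q_def)
  also have "wt UNIV g \<le> l * d" by (rule power_gens_wt[OF d g(1)])
  finally show ?thesis by simp
qed

section \<open>Degrees of minimal generators\<close>

lemma mult_wpart_expand:
  fixes f g :: "('x::finite, 'k::comm_ring_1) mpoly"
  shows "\<exists>T. finite T \<and> (\<forall>j\<in>T. 0 \<le> j) \<and> wpart UNIV u (f * g) = (\<Sum>j\<in>T. wpart UNIV j f * wpart UNIV (u - j) g)"
proof (intro exI conjI)
  let ?T = "(\<lambda>m. int (wt UNIV m)) ` keys f"
  show "finite ?T" "\<forall>j\<in>?T. 0 \<le> j" by auto
  have "f * g = (\<Sum>j\<in>?T. wpart UNIV j f) * g" by (subst sum_wparts) auto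
  also have "\<dots> = (\<Sum>j\<in>?T. wpart UNIV j f * g)" by (rule sum_distrib_right)
  finally show "wpart UNIV u (f * g) = (\<Sum>j\<in>?T. wpart UNIV j f * wpart UNIV (u - j) g)"
    by (simp add: wpart_sum wpart_mult_hom[OF wpart_hom])
qed

text \<open>A homogeneous element of larger degree than all generators of an ideal is redundant in every
  homogeneous generating set.\<close>

lemma min_generating_set_degree:
  fixes U :: "('x::finite) expo set" and I :: "('x, 'k::field) mpoly set"
  assumes I: "I = ideal_gen ((\<lambda>u. single u 1) ` U)" and U: "\<And>u. u \<in> U \<Longrightarrow> wt UNIV u \<le> d"
    and G: "min_generating_set I G" "g \<in> G" "g \<in> graded_part t"
  shows "t \<le> d"
proof (rule ccontr)
  assume t: "\<not> t \<le> d"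
  let ?S = "ideal_gen (G - {g})"
  \<comment> \<open>Closed under multiplication because polynomial factors have nonnegative degrees:
    a part of degree at most \<open>d\<close> of a product involves only such parts of its factor in
    \<open>T\<close>. It contains \<open>g\<close>, whose degree \<open>t\<close> exceeds
    \<open>d\<close>.\<close>
  define T where "T = {f. \<forall>u\<le>int d. wpart UNIV u f \<in> ?S}"
  have S: "is_ideal ?S" by (rule rmod.subspace_span)
  have "is_ideal T"
  proof (rule rmod.subspaceI)
    show "0 \<in> T" by (simp add: T_def rmod.span_zero)
    show "x + y \<in> T" if "x \<in> T" "y \<in> T" for x y
      using that by (simp add: T_def wpart_def part_add rmod.span_add)
    show "c * x \<in> T" if x: "x \<in> T" for c x
      unfolding T_def
    proof (intro CollectI allI impI)
      fix u assume u: "u \<le> int d"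
      obtain A where A: "\<forall>j\<in>A. 0 \<le> j" "wpart UNIV u (c * x) = (\<Sum>j\<in>A. wpart UNIV j c * wpart UNIV (u - j) x)"
        using mult_wpart_expand by blast
      show "wpart UNIV u (c * x) \<in> ?S"
        unfolding A(2) using A(1) x u by (intro rmod.span_sum rmod.span_scale) (auto simp: T_def)
    qed
  qed
  moreover have "G \<subseteq> T"
  proof
    fix h assume h: "h \<in> G"
    show "h \<in> T"
      unfolding T_def
    proof (intro CollectI allI impI)
      fix u assume u: "u \<le> int d"
      show "wpart UNIV u h \<in> ?S"
      proof (cases "h = g")
        case True
        then have "wpart UNIV u h = 0"
          using G(3) t u by (intro wpart_of_hom_other[of _ "int t"]) (auto simp: graded_part_eq)
        then show ?thesis by (simp add: rmod.span_zero)
      next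
        case False
        obtain e where e: "h \<in> hom_part (int e)" using G(1) h unfolding min_generating_set_def graded_part_eq by blast
        then have "wpart UNIV u h = h \<or> wpart UNIV u h = 0"
          using wpart_of_hom[OF e] wpart_of_hom_other[OF e, of u] by blast
        then show ?thesis using False h by (auto simp: rmod.span_zero rmod.span_base)
      qed
    qed
  qed
  moreover have IG: "ideal_gen G = I" using G(1) by (simp add: min_generating_set_def)
  ultimately have IT: "I \<subseteq> T" using rmod.span_minimal by metis
  have "(\<lambda>u. single u 1) ` U \<subseteq> ?S"
  proof
    fix f assume "f \<in> (\<lambda>u. single u 1 :: ('x, 'k) mpoly) ` U"
    then obtain u where u: "u \<in> U" "f = single u 1" by blast
    then have "f \<in> T" using IT unfolding I by (auto intro: rmod.span_base)
    moreover have "wpart UNIV (int (wt UNIV u)) f = f" unfolding u(2) by (intro wpart_of_hom hom_part_single)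
    moreover have "int (wt UNIV u) \<le> int d" using U[OF u(1)] by simp
    ultimately show "f \<in> ?S" unfolding T_def by (metis (mono_tags, lifting) mem_Collect_eq)
  qed
  then have "I \<subseteq> ?S" unfolding I by (rule rmod.span_minimal) (rule S)
  moreover have "?S \<subseteq> I" unfolding IG[symmetric] by (rule rmod.span_mono) blast
  ultimately have "ideal_gen (G - {g}) = I" by blast
  moreover have "G - {g} \<subset> G" using G(2) by blast
  ultimately show False using G(1) unfolding min_generating_set_def by blast
qed

text \<open>The edge monomials form a minimal generating set since no edge contains another.
  \<open>max_gen_degree\<close> ranges over all minimal generating sets, so
  \<open>min_generating_set_degree\<close> is needed to make its \<open>Max\<close> finite.\<close>

lemma card_edge_le_max_gen_degree:
  fixes E :: "('x::finite) set set"
  assumes anti: "\<And>e e'. e \<in> E \<Longrightarrow> e' \<in> E \<Longrightarrow> e \<subseteq> e' \<Longrightarrow> e = e'" and e: "e \<in> E"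
  shows "card e \<le> max_gen_degree (monomial_ideal (power_expos E 1) :: ('x, 'k::field) mpoly set)"
proof -
  let ?I = "monomial_ideal (power_expos E 1) :: ('x, 'k) mpoly set"
  let ?mon = "\<lambda>e. single (ind e) 1 :: ('x, 'k) mpoly"
  have gen: "ideal_gen (?mon ` F) = monomial_ideal {ind e + n | e n. e \<in> F}" for F
  proof -
    have "ideal_gen (?mon ` F) = ideal_gen ((\<lambda>u. single u 1 :: ('x, 'k) mpoly) ` ind ` F)" by (simp add: image_image)
    then show ?thesis unfolding ideal_gen_monomials by (auto intro!: arg_cong[where f = monomial_ideal])
  qed
  have I: "?I = ideal_gen ((\<lambda>u. single u 1) ` ind ` E)"
    using gen[of E] by (simp add: image_image power_expos_1)
  let ?S = "{t. \<exists>G g. min_generating_set ?I G \<and> g \<in> G \<and> g \<in> graded_part t}"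
  have "?S \<subseteq> {..card (UNIV :: 'x set)}"
  proof
    fix t assume "t \<in> ?S"
    then obtain G g where G: "min_generating_set ?I G" "g \<in> G" "g \<in> graded_part t" by blast
    have "t \<le> card (UNIV :: 'x set)"
      by (rule min_generating_set_degree[OF I _ G]) (auto simp: wt_ind intro!: card_mono)
    then show "t \<in> {..card (UNIV :: 'x set)}" by simp
  qed
  then have fin: "finite ?S" by (rule finite_subset) simp
  have hom: "?mon e' \<in> graded_part (card e')" for e'
    by (simp add: graded_part_eq hom_part_def wt_ind)
  have "min_generating_set ?I (?mon ` E)"
    unfolding min_generating_set_def
  proof (intro conjI allI impI ballI)
    show "\<exists>t. g \<in> graded_part t" if "g \<in> ?mon ` E" for g using that hom by blast
    show "ideal_gen (?mon ` E) = ?I" by (simp add: gen power_expos_1)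
    fix G' assume G': "G' \<subset> ?mon ` E"
    define F where "F = {e \<in> E. ?mon e \<in> G'}"
    have G'F: "G' = ?mon ` F" using G' by (auto simp: F_def)
    then obtain e0 where e0: "e0 \<in> E" "e0 \<notin> F" using G' by blast
    show "ideal_gen G' \<noteq> ?I"
    proof
      assume "ideal_gen G' = ?I"
      moreover have "ind e0 \<in> power_expos E 1" using e0(1) unfolding power_expos_1 by (metis (mono_tags, lifting) add.right_neutral mem_Collect_eq)
      then have "?mon e0 \<in> ?I" by (simp add: single_in_monomial_ideal)
      ultimately have "?mon e0 \<in> monomial_ideal {ind e + n | e n. e \<in> F}" by (simp add: G'F gen)
      then obtain e' n where e': "ind e0 = ind e' + n" "e' \<in> F" unfolding single_in_monomial_ideal by blast
      have "e' \<subseteq> e0"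
      proof
        fix x assume "x \<in> e'"
        then have "lookup (ind e0) x \<noteq> 0" unfolding e'(1) by (simp add: lookup_add lookup_ind)
        then show "x \<in> e0" by (simp add: lookup_ind split: if_splits)
      qed
      then have "e' = e0" using anti[of e' e0] e'(2) e0(1) by (simp add: F_def)
      then show False using e'(2) e0(2) by simp
    qed
  qed
  then have "card e \<in> ?S" using e hom by blast
  then show ?thesis unfolding max_gen_degree_def by (rule Max_ge[OF fin])
qed

section \<open>A nontrivial Koszul homology class\<close>

context koszul
begin

text \<open>\<open>M\<close> is kept abstract between the exponents of the ordinary power and those
  allowed by all covers, so that one argument serves ordinary and symbolic powers.\<close>

lemma induced_matching_class:
  fixes Es :: "nat \<Rightarrow> 'x set" and M :: "'x expo set" and s l :: nat
  defines "W \<equiv> \<Union>i\<in>{1..s}. Es i"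
  assumes edge: "\<And>i. i \<in> {1..s} \<Longrightarrow> Es i \<in> E" and ne: "\<And>i. i \<in> {1..s} \<Longrightarrow> Es i \<noteq> {}"
    and disj: "\<And>i j. i \<in> {1..s} \<Longrightarrow> j \<in> {1..s} \<Longrightarrow> i \<noteq> j \<Longrightarrow> Es i \<inter> Es j = {}"
    and induced: "\<And>e. e \<in> E \<Longrightarrow> e \<subseteq> W \<Longrightarrow> e \<in> Es ` {1..s}"
    and s: "1 \<le> s"
    and blocks: "\<And>i j u w. i \<in> {1..s} \<Longrightarrow> j \<in> {1..s} \<Longrightarrow> i < j \<Longrightarrow> u \<in> Es i \<Longrightarrow> w \<in> Es j \<Longrightarrow> r u < r w"
    and M: "power_expos E (Suc l) \<subseteq> M" and up: "upclosed M"
    and M_cover: "\<And>m C. m \<in> M \<Longrightarrow> cover E C \<Longrightarrow> Suc l \<le> wt C m"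
  shows "\<not> quotient_koszul_vanish (monomial_ideal M :: ('x, 'k::comm_ring_1) mpoly set) s (int (card W + l * card (Es 1)))"
proof
  let ?I = "{1..s}"
  let ?J = "monomial_ideal M :: ('x, 'k) mpoly set"
  \<comment> \<open>The multidegree of the class: all vertices of the matching once, and
    \<open>l\<close> more copies of the first edge. The term at \<open>S\<close> has the monomial
    \<open>a - ind S\<close>.\<close>
  define a where "a = ind W + rep l (ind (Es 1))"
  have one: "1 \<in> ?I" using s by simp
  have E1W: "Es 1 \<subseteq> W" using one unfolding W_def by blast
  have a: "lookup a x = (if x \<in> Es 1 then Suc l else if x \<in> W then 1 else 0)" for x
    using E1W by (auto simp: a_def lookup_add lookup_ind lookup_rep)
  have wt_a: "wt UNIV a = card W + l * card (Es 1)"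
    by (simp add: a_def wt_add wt_ind wt_rep)
  have J: "is_ideal ?J" by (rule monomial_ideal_ideal[OF up])
  define Tr where "Tr = {S. S \<subseteq> W \<and> (\<forall>i\<in>?I. \<exists>!x. x \<in> S \<inter> Es i)}"
  have sub_a: "ind S + (a - ind S) = a" if "S \<subseteq> W" for S
    by (rule expo_diff_add) (use that a in \<open>auto simp: lookup_ind\<close>)
  have lookup_a_ind: "lookup (a - ind S) x = lookup a x - (if x \<in> S then 1 else 0)" for S x
    by (simp add: lookup_minus lookup_ind)
  \<comment> \<open>A transversal together with everything outside \<open>W\<close> is a cover: an
    edge inside \<open>W\<close> belongs to the matching, as the matching is induced. On this cover
    \<open>a - ind S\<close> has weight only \<open>l\<close>, all of it at the vertex chosen in
    \<open>Es 1\<close>.\<close>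
  have notM: "a - ind S \<notin> M" if S: "S \<in> Tr" for S
  proof
    assume "a - ind S \<in> M"
    have "cover E (S \<union> - W)"
      unfolding cover_def
    proof
      fix e assume e: "e \<in> E"
      show "e \<inter> (S \<union> - W) \<noteq> {}"
      proof (cases "e \<subseteq> W")
        case True
        then obtain i where i: "i \<in> ?I" "e = Es i" using induced[OF e] by blast
        then have "\<exists>x. x \<in> S \<inter> Es i" using S unfolding Tr_def by blast
        then show ?thesis using i(2) by blast
      qed blast
    qed
    then have "Suc l \<le> wt (S \<union> - W) (a - ind S)" by (rule M_cover[OF \<open>a - ind S \<in> M\<close>])
    moreover have "wt (S \<union> - W) (a - ind S) \<le> l"
    proof -
      obtain x1 where x1: "x1 \<in> S \<inter> Es 1" "\<And>x. x \<in> S \<inter> Es 1 \<Longrightarrow> x = x1"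
        using S one unfolding Tr_def by blast
      have "wt (S \<union> - W) (a - ind S) = (\<Sum>x\<in>S \<union> - W. if x = x1 then l else 0)"
        unfolding wt_def
      proof (intro sum.cong refl)
        fix x assume x: "x \<in> S \<union> - W"
        have "x \<notin> Es 1" if "x \<noteq> x1" using x1(2)[of x] x E1W that by blast
        moreover have "x \<in> S \<longleftrightarrow> x \<in> W" using x S unfolding Tr_def by blast
        ultimately show "lookup (a - ind S) x = (if x = x1 then l else 0)"
          using x1(1) unfolding lookup_a_ind a by (cases "x = x1") simp_all
      qed
      then show ?thesis by simp
    qed
    ultimately show False by simp
  qed
  define v where "v = (\<lambda>i. SOME x. x \<in> Es i)"
  have v: "v i \<in> Es i" if "i \<in> ?I" for i unfolding v_def using ne[OF that] by (simp only: some_in_eq not_False_eq_True)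
  define S0 where "S0 = v ` ?I"
  have v_Es: "i = j" if "i \<in> ?I" "j \<in> ?I" "v i \<in> Es j" for i j
    using disj[OF that(1,2)] v[OF that(1)] that(3) by blast
  have S0Tr: "S0 \<in> Tr"
    unfolding Tr_def
  proof (intro CollectI conjI ballI)
    show "S0 \<subseteq> W" using v by (auto simp: S0_def W_def)
    show "\<exists>!x. x \<in> S0 \<inter> Es i" if i: "i \<in> ?I" for i
    proof (rule ex1I[of _ "v i"])
      show "v i \<in> S0 \<inter> Es i" using i v by (simp add: S0_def)
      fix x assume "x \<in> S0 \<inter> Es i"
      then obtain j where "j \<in> ?I" "x = v j" "v j \<in> Es i" by (auto simp: S0_def)
      then show "x = v i" using v_Es i by blast
    qed
  qed
  have S0W: "S0 \<subseteq> W" using S0Tr by (simp add: Tr_def)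
  have "inj_on v ?I" using v v_Es by (metis inj_onI)
  then have cardS0: "card S0 = s" by (simp add: S0_def card_image)
  define c where "c = (\<lambda>S (i::nat). if S = S0 \<and> i = 0 then single (a - ind S0) 1 else 0 :: ('x, 'k) mpoly)"
  have "chain (free_mod [0]) s (int (card W + l * card (Es 1))) c"
  proof (rule chainI)
    fix S :: "'x set"
    show "c S = 0" if "card S \<noteq> s" using that cardS0 by (auto simp: c_def zero_fun_def)
    have "wt UNIV a = wt UNIV (ind S0) + wt UNIV (a - ind S0)" by (subst sub_a[OF S0W, symmetric]) (rule wt_add)
    then have "int (wt UNIV (a - ind S0)) = int (card W + l * card (Es 1)) - int s"
      using wt_a cardS0 by (simp add: wt_ind)
    then show "c S \<in> free_mod [0] (int (card W + l * card (Es 1)) - int s)"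
      by (auto simp: free_mod_def c_def hom_part_def)
  qed
  moreover have "kdiff_vec c S i \<in> ?J" for S i
    unfolding kdiff_vec_apply kdiff_def
  proof (rule rmod.subspace_sum[OF J])
    fix u assume "u \<in> - S"
    show "single (single u 1) (ksign S u) * c (insert u S) i \<in> ?J"
    proof (cases "insert u S = S0 \<and> i = 0")
      case False
      then have "c (insert u S) i = 0" by (auto simp: c_def)
      then show ?thesis using rmod.subspace_0[OF J] by simp
    next
      case True
      then obtain i where i: "i \<in> ?I" "u = v i" unfolding S0_def by blast
      \<comment> \<open>Multiplication by \<open>u\<close> completes the edge \<open>Es i\<close>,
        and \<open>l\<close> further copies of \<open>Es 1\<close> are still present, giving a
        product of \<open>Suc l\<close> edges.\<close>
      have "lookup (ind (Es i) + rep l (ind (Es 1))) x \<le> lookup (single u 1 + (a - ind S0)) x" for x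
      proof -
        have "lookup (single u (1::nat)) x = (if x = u then 1 else 0)" by (simp add: lookup_single)
        moreover have "x \<notin> S0" if "x \<in> Es i" "x \<noteq> u"
          using that i v_Es unfolding S0_def by blast
        moreover have "x \<notin> Es 1" if "x \<in> Es i" "i \<noteq> 1" using disj[OF i(1) one] that by blast
        moreover have "x \<in> W" if "x \<in> Es i" using that i(1) by (auto simp: W_def)
        ultimately show ?thesis
          unfolding lookup_add lookup_a_ind lookup_rep lookup_ind a by auto
      qed
      then obtain p where p: "single u 1 + (a - ind S0) = ind (Es i) + rep l (ind (Es 1)) + p"
        by (rule expo_le_decompose)
      have "rep l (ind (Es 1)) + p \<in> power_expos E l" by (rule power_expos_rep[OF edge[OF one]])
      then have "single u 1 + (a - ind S0) \<in> power_expos E (Suc l)"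
        unfolding p using edge[OF i(1)] by (auto simp: add.assoc)
      then have "single u 1 + (a - ind S0) \<in> M" using M by blast
      moreover have "c (insert u S) 0 = single (a - ind S0) 1" using True by (simp add: c_def)
      ultimately show ?thesis using True by (simp add: mult_single monomial_ideal_def)
    qed
  qed
  moreover assume "quotient_koszul_vanish ?J s (int (card W + l * card (Es 1)))"
  ultimately obtain e where e: "\<And>S i. (c S - kdiff_vec e S) i \<in> ?J"
    unfolding quotient_koszul_vanish_def koszul_vanish_def by blast
  define \<epsilon> where "\<epsilon> = (\<lambda>T. lookup (e T 0) (a - ind T))"
  define A where "A = Sigma Tr (\<lambda>S. W - S)"
  define t where "t = (\<lambda>(S, u). ksign S u * \<epsilon> (insert u S))"
  \<comment> \<open>At transversals the error term has no coefficient, by \<open>notM\<close>, so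
    \<open>c\<close> agrees there with the boundary. Only vertices of \<open>W\<close> contribute
    because \<open>a\<close> is supported on \<open>W\<close>.\<close>
  have coeff: "lookup (c S 0) (a - ind S) = (\<Sum>u\<in>W - S. t (S, u))" if S: "S \<in> Tr" for S
  proof -
    have "keys ((c S - kdiff_vec e S) 0) \<subseteq> M" using e by (simp add: monomial_ideal_def)
    then have "a - ind S \<notin> keys ((c S - kdiff_vec e S) 0)" using notM[OF S] by blast
    then have "lookup (c S 0) (a - ind S) = lookup (kdiff (\<lambda>S. e S 0) S) (a - ind S)"
      by (simp add: in_keys_iff lookup_minus kdiff_vec_apply)
    also have "\<dots> = (\<Sum>u\<in>-S. if u \<in> W then t (S, u) else 0)"
      unfolding lookup_kdiff
    proof (intro sum.cong refl)
      fix u assume u: "u \<in> - S"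
      have "a - ind S - single u 1 = a - ind (insert u S)"
        using u by (intro poly_mapping_eqI) (auto simp: lookup_minus lookup_ind lookup_single when_def)
      moreover have "lookup (a - ind S) u = 0 \<longleftrightarrow> u \<notin> W" using u E1W by (auto simp: lookup_a_ind a)
      ultimately show "(if lookup (a - ind S) u = 0 then 0
          else ksign S u * lookup (e (insert u S) 0) (a - ind S - single u 1)) = (if u \<in> W then t (S, u) else 0)"
        by (simp add: t_def \<epsilon>_def)
    qed
    also have "\<dots> = (\<Sum>u\<in>- S \<inter> W. t (S, u))" by (simp add: sum.inter_restrict)
    also have "- S \<inter> W = W - S" by blast
    finally show ?thesis .
  qed
  have "(\<Sum>S\<in>Tr. lookup (c S 0) (a - ind S)) = (\<Sum>S\<in>Tr. if S = S0 then 1 else 0)"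
    by (intro sum.cong refl) (auto simp: c_def)
  also have "\<dots> = 1" using S0Tr by simp
  finally have "1 = (\<Sum>S\<in>Tr. \<Sum>u\<in>W - S. t (S, u))" using coeff by simp
  also have "\<dots> = sum t A" unfolding A_def by (subst sum.Sigma) auto
  also have "sum t A = 0"
  proof -
    \<comment> \<open>The vertex of \<open>S\<close> in the same matching edge as \<open>u\<close>.
      The involution exchanges the two, leaving the set \<open>insert u S\<close>, and with it the
      coefficient \<open>\<epsilon>\<close>, unchanged.\<close>
    define partner where "partner = (\<lambda>(S, u). THE w. \<exists>i\<in>?I. u \<in> Es i \<and> w \<in> S \<inter> Es i)"
    define \<phi> where "\<phi> = (\<lambda>(S, u). (insert u (S - {partner (S, u)}), partner (S, u)))"
    have partner_eq: "partner (S, u) = w" if "S \<in> Tr" "i \<in> ?I" "u \<in> Es i" "w \<in> S \<inter> Es i" for S u i w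
      unfolding partner_def prod.case
    proof (rule the_equality)
      show "\<exists>i\<in>?I. u \<in> Es i \<and> w \<in> S \<inter> Es i" using that by blast
      fix w' assume "\<exists>i\<in>?I. u \<in> Es i \<and> w' \<in> S \<inter> Es i"
      then obtain j where j: "j \<in> ?I" "u \<in> Es j" "w' \<in> S \<inter> Es j" by blast
      then have "j = i" using disj[OF j(1) that(2)] that(3) by blast
      then show "w' = w" using j(3) that unfolding Tr_def by blast
    qed
    have main: "\<phi> x \<in> A \<and> \<phi> (\<phi> x) = x \<and> ((case \<phi> x of (S, u) \<Rightarrow> r u < r (partner (S, u))) \<longleftrightarrow>
       \<not> (case x of (S, u) \<Rightarrow> r u < r (partner (S, u)))) \<and> t (\<phi> x) = - t x" if x: "x \<in> A" for x
    proof -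
      obtain S u where Su: "x = (S, u)" "S \<in> Tr" "u \<in> W" "u \<notin> S" using x by (auto simp: A_def)
      obtain i where i: "i \<in> ?I" "u \<in> Es i" using Su(3) by (auto simp: W_def)
      obtain w where w: "w \<in> S \<inter> Es i" "\<And>y. y \<in> S \<inter> Es i \<Longrightarrow> y = w" using Su(2) i(1) unfolding Tr_def by blast
      have pw: "partner (S, u) = w" by (rule partner_eq[OF Su(2) i w(1)])
      define R where "R = S - {w}"
      have SR: "S = insert w R" "w \<notin> R" "u \<notin> R" "u \<noteq> w" using w(1) Su(4) by (auto simp: R_def)
      have \<phi>x: "\<phi> x = (insert u R, w)" by (simp add: \<phi>_def Su(1) pw R_def)
      have RW: "R \<subseteq> W" and wW: "w \<in> W" using Su(2) w(1) by (auto simp: Tr_def R_def)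
      have R_Es: "R \<inter> Es i = {}" unfolding R_def using w(2) by blast
      have Tr': "insert u R \<in> Tr"
        unfolding Tr_def
      proof (intro CollectI conjI ballI)
        show "insert u R \<subseteq> W" using RW Su(3) by blast
        fix j assume j: "j \<in> ?I"
        show "\<exists>!y. y \<in> insert u R \<inter> Es j"
        proof (cases "j = i")
          case True
          then have "insert u R \<inter> Es j = {u}" using R_Es i(2) by blast
          then show ?thesis by simp
        next
          case False
          then have "insert u R \<inter> Es j = S \<inter> Es j" using disj[OF j i(1)] i(2) w(1) SR(1) by blast
          then show ?thesis using Su(2) j unfolding Tr_def by simp
        qed
      qed
      have pu: "partner (insert u R, w) = u"
        using w(1) by (intro partner_eq[OF Tr' i(1)]) (use i(2) in auto)
      have "\<phi> x \<in> A" unfolding \<phi>x A_def using Tr' wW SR by auto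
      moreover have "insert w (insert u R - {u}) = S" using SR by blast
      then have "\<phi> (\<phi> x) = x" unfolding \<phi>x by (simp only: \<phi>_def prod.case pu Su(1))
      moreover have ruw: "r u \<noteq> r w" using inj_r SR(4) by (auto dest: injD)
      then have "(case \<phi> x of (S, u) \<Rightarrow> r u < r (partner (S, u))) \<longleftrightarrow>
         \<not> (case x of (S, u) \<Rightarrow> r u < r (partner (S, u)))"
        unfolding \<phi>x unfolding Su(1) prod.case pu pw by auto
      moreover have "t (\<phi> x) = - t x"
      proof -
        \<comment> \<open>\<open>u\<close> and \<open>w\<close> lie in one block and
          \<open>R\<close> avoids that block. Both therefore have the same sign relative to
          \<open>R\<close>, and their mutual order supplies the single minus sign.\<close>
        have "r z < r u \<longleftrightarrow> r z < r w" if z: "z \<in> R" for z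
        proof -
          obtain j where j: "j \<in> ?I" "z \<in> Es j" using z RW by (auto simp: W_def)
          then have "j \<noteq> i" using R_Es z by blast
          then show ?thesis
            using blocks[OF j(1) i(1) _ j(2)] blocks[OF i(1) j(1) _ _ j(2)] i(2) w(1)
            by (metis Int_iff linorder_neqE_nat order_less_asym)
        qed
        then have "{z \<in> R. r z < r u} = {z \<in> R. r z < r w}" by blast
        then have "ksign R u = (ksign R w :: 'k)" by (simp add: ksign_def)
        then have "ksign (insert u R) w = - (ksign (insert w R) u :: 'k)"
          using SR ruw by (auto simp: ksign_insert)
        then show ?thesis unfolding \<phi>x unfolding Su(1) t_def prod.case using SR(1) by (simp add: insert_commute)
      qed
      ultimately show ?thesis by blast
    qed
    show ?thesis
    proof (rule sum_pairing_zero[where \<phi> = \<phi> and P = "\<lambda>(S, u). r u < r (partner (S, u))"])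
      show "finite A" unfolding A_def by simp
    next
      fix x assume "x \<in> A"
      note m = main[OF this]
      show "\<phi> x \<in> A" using m by (rule conjunct1)
      show "\<phi> (\<phi> x) = x" using m[THEN conjunct2] by (rule conjunct1)
      show "(case \<phi> x of (S, u) \<Rightarrow> r u < r (partner (S, u))) \<longleftrightarrow>
        \<not> (case x of (S, u) \<Rightarrow> r u < r (partner (S, u)))"
        using m[THEN conjunct2, THEN conjunct2] by (rule conjunct1)
      show "t (\<phi> x) = - t x" using m[THEN conjunct2, THEN conjunct2] by (rule conjunct2)
    qed
  qed
  finally show False by simp
qed

end

lemma ordering_along_blocks:
  fixes Es :: "nat \<Rightarrow> ('x::finite) set"
  assumes disj: "\<And>i j. i \<in> I \<Longrightarrow> j \<in> I \<Longrightarrow> i \<noteq> j \<Longrightarrow> Es i \<inter> Es j = {}"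
  shows "\<exists>r :: 'x \<Rightarrow> nat. inj r \<and> (\<forall>i\<in>I. \<forall>j\<in>I. \<forall>u\<in>Es i. \<forall>w\<in>Es j. i < j \<longrightarrow> r u < r w)"
proof -
  define N where "N = card (UNIV :: 'x set)"
  obtain h :: "'x \<Rightarrow> nat" where h: "bij_betw h UNIV {0..<N}"
    using ex_bij_betw_finite_nat[of "UNIV :: 'x set"] unfolding N_def by auto
  have hN: "h x < N" for x using h by (auto simp: bij_betw_def)
  define b where "b = (\<lambda>x. THE i. i \<in> I \<and> x \<in> Es i)"
  have b: "b x = i" if "i \<in> I" "x \<in> Es i" for i x
    unfolding b_def
  proof (rule the_equality)
    show "i \<in> I \<and> x \<in> Es i" using that by simp
    show "j = i" if "j \<in> I \<and> x \<in> Es j" for j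
      using that \<open>i \<in> I\<close> \<open>x \<in> Es i\<close> disj[of j i] by blast
  qed
  define r where "r = (\<lambda>x. b x * N + h x)"
  have "r x mod N = h x" for x using hN[of x] by (simp add: r_def)
  then have "inj r" using h by (metis bij_betw_def inj_def)
  moreover have "r u < r w" if "i \<in> I" "j \<in> I" "u \<in> Es i" "w \<in> Es j" "i < j" for i j u w
  proof -
    have "b u < b w" using b that by simp
    then have "(b u + 1) * N \<le> b w * N" by (intro mult_right_mono) simp_all
    then show ?thesis using hN[of u] by (simp add: r_def algebra_simps)
  qed
  ultimately show ?thesis by blast
qed

theorem proposition4p11:
  fixes H :: "'x::{finite,linorder} hypergraph"
    and I :: "('x, 'k::field) mpoly set"
    and Es :: "nat \<Rightarrow> 'x set" and s :: nat
  assumes "simple_hypergraph H" and "vertices H = UNIV"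
    and "I = edge_ideal H" and "I \<noteq> {0}" and "I \<noteq> UNIV"
    and "s \<ge> 1" and "inj_on Es {1..s}" and "induced_matching H (Es ` {1..s})"
    and "card (Es 1) = max_gen_degree I"
  shows "(int (v_number I) \<le> (\<Sum>i=1..s. (int (card (Es i)) - 1)) \<longrightarrow>
            (\<forall>k\<ge>1. int (v_number (symbolic_power I k)) \<le> reg_quotient (symbolic_power I k)))
       \<and> (strong_persistence I \<and> int (v_number I) \<le> (\<Sum>i=1..s. (int (card (Es i)) - 1)) \<longrightarrow>
            (\<forall>k\<ge>1. int (v_number (ideal_power I k)) \<le> reg_quotient (ideal_power I k)))"
proof -
  define E where "E = edges H"
  define W where "W = (\<Union>i\<in>{1..s}. Es i)"
  have I: "I = monomial_ideal (power_expos E 1)" by (simp add: assms(3) edge_ideal_eq E_def)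
  have idI: "is_ideal I" unfolding I by (rule monomial_ideal_ideal[OF power_expos_upclosed])
  have anti: "e = e'" if "e \<in> E" "e' \<in> E" "e \<subseteq> e'" for e e'
    using assms(1) that unfolding simple_hypergraph_def E_def by blast
  have im: "Es ` {1..s} \<subseteq> E" "disjoint (Es ` {1..s})" "{e \<in> E. e \<subseteq> W} = Es ` {1..s}"
    using assms(8) unfolding induced_matching_def induced_subhypergraph_def E_def W_def by auto
  have E0: "{} \<notin> E"
  proof
    assume "{} \<in> E"
    then have "m \<in> power_expos E 1" for m :: "'x expo" unfolding power_expos_1 using ind_empty by (metis (mono_tags, lifting) add_0 mem_Collect_eq)
    then have "I = UNIV" unfolding I monomial_ideal_def by blast
    then show False using assms(5) by simp
  qed
  have edge: "Es i \<in> E" if "i \<in> {1..s}" for i using im(1) that by blast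
  have ne: "Es i \<noteq> {}" if "i \<in> {1..s}" for i using edge[OF that] E0 by metis
  have disj: "Es i \<inter> Es j = {}" if "i \<in> {1..s}" "j \<in> {1..s}" "i \<noteq> j" for i j
  proof -
    have "Es i \<noteq> Es j" using assms(7) that by (auto dest: inj_onD)
    then show ?thesis using im(2) that by (auto simp: disjoint_def)
  qed
  have induced: "e \<in> Es ` {1..s}" if "e \<in> E" "e \<subseteq> (\<Union>i\<in>{1..s}. Es i)" for e
    using im(3) that unfolding W_def by blast
  obtain r :: "'x \<Rightarrow> nat" where r: "inj r"
    "\<And>i j u w. i \<in> {1..s} \<Longrightarrow> j \<in> {1..s} \<Longrightarrow> u \<in> Es i \<Longrightarrow> w \<in> Es j \<Longrightarrow> i < j \<Longrightarrow> r u < r w"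
    using ordering_along_blocks[of "{1..s}" Es, OF disj] by blast
  interpret koszul r by unfold_locales (rule r(1))
  have cardW: "card W = (\<Sum>i=1..s. card (Es i))"
    unfolding W_def using disj by (intro card_UN_disjoint) auto
  \<comment> \<open>The properties shared by ordinary and symbolic powers, with
    \<open>k = Suc l\<close>; strong persistence enters only through \<open>col\<close>.\<close>
  have main: "int (v_number (monomial_ideal M :: ('x, 'k) mpoly set)) \<le> reg_quotient (monomial_ideal M :: ('x, 'k) mpoly set)"
    if v: "int (v_number I) \<le> (\<Sum>i=1..s. (int (card (Es i)) - 1))"
      and up: "upclosed M" and zero: "0 \<notin> M"
      and ins: "\<And>m v. m \<in> M \<Longrightarrow> Suc l < lookup m v \<Longrightarrow> m - single v 1 \<in> M"
      and power_expos: "power_expos E (Suc l) \<subseteq> M" and cov: "\<And>m C. m \<in> M \<Longrightarrow> cover E C \<Longrightarrow> Suc l \<le> wt C m"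
      and col: "colon (monomial_ideal M) (monomial_ideal (power_expos E l)) = (monomial_ideal (power_expos E 1) :: ('x, 'k) mpoly set)"
    for M and l :: nat
  proof -
    have "\<not> quotient_koszul_vanish (monomial_ideal M :: ('x, 'k) mpoly set) s (int (card W + l * card (Es 1)))"
      unfolding W_def
      by (rule induced_matching_class[OF edge ne disj induced assms(6) _ power_expos up cov]) (use r(2) in auto)
    from reg_quotient_ge[OF up zero ins this]
    have reg: "int (card W + l * card (Es 1)) - int s \<le> reg_quotient (monomial_ideal M :: ('x, 'k) mpoly set)" .
    have "card e \<le> card (Es 1)" if "e \<in> E" for e
      unfolding assms(9) I by (rule card_edge_le_max_gen_degree[OF anti that])
    from v_number_le[OF E0 this monomial_ideal_ideal[OF up] col]
    have "int (v_number (monomial_ideal M :: ('x, 'k) mpoly set)) \<le> int (v_number I) + int (l * card (Es 1))"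
      unfolding I by (metis of_nat_add of_nat_le_iff)
    also have "\<dots> \<le> (\<Sum>i=1..s. (int (card (Es i)) - 1)) + int (l * card (Es 1))" using v by simp
    \<comment> \<open>The matching edges are disjoint, so the hypothesis on the v-number of
      \<open>I\<close> is measured by \<open>card W - s\<close>; the remaining terms cancel because
      \<open>card (Es 1)\<close> bounds all edge sizes.\<close>
    also have "\<dots> = int (card W + l * card (Es 1)) - int s"
      unfolding cardW by (simp add: sum_subtractf)
    also note reg
    finally show ?thesis .
  qed
  show ?thesis
  proof (intro conjI impI allI)
    fix k :: nat assume v: "int (v_number I) \<le> (\<Sum>i=1..s. (int (card (Es i)) - 1))" and "1 \<le> k"
    then obtain l where k: "k = Suc l" by (cases k) auto
    have "E \<noteq> {}" using edge[of 1] assms(6) by auto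
    from main[OF v symbolic_expos_upclosed symbolic_expos_nonzero[OF E0] symbolic_expos_insensitive power_expos_subset_symbolic_expos symbolic_expos_cover symbolic_expos_colon[OF this]]
    show "int (v_number (symbolic_power I k)) \<le> reg_quotient (symbolic_power I k)"
      unfolding I symbolic_power_eq k .
  next
    fix k :: nat assume "strong_persistence I \<and> int (v_number I) \<le> (\<Sum>i=1..s. (int (card (Es i)) - 1))" and "1 \<le> k"
    then obtain l where k: "k = Suc l" and sp: "strong_persistence I"
      and v: "int (v_number I) \<le> (\<Sum>i=1..s. (int (card (Es i)) - 1))" by (cases k) auto
    have "colon (monomial_ideal (power_expos E (Suc l))) (monomial_ideal (power_expos E l)) = (monomial_ideal (power_expos E 1) :: ('x, 'k) mpoly set)"
      using strong_persistence_colon[OF idI sp, of l] unfolding I ideal_power_eq .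
    from main[OF v power_expos_upclosed power_expos_nonzero[OF E0] power_expos_insensitive subset_refl power_expos_cover this]
    show "int (v_number (ideal_power I k)) \<le> reg_quotient (ideal_power I k)"
      unfolding I ideal_power_eq k .
  qed
qed

end
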